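(* Let $s_1,s_2\in\overline{\mathbf R_\flat}$, $s=(s_2,s_1)$, $W=\mathbf C^{d_2}\times\mathbf C^{d_1}$, and let $T_\diamond$ be the map from $\widehat{\mathcal A}_0(W)\times\widehat{\mathcal A}_0(W)$ to $\widehat{\mathcal A}_0(W)$ given by $T_\diamond(K_1,K_2)=K_1\diamond K_2$, where $$(K_1\diamond K_2)(z_2,z_1)=\sum_{\alpha_1\in\mathbf N^{d_1}}\sum_{\alpha_2\in\mathbf N^{d_2}}c(K_1;\alpha_2,\alpha_1)\frac{\partial_{z_2}^{\alpha_2}\partial_{\overline{z_1}}^{\alpha_1}K_2(z_2,z_1)}{(\alpha_1!\,\alpha_2!)^{1/2}}.$$ If $s_1,s_2<\frac12$, then $T_\diamond$ is uniquely extendable to continuous mappings $$\widehat{\mathcal A}_s(W)\times\widehat{\mathcal A}_s^\star(W)\to\widehat{\mathcal A}_s^\star(W),\qquad \widehat{\mathcal A}_s^\star(W)\times\widehat{\mathcal A}_s(W)\to\widehat{\mathcal A}_s(W),$$ $$\widehat{\mathcal B}_s(W)\times\widehat{\mathcal C}_s^\star(W)\to\widehat{\mathcal C}_s^\star(W),\qquad \widehat{\mathcal B}_s^\star(W)\times\widehat{\mathcal C}_s(W)\to\widehat{\mathcal C}_s(W),$$ $$\widehat{\mathcal C}_s(W)\times\widehat{\mathcal B}_s^\star(W)\to\widehat{\mathcal B}_s^\star(W),\qquad \widehat{\mathcal C}_s^\star(W)\times\widehat{\mathcal B}_s(W)\to\widehat{\mathcal B}_s(W).$$ If instead $0<s_1,s_2\le\frac12$,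 then the same holds true with $\widehat{\mathcal A}_{0,s}$, $\widehat{\mathcal B}_{0,s}$ and $\widehat{\mathcal C}_{0,s}$ in place of $\widehat{\mathcal A}_s$, $\widehat{\mathcal B}_s$ and $\widehat{\mathcal C}_s$, respectively, at each occurrence (and likewise for the $\star$-versions).
   Context: **Indices and weights.** $\mathbf N=\{0,1,2,\dots\}$. $\overline{\mathbf R_\flat}=[0,\infty)\cup\{\flat_\sigma:\sigma>0\}$, where the $\flat_\sigma$ are formal symbols, ordered so that $x_1<\flat_{\sigma_1}<\flat_{\sigma_2}<x_2$ whenever $x_1<\frac12\le x_2$ and $\sigma_1<\sigma_2$. For $r>0$ and a multi-index $\alpha$: $\vartheta_{r,s}(\alpha)=e^{r|\alpha|^{1/(2s)}}$ if $s\in(0,\infty)$; $\vartheta_{r,s}(\alpha)=r^{|\alpha|}(\alpha!)^{1/(2\sigma)}$ if $s=\flat_\sigma$; $\vartheta_{r,0}(\alpha)=1$ if $|\alpha|\le r$ and $=\infty$ if $|\alpha|>r$. Conventions: $a/\infty=0$ for all $a\in(0,\infty]$, $\infty\cdot0=0$. For $\omega:\Lambda\to[0,\infty]$, $\ell_{[\omega]}(\Lambda)$ is the set of $c:\Lambda\to\mathbf C$ with $\|c\,\omega\|_{\ell^p(\Lambda)}<\infty$, with this (quasi-/semi-)norm, $p\in(0,\infty]$ fixed (the limit spaces below do not depend on $p$). **Spaces.** For $\alpha=(\alpha_2,\alpha_1)\in\Lambda=\mathbf N^{d_2}\times\mathbf N^{d_1}$ put $\vartheta_r(\alpha)=\vartheta_{r,s_2}(\alpha_2)\vartheta_{r,s_1}(\alpha_1)$,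 $\omega_{r_2,r_1}(\alpha)=\vartheta_{r_2,s_2}(\alpha_2)/\vartheta_{r_1,s_1}(\alpha_1)$, $\omega^\star_{r_2,r_1}(\alpha)=\vartheta_{r_1,s_1}(\alpha_1)/\vartheta_{r_2,s_2}(\alpha_2)$. With limits over positive parameters: $\ell_{\mathcal A,s}=\operatorname{ind\,lim}_r\ell_{[\vartheta_r]}$, $\ell_{\mathcal A,s}^\star=\operatorname{proj\,lim}_r\ell_{[1/\vartheta_r]}$, $\ell_{\mathcal A,0,s}=\operatorname{proj\,lim}_r\ell_{[\vartheta_r]}$, $\ell_{\mathcal A,0,s}^\star=\operatorname{ind\,lim}_r\ell_{[1/\vartheta_r]}$; $\ell_{\mathcal B,s}=\operatorname{proj\,lim}_{r_1}\operatorname{ind\,lim}_{r_2}\ell_{[\omega_{r_2,r_1}]}$, $\ell_{\mathcal B,0,s}=\operatorname{proj\,lim}_{r_2}\operatorname{ind\,lim}_{r_1}\ell_{[\omega_{r_2,r_1}]}$, $\ell_{\mathcal B,s}^\star=\operatorname{proj\,lim}_{r_2}\operatorname{ind\,lim}_{r_1}\ell_{[\omega^\star_{r_2,r_1}]}$, $\ell_{\mathcal B,0,s}^\star=\operatorname{proj\,lim}_{r_1}\operatorname{ind\,lim}_{r_2}\ell_{[\omega^\star_{r_2,r_1}]}$; $\ell_{\mathcal C,s}=\operatorname{ind\,lim}_{r_2}\operatorname{proj\,lim}_{r_1}\ell_{[\omega_{r_2,r_1}]}$, $\ell_{\mathcal C,0,s}=\operatorname{ind\,lim}_{r_1}\operatorname{proj\,lim}_{r_2}\ell_{[\omega_{r_2,r_1}]}$,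 $\ell_{\mathcal C,s}^\star=\operatorname{ind\,lim}_{r_1}\operatorname{proj\,lim}_{r_2}\ell_{[\omega^\star_{r_2,r_1}]}$, $\ell_{\mathcal C,0,s}^\star=\operatorname{ind\,lim}_{r_2}\operatorname{proj\,lim}_{r_1}\ell_{[\omega^\star_{r_2,r_1}]}$. As sets, projective/inductive limits are intersections/unions. With $e_\alpha(z)=z^\alpha/\sqrt{\alpha!}$, the spaces $\widehat{\mathcal A}_s(W),\widehat{\mathcal A}_s^\star(W),\widehat{\mathcal B}_s(W)$, etc. consist of the formal series $K(z_2,z_1)=\sum c(K;\alpha_2,\alpha_1)e_{\alpha_2}(z_2)e_{\alpha_1}(\overline{z_1})$ with coefficients in the sequence space with the same decorations ($\ell_{\mathcal A,s},\ell_{\mathcal A,s}^\star,\ell_{\mathcal B,s}$, etc.), with transported topology. $\widehat{\mathcal A}_0(W)$ is the space of such series with finitely many non-zero coefficients.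
   Formalization: "Continuous" means separately and jointly sequentially continuous, since continuity for the product topology fails; in the A-type spaces the two factors of ϑ_r have independent parameters, which changes the spaces only when exactly one of s_1, s_2 is 0, where the claim for a single r fails. *)

theory Defs
  imports "HOL-Analysis.Analysis"
begin

section \<open>The extended index set\<close>

text \<open>
  \<open>Reg x\<close> is the real index \<open>x\<close> and \<open>Flat \<sigma>\<close> is the formal symbol \<open>\<flat>\<^sub>\<sigma>\<close>. Only the values in
  \<open>bar_R_flat\<close> are indices of the theory; the order is defined on the whole datatype.
\<close>

datatype flat_real = Reg real | Flat real

definition bar_R_flat :: "flat_real set" where
  "bar_R_flat = {Reg x | x. 0 \<le> x} \<union> {Flat \<sigma> | \<sigma>. 0 < \<sigma>}"

instantiation flat_real :: linorder
begin

fun less_flat_real :: "flat_real \<Rightarrow> flat_real \<Rightarrow> bool" where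
  "Reg x < Reg y \<longleftrightarrow> x < y"
| "Flat \<sigma> < Flat \<tau> \<longleftrightarrow> \<sigma> < \<tau>"
| "Reg x < Flat \<sigma> \<longleftrightarrow> x < 1/2"
| "Flat \<sigma> < Reg x \<longleftrightarrow> 1/2 \<le> x"

definition less_eq_flat_real :: "flat_real \<Rightarrow> flat_real \<Rightarrow> bool" where
  "a \<le> b \<longleftrightarrow> a < b \<or> (a :: flat_real) = b"

instance
proof
  fix a b c :: flat_real
  show "a < b \<longleftrightarrow> a \<le> b \<and> \<not> b \<le> a"
    by (cases a; cases b) (auto simp: less_eq_flat_real_def)
  show "a \<le> a"
    by (simp add: less_eq_flat_real_def)
  show "a \<le> b \<Longrightarrow> b \<le> c \<Longrightarrow> a \<le> c"
    by (cases a; cases b; cases c) (auto simp: less_eq_flat_real_def)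
  show "a \<le> b \<Longrightarrow> b \<le> a \<Longrightarrow> a = b"
    by (cases a; cases b) (auto simp: less_eq_flat_real_def)
  show "a \<le> b \<or> b \<le> a"
    by (cases a; cases b) (auto simp: less_eq_flat_real_def)
qed

end


section \<open>Multi-indices and weights\<close>

definition mi_abs :: "nat ^ 'd \<Rightarrow> nat" where
  "mi_abs \<alpha> = (\<Sum>i\<in>UNIV. \<alpha> $ i)"

definition mi_fact :: "nat ^ 'd \<Rightarrow> real" where
  "mi_fact \<alpha> = (\<Prod>i\<in>UNIV. fact (\<alpha> $ i))"

text \<open>The pair \<open>\<alpha> = (\<alpha>\<^sub>2, \<alpha>\<^sub>1)\<close> is an element of \<open>\<Lambda>\<close>, and \<open>\<alpha>!\<close> is \<open>\<alpha>\<^sub>2! \<alpha>\<^sub>1!\<close>.\<close>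

type_synonym ('d2, 'd1) mi2 = "(nat ^ 'd2) \<times> (nat ^ 'd1)"

definition mi2_fact :: "('d2::finite, 'd1::finite) mi2 \<Rightarrow> real" where
  "mi2_fact \<alpha> = mi_fact (fst \<alpha>) * mi_fact (snd \<alpha>)"

fun theta :: "real \<Rightarrow> flat_real \<Rightarrow> nat ^ 'd \<Rightarrow> ennreal" where
  "theta r (Reg x) \<alpha> =
     (if x = 0 then (if real (mi_abs \<alpha>) \<le> r then 1 else \<infinity>)
      else ennreal (exp (r * real (mi_abs \<alpha>) powr (1 / (2 * x)))))"
| "theta r (Flat \<sigma>) \<alpha> = ennreal (r ^ mi_abs \<alpha> * mi_fact \<alpha> powr (1 / (2 * \<sigma>)))"

text \<open>
  In all weights below \<open>s\<close> is the pair \<open>(s\<^sub>2, s\<^sub>1)\<close>. Division and multiplication in \<^typ>\<open>ennreal\<close>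
  satisfy \<open>a / \<infinity> = 0\<close> for every \<open>a\<close>, including \<open>a = \<infinity>\<close>, and \<open>\<infinity> * 0 = 0\<close>.
\<close>

definition theta2 :: "flat_real \<times> flat_real \<Rightarrow> real \<times> real
    \<Rightarrow> ('d2::finite, 'd1::finite) mi2 \<Rightarrow> ennreal" where
  "theta2 s r \<alpha> = theta (fst r) (fst s) (fst \<alpha>) * theta (snd r) (snd s) (snd \<alpha>)"

definition omega :: "flat_real \<times> flat_real \<Rightarrow> real \<Rightarrow> real
    \<Rightarrow> ('d2::finite, 'd1::finite) mi2 \<Rightarrow> ennreal" where
  "omega s r2 r1 \<alpha> = theta r2 (fst s) (fst \<alpha>) / theta r1 (snd s) (snd \<alpha>)"

definition omega_star :: "flat_real \<times> flat_real \<Rightarrow> real \<Rightarrow> real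
    \<Rightarrow> ('d2::finite, 'd1::finite) mi2 \<Rightarrow> ennreal" where
  "omega_star s r2 r1 \<alpha> = theta r1 (snd s) (snd \<alpha>) / theta r2 (fst s) (fst \<alpha>)"


section \<open>Weighted sequence spaces\<close>

definition ennreal_powr :: "ennreal \<Rightarrow> real \<Rightarrow> ennreal" where
  "ennreal_powr x a = (if x = \<infinity> then \<infinity> else ennreal (enn2real x powr a))"

text \<open>The \<open>\<ell>\<^sup>p\<close> (quasi-)norm of a \<open>[0, \<infinity>]\<close>-valued family, \<open>0 < p \<le> \<infinity>\<close>.\<close>

definition lp_norm :: "ennreal \<Rightarrow> ('a \<Rightarrow> ennreal) \<Rightarrow> ennreal" where
  "lp_norm p f =
     (if p = \<infinity> then (SUP \<alpha>. f \<alpha>)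
      else ennreal_powr (\<Sum>\<^sub>\<infinity>\<alpha>\<in>UNIV. ennreal_powr (f \<alpha>) (enn2real p)) (1 / enn2real p))"

definition ell_norm :: "ennreal \<Rightarrow> ('a \<Rightarrow> ennreal) \<Rightarrow> ('a \<Rightarrow> complex) \<Rightarrow> ennreal" where
  "ell_norm p \<omega> c = lp_norm p (\<lambda>\<alpha>. ennreal (norm (c \<alpha>)) * \<omega> \<alpha>)"

definition ell_set :: "ennreal \<Rightarrow> ('a \<Rightarrow> ennreal) \<Rightarrow> ('a \<Rightarrow> complex) set" where
  "ell_set p \<omega> = {c. ell_norm p \<omega> c < \<infinity>}"

definition ell :: "ennreal \<Rightarrow> ('a \<Rightarrow> ennreal) \<Rightarrow> ('a \<Rightarrow> complex) topology" where
  "ell p \<omega> = topology (\<lambda>U. U \<subseteq> ell_set p \<omega> \<and>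
     (\<forall>c\<in>U. \<exists>\<epsilon>>0. \<forall>d\<in>ell_set p \<omega>. ell_norm p \<omega> (\<lambda>\<alpha>. d \<alpha> - c \<alpha>) < ennreal \<epsilon> \<longrightarrow> d \<in> U))"

lemma openin_ell:
  "openin (ell p \<omega>) U \<longleftrightarrow> U \<subseteq> ell_set p \<omega> \<and>
     (\<forall>c\<in>U. \<exists>\<epsilon>>0. \<forall>d\<in>ell_set p \<omega>. ell_norm p \<omega> (\<lambda>\<alpha>. d \<alpha> - c \<alpha>) < ennreal \<epsilon> \<longrightarrow> d \<in> U)"
proof -
  let ?N = "\<lambda>d c. ell_norm p \<omega> (\<lambda>\<alpha>. d \<alpha> - c \<alpha>)"
  let ?P = "\<lambda>U. U \<subseteq> ell_set p \<omega> \<and>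
     (\<forall>c\<in>U. \<exists>\<epsilon>>0. \<forall>d\<in>ell_set p \<omega>. ?N d c < ennreal \<epsilon> \<longrightarrow> d \<in> U)"
  have "istopology ?P"
    unfolding istopology_def
  proof (intro conjI allI impI)
    fix S T assume S: "?P S" and T: "?P T"
    show "S \<inter> T \<subseteq> ell_set p \<omega>" using S by blast
    show "\<forall>c\<in>S \<inter> T. \<exists>\<epsilon>>0. \<forall>d\<in>ell_set p \<omega>. ?N d c < ennreal \<epsilon> \<longrightarrow> d \<in> S \<inter> T"
    proof
      fix c assume c: "c \<in> S \<inter> T"
      obtain e where e: "e > 0" "\<forall>d\<in>ell_set p \<omega>. ?N d c < ennreal e \<longrightarrow> d \<in> S"
        using S c by blast
      obtain e' where e': "e' > 0" "\<forall>d\<in>ell_set p \<omega>. ?N d c < ennreal e' \<longrightarrow> d \<in> T"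
        using T c by blast
      have "?N d c < ennreal e \<and> ?N d c < ennreal e'" if "?N d c < ennreal (min e e')" for d
        using that e(1) e'(1) by (meson ennreal_leI less_le_trans min.cobounded1 min.cobounded2)
      then show "\<exists>\<epsilon>>0. \<forall>d\<in>ell_set p \<omega>. ?N d c < ennreal \<epsilon> \<longrightarrow> d \<in> S \<inter> T"
        using e e' by (intro exI[of _ "min e e'"]) auto
    qed
  next
    fix K assume K: "\<forall>S\<in>K. ?P S"
    show "\<Union>K \<subseteq> ell_set p \<omega>" using K by blast
    show "\<forall>c\<in>\<Union>K. \<exists>\<epsilon>>0. \<forall>d\<in>ell_set p \<omega>. ?N d c < ennreal \<epsilon> \<longrightarrow> d \<in> \<Union>K"
      using K by (meson UnionE UnionI)
  qed
  then show ?thesis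
    unfolding ell_def by (simp add: topology_inverse')
qed

lemma topspace_ell [simp]: "topspace (ell p \<omega>) = ell_set p \<omega>"
proof -
  have "openin (ell p \<omega>) (ell_set p \<omega>)"
    unfolding openin_ell using zero_less_one by blast
  moreover have "topspace (ell p \<omega>) \<subseteq> ell_set p \<omega>"
    using openin_topspace[of "ell p \<omega>"] unfolding openin_ell by (rule conjunct1)
  ultimately show ?thesis
    by (metis openin_subset subset_antisym)
qed


section \<open>Projective and inductive limits\<close>

definition proj_lim :: "'i set \<Rightarrow> ('i \<Rightarrow> 'b topology) \<Rightarrow> 'b topology" where
  "proj_lim I X = topology_generated_by
     {U \<inter> (\<Inter>i\<in>I. topspace (X i)) | i U. i \<in> I \<and> openin (X i) U}"

definition abs_convex :: "('a \<Rightarrow> complex) set \<Rightarrow> bool" where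
  "abs_convex V \<longleftrightarrow> (\<forall>c\<in>V. \<forall>d\<in>V. \<forall>a b. norm a + norm b \<le> 1 \<longrightarrow> (\<lambda>\<alpha>. a * c \<alpha> + b * d \<alpha>) \<in> V)"

definition nhd_zero :: "('a \<Rightarrow> complex) topology \<Rightarrow> ('a \<Rightarrow> complex) set \<Rightarrow> bool" where
  "nhd_zero X V \<longleftrightarrow> (\<exists>U. openin X U \<and> (\<lambda>_. 0) \<in> U \<and> U \<subseteq> V)"

text \<open>
  The locally convex inductive limit, that is, the finest locally convex topology on the union of
  the steps for which all inclusions are continuous: the absolutely convex sets that meet each
  step in a zero neighbourhood of that step form a base of zero neighbourhoods.
\<close>

definition ind_lim :: "'i set \<Rightarrow> ('i \<Rightarrow> ('a \<Rightarrow> complex) topology) \<Rightarrow> ('a \<Rightarrow> complex) topology" where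
  "ind_lim I X = topology (\<lambda>U. U \<subseteq> (\<Union>i\<in>I. topspace (X i)) \<and>
     (\<forall>c\<in>U. \<exists>V. abs_convex V \<and> (\<forall>i\<in>I. nhd_zero (X i) V) \<and>
        (\<forall>d\<in>(\<Union>i\<in>I. topspace (X i)). (\<lambda>\<alpha>. d \<alpha> - c \<alpha>) \<in> V \<longrightarrow> d \<in> U)))"

lemma openin_ind_lim:
  "openin (ind_lim I X) U \<longleftrightarrow> U \<subseteq> (\<Union>i\<in>I. topspace (X i)) \<and>
     (\<forall>c\<in>U. \<exists>V. abs_convex V \<and> (\<forall>i\<in>I. nhd_zero (X i) V) \<and>
        (\<forall>d\<in>(\<Union>i\<in>I. topspace (X i)). (\<lambda>\<alpha>. d \<alpha> - c \<alpha>) \<in> V \<longrightarrow> d \<in> U))"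
proof -
  let ?E = "\<Union>i\<in>I. topspace (X i)"
  let ?Q = "\<lambda>U c V. abs_convex V \<and> (\<forall>i\<in>I. nhd_zero (X i) V) \<and>
        (\<forall>d\<in>?E. (\<lambda>\<alpha>. d \<alpha> - c \<alpha>) \<in> V \<longrightarrow> d \<in> U)"
  let ?P = "\<lambda>U. U \<subseteq> ?E \<and> (\<forall>c\<in>U. \<exists>V. ?Q U c V)"
  have "istopology ?P"
    unfolding istopology_def
  proof (intro conjI allI impI)
    fix S T assume S: "?P S" and T: "?P T"
    show "S \<inter> T \<subseteq> ?E" using S by blast
    show "\<forall>c\<in>S \<inter> T. \<exists>V. ?Q (S \<inter> T) c V"
    proof
      fix c assume c: "c \<in> S \<inter> T"
      obtain V where V: "?Q S c V" using S c by blast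
      obtain V' where V': "?Q T c V'" using T c by blast
      have "nhd_zero (X i) (V \<inter> V')" if i: "i \<in> I" for i
      proof -
        obtain O1 where O1: "openin (X i) O1" "(\<lambda>_. 0) \<in> O1" "O1 \<subseteq> V"
          using V i unfolding nhd_zero_def by blast
        obtain O2 where O2: "openin (X i) O2" "(\<lambda>_. 0) \<in> O2" "O2 \<subseteq> V'"
          using V' i unfolding nhd_zero_def by blast
        show ?thesis
          unfolding nhd_zero_def using O1 O2 by (intro exI[of _ "O1 \<inter> O2"]) auto
      qed
      moreover have "abs_convex (V \<inter> V')"
        using V V' unfolding abs_convex_def by simp
      ultimately show "\<exists>V. ?Q (S \<inter> T) c V"
        using V V' by (intro exI[of _ "V \<inter> V'"]) auto
    qed
  next
    fix K assume K: "\<forall>S\<in>K. ?P S"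
    show "\<Union>K \<subseteq> ?E" using K by blast
    show "\<forall>c\<in>\<Union>K. \<exists>V. ?Q (\<Union>K) c V"
    proof
      fix c assume "c \<in> \<Union>K"
      then obtain S where S: "S \<in> K" "c \<in> S" by blast
      then obtain V where "?Q S c V" using K by blast
      then show "\<exists>V. ?Q (\<Union>K) c V" using S(1) by (intro exI[of _ V]) blast
    qed
  qed
  then show ?thesis
    unfolding ind_lim_def by (simp add: topology_inverse')
qed

lemma topspace_ind_lim:
  fixes X :: "'i \<Rightarrow> ('b \<Rightarrow> complex) topology"
  assumes "\<And>i. i \<in> I \<Longrightarrow> (\<lambda>_. 0) \<in> topspace (X i)"
  shows "topspace (ind_lim I X) = (\<Union>i\<in>I. topspace (X i))"
proof -
  have "\<forall>i\<in>I. nhd_zero (X i) UNIV"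
    unfolding nhd_zero_def using assms by blast
  moreover have "abs_convex (UNIV :: ('b \<Rightarrow> complex) set)"
    by (simp add: abs_convex_def)
  ultimately have "openin (ind_lim I X) (\<Union>i\<in>I. topspace (X i))"
    unfolding openin_ind_lim by blast
  moreover have "topspace (ind_lim I X) \<subseteq> (\<Union>i\<in>I. topspace (X i))"
    using openin_topspace[of "ind_lim I X"] unfolding openin_ind_lim by (rule conjunct1)
  ultimately show ?thesis
    by (metis openin_subset subset_antisym)
qed

lemma topspace_proj_lim:
  assumes "I \<noteq> {}"
  shows "topspace (proj_lim I X) = (\<Inter>i\<in>I. topspace (X i))"
proof -
  have "(\<Union>{U \<inter> (\<Inter>i\<in>I. topspace (X i)) | i U. i \<in> I \<and> openin (X i) U}) = (\<Inter>i\<in>I. topspace (X i))"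
    (is "\<Union>?S = ?E")
  proof
    obtain i where i: "i \<in> I" using assms by blast
    then have "topspace (X i) \<inter> ?E \<in> ?S" by blast
    then show "?E \<subseteq> \<Union>?S" using i by blast
  qed blast
  then show ?thesis unfolding proj_lim_def topology_generated_by_topspace .
qed


section \<open>The sequence spaces\<close>

text \<open>
  In the \<open>\<A>\<close>-spaces the parameters \<open>r\<^sub>2\<close> and \<open>r\<^sub>1\<close> of the two factors of \<open>\<vartheta>\<^sub>r\<close> run independently
  of each other. If both or none of \<open>s\<^sub>2, s\<^sub>1\<close> vanish, this is the same limit as the one over
  \<open>r\<^sub>2 = r\<^sub>1 = r\<close>, see the lemmas \<open>ell_A_diagonal\<close> etc. below. If exactly one of them vanishes, the
  diagonal family is not directed (\<open>\<vartheta>\<^bsub>r,s\<^esub>\<close> increases with \<open>r\<close> for \<open>s \<noteq> 0\<close> and decreases with \<open>r\<close>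
  for \<open>s = 0\<close>), and the union over it is not even a vector space.
\<close>

abbreviation pos :: "real set" where
  "pos \<equiv> {0<..}"

definition ell_A :: "ennreal \<Rightarrow> flat_real \<times> flat_real \<Rightarrow> (('d2::finite, 'd1::finite) mi2 \<Rightarrow> complex) topology" where
  "ell_A p s = ind_lim (pos \<times> pos) (\<lambda>r. ell p (theta2 s r))"

definition ell_A_star :: "ennreal \<Rightarrow> flat_real \<times> flat_real \<Rightarrow> (('d2::finite, 'd1::finite) mi2 \<Rightarrow> complex) topology" where
  "ell_A_star p s = proj_lim (pos \<times> pos) (\<lambda>r. ell p (\<lambda>\<alpha>. 1 / theta2 s r \<alpha>))"

definition ell_A0 :: "ennreal \<Rightarrow> flat_real \<times> flat_real \<Rightarrow> (('d2::finite, 'd1::finite) mi2 \<Rightarrow> complex) topology" where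
  "ell_A0 p s = proj_lim (pos \<times> pos) (\<lambda>r. ell p (theta2 s r))"

definition ell_A0_star :: "ennreal \<Rightarrow> flat_real \<times> flat_real \<Rightarrow> (('d2::finite, 'd1::finite) mi2 \<Rightarrow> complex) topology" where
  "ell_A0_star p s = ind_lim (pos \<times> pos) (\<lambda>r. ell p (\<lambda>\<alpha>. 1 / theta2 s r \<alpha>))"

definition ell_B :: "ennreal \<Rightarrow> flat_real \<times> flat_real \<Rightarrow> (('d2::finite, 'd1::finite) mi2 \<Rightarrow> complex) topology" where
  "ell_B p s = proj_lim pos (\<lambda>r1. ind_lim pos (\<lambda>r2. ell p (omega s r2 r1)))"

definition ell_B0 :: "ennreal \<Rightarrow> flat_real \<times> flat_real \<Rightarrow> (('d2::finite, 'd1::finite) mi2 \<Rightarrow> complex) topology" where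
  "ell_B0 p s = proj_lim pos (\<lambda>r2. ind_lim pos (\<lambda>r1. ell p (omega s r2 r1)))"

definition ell_B_star :: "ennreal \<Rightarrow> flat_real \<times> flat_real \<Rightarrow> (('d2::finite, 'd1::finite) mi2 \<Rightarrow> complex) topology" where
  "ell_B_star p s = proj_lim pos (\<lambda>r2. ind_lim pos (\<lambda>r1. ell p (omega_star s r2 r1)))"

definition ell_B0_star :: "ennreal \<Rightarrow> flat_real \<times> flat_real \<Rightarrow> (('d2::finite, 'd1::finite) mi2 \<Rightarrow> complex) topology" where
  "ell_B0_star p s = proj_lim pos (\<lambda>r1. ind_lim pos (\<lambda>r2. ell p (omega_star s r2 r1)))"

definition ell_C :: "ennreal \<Rightarrow> flat_real \<times> flat_real \<Rightarrow> (('d2::finite, 'd1::finite) mi2 \<Rightarrow> complex) topology" where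
  "ell_C p s = ind_lim pos (\<lambda>r2. proj_lim pos (\<lambda>r1. ell p (omega s r2 r1)))"

definition ell_C0 :: "ennreal \<Rightarrow> flat_real \<times> flat_real \<Rightarrow> (('d2::finite, 'd1::finite) mi2 \<Rightarrow> complex) topology" where
  "ell_C0 p s = ind_lim pos (\<lambda>r1. proj_lim pos (\<lambda>r2. ell p (omega s r2 r1)))"

definition ell_C_star :: "ennreal \<Rightarrow> flat_real \<times> flat_real \<Rightarrow> (('d2::finite, 'd1::finite) mi2 \<Rightarrow> complex) topology" where
  "ell_C_star p s = ind_lim pos (\<lambda>r1. proj_lim pos (\<lambda>r2. ell p (omega_star s r2 r1)))"

definition ell_C0_star :: "ennreal \<Rightarrow> flat_real \<times> flat_real \<Rightarrow> (('d2::finite, 'd1::finite) mi2 \<Rightarrow> complex) topology" where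
  "ell_C0_star p s = ind_lim pos (\<lambda>r2. proj_lim pos (\<lambda>r1. ell p (omega_star s r2 r1)))"


subsection \<open>Comparison with the diagonal limits\<close>

lemma ennreal_powr_mono:
  assumes "x \<le> y" "0 \<le> a" shows "ennreal_powr x a \<le> ennreal_powr y a"
proof (cases "y = \<infinity>")
  case False
  then have "enn2real x \<le> enn2real y"
    using assms(1) by (simp add: enn2real_mono less_top)
  then show ?thesis
    using assms False unfolding ennreal_powr_def
    by (auto simp: top_unique intro!: ennreal_leI powr_mono2)
qed (simp add: ennreal_powr_def)

lemma ell_norm_mono:
  assumes "\<And>\<alpha>. \<omega>' \<alpha> \<le> \<omega> \<alpha>" shows "ell_norm p \<omega>' c \<le> ell_norm p \<omega> c"
proof -
  have le: "ennreal (norm (c \<alpha>)) * \<omega>' \<alpha> \<le> ennreal (norm (c \<alpha>)) * \<omega> \<alpha>" for \<alpha>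
    using assms by (simp add: mult_left_mono)
  show ?thesis
    unfolding ell_norm_def lp_norm_def
    using le by (auto intro!: SUP_mono' ennreal_powr_mono infsum_mono nonneg_summable_on_complete)
qed

lemma ell_norm_zero: "0 < p \<Longrightarrow> ell_norm p \<omega> (\<lambda>_. 0) = 0"
  by (auto simp: ell_norm_def lp_norm_def ennreal_powr_def)

lemma zero_in_ell_set: "0 < p \<Longrightarrow> (\<lambda>_. 0) \<in> ell_set p \<omega>"
  by (simp add: ell_set_def ell_norm_zero)

lemma ell_set_mono:
  assumes "\<And>\<alpha>. \<omega>' \<alpha> \<le> \<omega> \<alpha>" shows "ell_set p \<omega> \<subseteq> ell_set p \<omega>'"
  unfolding ell_set_def using ell_norm_mono[of \<omega>' \<omega>] assms by (auto intro: le_less_trans)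

lemma openin_ell_mono:
  assumes le: "\<And>\<alpha>. \<omega>' \<alpha> \<le> \<omega> \<alpha>" and U: "openin (ell p \<omega>') U"
  shows "openin (ell p \<omega>) (U \<inter> ell_set p \<omega>)"
  unfolding openin_ell
proof (intro conjI ballI)
  fix c assume c: "c \<in> U \<inter> ell_set p \<omega>"
  then obtain e where e: "e > 0"
    "\<And>d. d \<in> ell_set p \<omega>' \<Longrightarrow> ell_norm p \<omega>' (\<lambda>\<alpha>. d \<alpha> - c \<alpha>) < ennreal e \<Longrightarrow> d \<in> U"
    using U unfolding openin_ell by blast
  show "\<exists>\<epsilon>>0. \<forall>d\<in>ell_set p \<omega>. ell_norm p \<omega> (\<lambda>\<alpha>. d \<alpha> - c \<alpha>) < ennreal \<epsilon> \<longrightarrow> d \<in> U \<inter> ell_set p \<omega>"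
    using e ell_set_mono[of \<omega>' \<omega> p] ell_norm_mono[of \<omega>' \<omega> p] le
    by (intro exI[of _ e]) (auto intro: le_less_trans)
qed blast

definition finer_step :: "'b topology \<Rightarrow> 'b topology \<Rightarrow> bool" where
  "finer_step X Y \<longleftrightarrow> topspace X \<subseteq> topspace Y \<and> continuous_map X Y id"

lemma finer_step_ell:
  assumes "\<And>\<alpha>. \<omega>' \<alpha> \<le> \<omega> \<alpha>" shows "finer_step (ell p \<omega>) (ell p \<omega>')"
proof -
  have "{x \<in> ell_set p \<omega>. x \<in> U} = U \<inter> ell_set p \<omega>" for U by blast
  then show ?thesis
    using ell_set_mono[of \<omega>' \<omega> p] openin_ell_mono[of \<omega>' \<omega> p] assms
    unfolding finer_step_def continuous_map_def by auto
qed

lemma ind_lim_cofinal: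
  fixes X :: "'i \<Rightarrow> ('a \<Rightarrow> complex) topology" and Y :: "'j \<Rightarrow> ('a \<Rightarrow> complex) topology"
  assumes zero: "\<And>i. i \<in> I \<Longrightarrow> (\<lambda>_. 0) \<in> topspace (X i)" "\<And>j. j \<in> J \<Longrightarrow> (\<lambda>_. 0) \<in> topspace (Y j)"
    and XY: "\<And>i. i \<in> I \<Longrightarrow> \<exists>j\<in>J. finer_step (X i) (Y j)"
    and YX: "\<And>j. j \<in> J \<Longrightarrow> \<exists>i\<in>I. finer_step (Y j) (X i)"
  shows "ind_lim I X = ind_lim J Y"
proof -
  have E: "(\<Union>i\<in>I. topspace (X i)) = (\<Union>j\<in>J. topspace (Y j))"
    using XY YX unfolding finer_step_def by blast
  have tr: "nhd_zero A V" if AB: "finer_step A B" and z: "(\<lambda>_. 0) \<in> topspace A" and B: "nhd_zero B V"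
    for A B and V :: "('a \<Rightarrow> complex) set"
  proof -
    obtain U where U: "openin B U" "(\<lambda>_. 0) \<in> U" "U \<subseteq> V"
      using B unfolding nhd_zero_def by blast
    have "openin A {x \<in> topspace A. id x \<in> U}"
      using AB U(1) unfolding finer_step_def continuous_map_def by blast
    then show ?thesis
      unfolding nhd_zero_def using U z by (intro exI[of _ "{x \<in> topspace A. id x \<in> U}"]) auto
  qed
  have "(\<forall>i\<in>I. nhd_zero (X i) V) \<longleftrightarrow> (\<forall>j\<in>J. nhd_zero (Y j) V)" for V
  proof (intro iffI ballI)
    fix j assume V: "\<forall>i\<in>I. nhd_zero (X i) V" and j: "j \<in> J"
    obtain i where "i \<in> I" "finer_step (Y j) (X i)" using YX[OF j] by blast
    then show "nhd_zero (Y j) V" using tr[OF _ zero(2)[OF j]] V by blast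
  next
    fix i assume V: "\<forall>j\<in>J. nhd_zero (Y j) V" and i: "i \<in> I"
    obtain j where "j \<in> J" "finer_step (X i) (Y j)" using XY[OF i] by blast
    then show "nhd_zero (X i) V" using tr[OF _ zero(1)[OF i]] V by blast
  qed
  then show ?thesis
    unfolding topology_eq openin_ind_lim E by simp
qed

lemma openin_proj_lim_le:
  assumes ne: "J \<noteq> {}" and YX: "\<And>i. i \<in> I \<Longrightarrow> \<exists>j\<in>J. finer_step (Y j) (X i)"
    and E: "(\<Inter>i\<in>I. topspace (X i)) = (\<Inter>j\<in>J. topspace (Y j))"
    and U: "openin (proj_lim I X) U"
  shows "openin (proj_lim J Y) U"
proof -
  have "openin (proj_lim J Y) (W \<inter> (\<Inter>i\<in>I. topspace (X i)))" if i: "i \<in> I" and W: "openin (X i) W" for i W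
  proof -
    obtain j where j: "j \<in> J" "finer_step (Y j) (X i)" using YX i by blast
    let ?W = "{x \<in> topspace (Y j). id x \<in> W}"
    have "openin (Y j) ?W"
      using j(2) W unfolding finer_step_def continuous_map_def by blast
    then have "openin (proj_lim J Y) (?W \<inter> (\<Inter>j\<in>J. topspace (Y j)))"
      unfolding proj_lim_def using j(1) by (intro topology_generated_by_Basis) blast
    moreover have "?W \<inter> (\<Inter>j\<in>J. topspace (Y j)) = W \<inter> (\<Inter>i\<in>I. topspace (X i))"
      unfolding E using j(1) by auto
    ultimately show ?thesis by simp
  qed
  then have basis: "openin (proj_lim J Y) S"
    if "S \<in> {U \<inter> (\<Inter>i\<in>I. topspace (X i)) | i U. i \<in> I \<and> openin (X i) U}" for S
    using that by blast
  have "generate_topology_on {U \<inter> (\<Inter>i\<in>I. topspace (X i)) | i U. i \<in> I \<and> openin (X i) U} U"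
    using U unfolding proj_lim_def openin_topology_generated_by_iff .
  from generate_topology_on_coarsest[of "openin (proj_lim J Y)", OF istopology_openin basis this]
  show ?thesis by blast
qed

lemma proj_lim_cofinal:
  assumes "I \<noteq> {}" "J \<noteq> {}"
    and XY: "\<And>j. j \<in> J \<Longrightarrow> \<exists>i\<in>I. finer_step (X i) (Y j)"
    and YX: "\<And>i. i \<in> I \<Longrightarrow> \<exists>j\<in>J. finer_step (Y j) (X i)"
  shows "proj_lim I X = proj_lim J Y"
proof -
  have E: "(\<Inter>i\<in>I. topspace (X i)) = (\<Inter>j\<in>J. topspace (Y j))"
    using XY YX unfolding finer_step_def by blast
  show ?thesis
    unfolding topology_eq
    using openin_proj_lim_le[where I=I and J=J and X=X and Y=Y, OF assms(2) YX E]
      openin_proj_lim_le[where I=J and J=I and X=Y and Y=X, OF assms(1) XY E[symmetric]] by blast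
qed

lemma mi_fact_ge_1: "1 \<le> mi_fact \<alpha>"
  unfolding mi_fact_def by (intro prod_ge_1) simp

lemma theta_mono:
  assumes "s \<in> bar_R_flat" "s \<noteq> Reg 0" "0 < r" "r \<le> r'"
  shows "theta r s \<alpha> \<le> theta r' s \<alpha>"
proof (cases s)
  case (Reg x)
  then show ?thesis using assms
    by (auto intro!: ennreal_leI mult_right_mono)
next
  case (Flat \<sigma>)
  then show ?thesis using assms mi_fact_ge_1[of \<alpha>]
    by (auto intro!: ennreal_leI mult_right_mono power_mono)
qed

lemma theta_antimono:
  assumes "r \<le> r'" shows "theta r' (Reg 0) \<alpha> \<le> theta r (Reg 0) \<alpha>"
  using assms by auto

lemma theta2_cofinal:
  fixes s :: "flat_real \<times> flat_real"
  assumes s: "fst s \<in> bar_R_flat" "snd s \<in> bar_R_flat" "fst s = Reg 0 \<longleftrightarrow> snd s = Reg 0"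
    and r: "r \<in> pos \<times> pos"
  shows "\<exists>\<rho>\<in>pos. \<forall>\<alpha>. theta2 s (\<rho>, \<rho>) \<alpha> \<le> theta2 s r \<alpha>"
    and "\<exists>\<rho>\<in>pos. \<forall>\<alpha>. theta2 s r \<alpha> \<le> theta2 s (\<rho>, \<rho>) \<alpha>"
proof -
  let ?m = "min (fst r) (snd r)" and ?M = "max (fst r) (snd r)"
  have pos: "0 < fst r" "0 < snd r" "?m \<in> pos" "?M \<in> pos" using r by auto
  show "\<exists>\<rho>\<in>pos. \<forall>\<alpha>. theta2 s (\<rho>, \<rho>) \<alpha> \<le> theta2 s r \<alpha>"
  proof (cases "fst s = Reg 0")
    case True
    then have "\<forall>\<alpha>. theta2 s (?M, ?M) \<alpha> \<le> theta2 s r \<alpha>"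
      using s(3) unfolding theta2_def
      by (auto intro!: mult_mono theta_antimono simp del: theta.simps)
    then show ?thesis using pos by blast
  next
    case False
    then have "\<forall>\<alpha>. theta2 s (?m, ?m) \<alpha> \<le> theta2 s r \<alpha>"
      using s pos unfolding theta2_def
      by (auto intro!: mult_mono theta_mono simp del: theta.simps)
    then show ?thesis using pos by blast
  qed
  show "\<exists>\<rho>\<in>pos. \<forall>\<alpha>. theta2 s r \<alpha> \<le> theta2 s (\<rho>, \<rho>) \<alpha>"
  proof (cases "fst s = Reg 0")
    case True
    then have "\<forall>\<alpha>. theta2 s r \<alpha> \<le> theta2 s (?m, ?m) \<alpha>"
      using s(3) unfolding theta2_def
      by (auto intro!: mult_mono theta_antimono simp del: theta.simps)
    then show ?thesis using pos by blast
  next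
    case False
    then have "\<forall>\<alpha>. theta2 s r \<alpha> \<le> theta2 s (?M, ?M) \<alpha>"
      using s pos unfolding theta2_def
      by (auto intro!: mult_mono theta_mono simp del: theta.simps)
    then show ?thesis using pos by blast
  qed
qed

lemma one_divide_ennreal_mono: "a \<le> b \<Longrightarrow> 1 / b \<le> 1 / (a :: ennreal)"
  unfolding divide_ennreal_def
  by (rule mult_left_mono)
    (simp_all add: less_eq_ennreal.rep_eq[of "inverse b"] less_eq_ennreal.rep_eq[of a]
      inverse_ennreal.rep_eq ereal_inverse_antimono)

lemma finer_step_refl: "finer_step X X"
  by (simp add: finer_step_def)

context
  fixes p :: ennreal and s :: "flat_real \<times> flat_real"
  assumes p: "0 < p"
    and s: "fst s \<in> bar_R_flat" "snd s \<in> bar_R_flat" "fst s = Reg 0 \<longleftrightarrow> snd s = Reg 0"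
begin

lemma ell_A_diagonal:
  "(ell_A p s :: (('d2::finite, 'd1::finite) mi2 \<Rightarrow> complex) topology) = ind_lim pos (\<lambda>r. ell p (theta2 s (r, r)))"
  unfolding ell_A_def
proof (rule ind_lim_cofinal)
  fix r :: "real \<times> real" assume "r \<in> pos \<times> pos"
  then obtain \<rho> where "\<rho> \<in> pos" "\<And>\<alpha> :: ('d2, 'd1) mi2. theta2 s (\<rho>, \<rho>) \<alpha> \<le> theta2 s r \<alpha>"
    using theta2_cofinal(1)[OF s, of r] by auto
  then show "\<exists>\<rho>\<in>pos. finer_step (ell p (theta2 s r :: ('d2, 'd1) mi2 \<Rightarrow> ennreal)) (ell p (theta2 s (\<rho>, \<rho>)))"
    by (intro bexI[of _ \<rho>] finer_step_ell) simp_all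
next
  fix \<rho> :: real assume "\<rho> \<in> pos"
  then show "\<exists>r\<in>pos \<times> pos. finer_step (ell p (theta2 s (\<rho>, \<rho>) :: ('d2, 'd1) mi2 \<Rightarrow> ennreal)) (ell p (theta2 s r))"
    by (intro bexI[of _ "(\<rho>, \<rho>)"] finer_step_refl) auto
qed (simp_all add: zero_in_ell_set p)

lemma ell_A0_star_diagonal:
  "(ell_A0_star p s :: (('d2::finite, 'd1::finite) mi2 \<Rightarrow> complex) topology) = ind_lim pos (\<lambda>r. ell p (\<lambda>\<alpha>. 1 / theta2 s (r, r) \<alpha>))"
  unfolding ell_A0_star_def
proof (rule ind_lim_cofinal)
  fix r :: "real \<times> real" assume "r \<in> pos \<times> pos"
  then obtain \<rho> where "\<rho> \<in> pos" "\<And>\<alpha> :: ('d2, 'd1) mi2. theta2 s r \<alpha> \<le> theta2 s (\<rho>, \<rho>) \<alpha>"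
    using theta2_cofinal(2)[OF s, of r] by auto
  then show "\<exists>\<rho>\<in>pos. finer_step (ell p (\<lambda>\<alpha> :: ('d2, 'd1) mi2. 1 / theta2 s r \<alpha>)) (ell p (\<lambda>\<alpha>. 1 / theta2 s (\<rho>, \<rho>) \<alpha>))"
    by (intro bexI[of _ \<rho>] finer_step_ell one_divide_ennreal_mono) simp_all
next
  fix \<rho> :: real assume "\<rho> \<in> pos"
  then show "\<exists>r\<in>pos \<times> pos. finer_step (ell p (\<lambda>\<alpha> :: ('d2, 'd1) mi2. 1 / theta2 s (\<rho>, \<rho>) \<alpha>)) (ell p (\<lambda>\<alpha>. 1 / theta2 s r \<alpha>))"
    by (intro bexI[of _ "(\<rho>, \<rho>)"] finer_step_refl) auto
qed (simp_all add: zero_in_ell_set p)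

lemma ell_A0_diagonal:
  "(ell_A0 p s :: (('d2::finite, 'd1::finite) mi2 \<Rightarrow> complex) topology) = proj_lim pos (\<lambda>r. ell p (theta2 s (r, r)))"
  unfolding ell_A0_def
proof (rule proj_lim_cofinal)
  fix r :: "real \<times> real" assume "r \<in> pos \<times> pos"
  then obtain \<rho> where "\<rho> \<in> pos" "\<And>\<alpha> :: ('d2, 'd1) mi2. theta2 s r \<alpha> \<le> theta2 s (\<rho>, \<rho>) \<alpha>"
    using theta2_cofinal(2)[OF s, of r] by auto
  then show "\<exists>\<rho>\<in>pos. finer_step (ell p (theta2 s (\<rho>, \<rho>) :: ('d2, 'd1) mi2 \<Rightarrow> ennreal)) (ell p (theta2 s r))"
    by (intro bexI[of _ \<rho>] finer_step_ell) simp_all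
next
  fix \<rho> :: real assume "\<rho> \<in> pos"
  then show "\<exists>r\<in>pos \<times> pos. finer_step (ell p (theta2 s r :: ('d2, 'd1) mi2 \<Rightarrow> ennreal)) (ell p (theta2 s (\<rho>, \<rho>)))"
    by (intro bexI[of _ "(\<rho>, \<rho>)"] finer_step_refl) auto
next
  show "pos \<noteq> {}" "pos \<times> pos \<noteq> {}"
    using greaterThan_non_empty by blast+
qed

lemma ell_A_star_diagonal:
  "(ell_A_star p s :: (('d2::finite, 'd1::finite) mi2 \<Rightarrow> complex) topology) = proj_lim pos (\<lambda>r. ell p (\<lambda>\<alpha>. 1 / theta2 s (r, r) \<alpha>))"
  unfolding ell_A_star_def
proof (rule proj_lim_cofinal)
  fix r :: "real \<times> real" assume "r \<in> pos \<times> pos"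
  then obtain \<rho> where "\<rho> \<in> pos" "\<And>\<alpha> :: ('d2, 'd1) mi2. theta2 s (\<rho>, \<rho>) \<alpha> \<le> theta2 s r \<alpha>"
    using theta2_cofinal(1)[OF s, of r] by auto
  then show "\<exists>\<rho>\<in>pos. finer_step (ell p (\<lambda>\<alpha> :: ('d2, 'd1) mi2. 1 / theta2 s (\<rho>, \<rho>) \<alpha>)) (ell p (\<lambda>\<alpha>. 1 / theta2 s r \<alpha>))"
    by (intro bexI[of _ \<rho>] finer_step_ell one_divide_ennreal_mono) simp_all
next
  fix \<rho> :: real assume "\<rho> \<in> pos"
  then show "\<exists>r\<in>pos \<times> pos. finer_step (ell p (\<lambda>\<alpha> :: ('d2, 'd1) mi2. 1 / theta2 s r \<alpha>)) (ell p (\<lambda>\<alpha>. 1 / theta2 s (\<rho>, \<rho>) \<alpha>))"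
    by (intro bexI[of _ "(\<rho>, \<rho>)"] finer_step_refl) auto
next
  show "pos \<noteq> {}" "pos \<times> pos \<noteq> {}"
    using greaterThan_non_empty by blast+
qed

end


section \<open>Formal series\<close>

text \<open>
  A formal series in \<open>(z\<^sub>2, cnj z\<^sub>1)\<close> is given by its coefficients with respect to the monomials
  \<open>z\<^sub>2\<^bsup>\<alpha>\<^sub>2\<^esup> (cnj z\<^sub>1)\<^bsup>\<alpha>\<^sub>1\<^esup>\<close>. Since \<open>e\<^sub>\<alpha>(z) = z\<^sup>\<alpha> / sqrt \<alpha>!\<close>, the coefficient \<open>c(K; \<alpha>)\<close> of
  \<open>e\<^bsub>\<alpha>\<^sub>2\<^esub>(z\<^sub>2) e\<^bsub>\<alpha>\<^sub>1\<^esub>(cnj z\<^sub>1)\<close> is the monomial coefficient times \<open>sqrt (\<alpha>\<^sub>2! \<alpha>\<^sub>1!)\<close>.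
\<close>

type_synonym ('d2, 'd1) fseries = "('d2, 'd1) mi2 \<Rightarrow> complex"

definition coeff_c :: "('d2::finite, 'd1::finite) fseries \<Rightarrow> ('d2, 'd1) mi2 \<Rightarrow> complex" where
  "coeff_c K = (\<lambda>\<alpha>. K \<alpha> * of_real (sqrt (mi2_fact \<alpha>)))"

definition hatA_fin :: "('d2::finite, 'd1::finite) fseries set" where
  "hatA_fin = {K. finite {\<alpha>. coeff_c K \<alpha> \<noteq> 0}}"

definition series_space :: "(('d2::finite, 'd1::finite) mi2 \<Rightarrow> complex) topology \<Rightarrow> ('d2, 'd1) fseries topology" where
  "series_space L = pullback_topology UNIV coeff_c L"

text \<open>
  Termwise derivative \<open>\<partial>\<^bsub>z\<^sub>2\<^esub>\<^bsup>\<alpha>\<^sub>2\<^esup> \<partial>\<^bsub>cnj z\<^sub>1\<^esub>\<^bsup>\<alpha>\<^sub>1\<^esup>\<close>: the monomial with exponent \<open>\<gamma> + \<alpha>\<close> is mapped to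
  \<open>(\<gamma> + \<alpha>)! / \<gamma>!\<close> times the one with exponent \<open>\<gamma>\<close>, and all other monomials to zero.
\<close>

definition fderiv :: "('d2::finite, 'd1::finite) mi2 \<Rightarrow> ('d2, 'd1) fseries \<Rightarrow> ('d2, 'd1) fseries" where
  "fderiv \<alpha> K = (\<lambda>\<gamma>. of_real (mi2_fact (\<gamma> + \<alpha>) / mi2_fact \<gamma>) * K (\<gamma> + \<alpha>))"

definition diamond :: "('d2::finite, 'd1::finite) fseries \<Rightarrow> ('d2, 'd1) fseries \<Rightarrow> ('d2, 'd1) fseries" where
  "diamond K1 K2 = (\<lambda>\<gamma>. \<Sum>\<alpha> | coeff_c K1 \<alpha> \<noteq> 0.
      coeff_c K1 \<alpha> * fderiv \<alpha> K2 \<gamma> / of_real (sqrt (mi2_fact \<alpha>)))"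

lemma mi_fact_pos: "0 < mi_fact \<alpha>"
  using mi_fact_ge_1[of \<alpha>] by linarith

lemma mi2_fact_pos: "0 < mi2_fact \<alpha>"
  by (simp add: mi2_fact_def mi_fact_pos)

lemma coeff_c_eq_0_iff [simp]: "coeff_c K \<alpha> = 0 \<longleftrightarrow> K \<alpha> = 0"
  using mi2_fact_pos[of \<alpha>] by (simp add: coeff_c_def)

lemma topspace_series_space: "topspace (series_space L) = {K. coeff_c K \<in> topspace L}"
  unfolding series_space_def topspace_pullback_topology by auto

lemma fderiv_zero: "fderiv 0 K = K"
proof
  fix \<gamma>
  show "fderiv 0 K \<gamma> = K \<gamma>"
    using mi2_fact_pos[of \<gamma>] by (simp add: fderiv_def)
qed

lemma fderiv_add: "fderiv (\<alpha> + \<beta>) K = fderiv \<alpha> (fderiv \<beta> K)"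
proof
  fix \<gamma>
  show "fderiv (\<alpha> + \<beta>) K \<gamma> = fderiv \<alpha> (fderiv \<beta> K) \<gamma>"
    using mi2_fact_pos[of "\<gamma> + \<alpha>"] by (simp add: fderiv_def add.assoc field_simps)
qed

lemma diamond_hatA_fin:
  assumes K1: "K1 \<in> hatA_fin" and K2: "K2 \<in> hatA_fin"
  shows "diamond K1 K2 \<in> hatA_fin"
proof -
  let ?A = "{\<alpha>. K1 \<alpha> \<noteq> 0}" and ?B = "{\<alpha>. K2 \<alpha> \<noteq> 0}"
  have fin: "finite ?A" "finite ?B" using K1 K2 by (simp_all add: hatA_fin_def)
  have "{\<gamma>. diamond K1 K2 \<gamma> \<noteq> 0} \<subseteq> (\<Union>\<alpha>\<in>?A. (\<lambda>\<gamma>. \<gamma> + \<alpha>) -` ?B)"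
  proof
    fix \<gamma> assume "\<gamma> \<in> {\<gamma>. diamond K1 K2 \<gamma> \<noteq> 0}"
    then have "(\<Sum>\<alpha> | coeff_c K1 \<alpha> \<noteq> 0. coeff_c K1 \<alpha> * fderiv \<alpha> K2 \<gamma> / of_real (sqrt (mi2_fact \<alpha>))) \<noteq> 0"
      by (simp only: diamond_def mem_Collect_eq not_False_eq_True)
    then obtain \<alpha> where "\<alpha> \<in> {\<alpha>. coeff_c K1 \<alpha> \<noteq> 0}"
      "coeff_c K1 \<alpha> * fderiv \<alpha> K2 \<gamma> / of_real (sqrt (mi2_fact \<alpha>)) \<noteq> 0"
      by (rule sum.not_neutral_contains_not_neutral)
    then have "K1 \<alpha> \<noteq> 0" "fderiv \<alpha> K2 \<gamma> \<noteq> 0"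
      by simp_all
    then have "\<alpha> \<in> ?A" "\<gamma> \<in> (\<lambda>\<gamma>. \<gamma> + \<alpha>) -` ?B"
      by (simp_all add: fderiv_def)
    then show "\<gamma> \<in> (\<Union>\<alpha>\<in>?A. (\<lambda>\<gamma>. \<gamma> + \<alpha>) -` ?B)"
      by blast
  qed
  moreover have "finite (\<Union>\<alpha>\<in>?A. (\<lambda>\<gamma>. \<gamma> + \<alpha>) -` ?B)"
    using fin by (intro finite_UN_I finite_vimageI) (auto simp: inj_on_def prod_eq_iff)
  ultimately have "finite {\<gamma>. diamond K1 K2 \<gamma> \<noteq> 0}"
    by (rule finite_subset)
  then show ?thesis
    by (simp add: hatA_fin_def)
qed

definition hatA :: "ennreal \<Rightarrow> flat_real \<times> flat_real \<Rightarrow> ('d2::finite, 'd1::finite) fseries topology" where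
  "hatA p s = series_space (ell_A p s)"

definition hatA_star :: "ennreal \<Rightarrow> flat_real \<times> flat_real \<Rightarrow> ('d2::finite, 'd1::finite) fseries topology" where
  "hatA_star p s = series_space (ell_A_star p s)"

definition hatA0 :: "ennreal \<Rightarrow> flat_real \<times> flat_real \<Rightarrow> ('d2::finite, 'd1::finite) fseries topology" where
  "hatA0 p s = series_space (ell_A0 p s)"

definition hatA0_star :: "ennreal \<Rightarrow> flat_real \<times> flat_real \<Rightarrow> ('d2::finite, 'd1::finite) fseries topology" where
  "hatA0_star p s = series_space (ell_A0_star p s)"

definition hatB :: "ennreal \<Rightarrow> flat_real \<times> flat_real \<Rightarrow> ('d2::finite, 'd1::finite) fseries topology" where
  "hatB p s = series_space (ell_B p s)"

definition hatB_star :: "ennreal \<Rightarrow> flat_real \<times> flat_real \<Rightarrow> ('d2::finite, 'd1::finite) fseries topology" where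
  "hatB_star p s = series_space (ell_B_star p s)"

definition hatB0 :: "ennreal \<Rightarrow> flat_real \<times> flat_real \<Rightarrow> ('d2::finite, 'd1::finite) fseries topology" where
  "hatB0 p s = series_space (ell_B0 p s)"

definition hatB0_star :: "ennreal \<Rightarrow> flat_real \<times> flat_real \<Rightarrow> ('d2::finite, 'd1::finite) fseries topology" where
  "hatB0_star p s = series_space (ell_B0_star p s)"

definition hatC :: "ennreal \<Rightarrow> flat_real \<times> flat_real \<Rightarrow> ('d2::finite, 'd1::finite) fseries topology" where
  "hatC p s = series_space (ell_C p s)"

definition hatC_star :: "ennreal \<Rightarrow> flat_real \<times> flat_real \<Rightarrow> ('d2::finite, 'd1::finite) fseries topology" where
  "hatC_star p s = series_space (ell_C_star p s)"

definition hatC0 :: "ennreal \<Rightarrow> flat_real \<times> flat_real \<Rightarrow> ('d2::finite, 'd1::finite) fseries topology" where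
  "hatC0 p s = series_space (ell_C0 p s)"

definition hatC0_star :: "ennreal \<Rightarrow> flat_real \<times> flat_real \<Rightarrow> ('d2::finite, 'd1::finite) fseries topology" where
  "hatC0_star p s = series_space (ell_C0_star p s)"


section \<open>Continuity and unique extension\<close>

text \<open>
  Continuity of a two-variable map between the limit spaces cannot mean continuity for the product
  topology: the constant term of \<open>K\<^sub>1 \<diamond> K\<^sub>2\<close> is \<open>\<Sum>\<^sub>\<alpha> c(K\<^sub>1; \<alpha>) c(K\<^sub>2; \<alpha>)\<close>, the pairing of a non-normable
  locally convex space with its dual, and such a pairing is never continuous for the product
  topology. The maps are required to be separately continuous and jointly sequentially
  continuous; uniqueness is required among all separately continuous maps.
\<close>

definition separately_continuous ::
    "'a topology \<Rightarrow> 'b topology \<Rightarrow> 'c topology \<Rightarrow> ('a \<Rightarrow> 'b \<Rightarrow> 'c) \<Rightarrow> bool" where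
  "separately_continuous X Y Z T \<longleftrightarrow>
     (\<forall>x\<in>topspace X. continuous_map Y Z (\<lambda>y. T x y)) \<and>
     (\<forall>y\<in>topspace Y. continuous_map X Z (\<lambda>x. T x y))"

definition jointly_seq_continuous ::
    "'a topology \<Rightarrow> 'b topology \<Rightarrow> 'c topology \<Rightarrow> ('a \<Rightarrow> 'b \<Rightarrow> 'c) \<Rightarrow> bool" where
  "jointly_seq_continuous X Y Z T \<longleftrightarrow>
     (\<forall>xs ys x y. limitin X xs x sequentially \<and> limitin Y ys y sequentially \<longrightarrow>
        limitin Z (\<lambda>n. T (xs n) (ys n)) (T x y) sequentially)"

definition extends_on :: "'a set \<Rightarrow> ('a \<Rightarrow> 'a \<Rightarrow> 'c) \<Rightarrow> ('a \<Rightarrow> 'a \<Rightarrow> 'c) \<Rightarrow> bool" where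
  "extends_on D T0 T \<longleftrightarrow> (\<forall>x\<in>D. \<forall>y\<in>D. T x y = T0 x y)"

definition uniquely_extendable ::
    "'a set \<Rightarrow> ('a \<Rightarrow> 'a \<Rightarrow> 'c) \<Rightarrow> 'a topology \<Rightarrow> 'a topology \<Rightarrow> 'c topology \<Rightarrow> bool" where
  "uniquely_extendable D T0 X Y Z \<longleftrightarrow>
     D \<subseteq> topspace X \<and> D \<subseteq> topspace Y \<and>
     (\<exists>T. extends_on D T0 T \<and> separately_continuous X Y Z T \<and> jointly_seq_continuous X Y Z T) \<and>
     (\<forall>T T'. extends_on D T0 T \<and> separately_continuous X Y Z T \<and>
             extends_on D T0 T' \<and> separately_continuous X Y Z T' \<longrightarrow>
             (\<forall>x\<in>topspace X. \<forall>y\<in>topspace Y. T x y = T' x y))"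

end

theory Submission
  imports Defs
begin

text \<open>
  Write \<open>S c d \<gamma> = (\<Sum>\<alpha>. c \<alpha> * d (\<alpha> + \<gamma>) * sqrt ((\<alpha> + \<gamma>)! / (\<alpha>! \<gamma>!)))\<close> for the product on
  coefficients. With weights \<open>u i = 1 / \<theta>\<close> (first case) or \<open>u i = \<theta>\<close> (second case) in one
  variable, and \<open>v j\<close> likewise in the other, every space is of one of the two forms
  \<open>PI = proj\<^sub>i ind\<^sub>j ell (u i / v j)\<close> and \<open>IP = ind\<^sub>i proj\<^sub>j ell (v j / u i)\<close>; the \<open>\<A>\<close>-spaces are the
  case of a single weight \<open>v = 1\<close>. The gaps between the weights absorb geometric factors, which makes
  the exponent \<open>p\<close> irrelevant, so that sup-norms suffice, and the inequalities
  \<open>u i \<alpha> * u i \<gamma> \<le> C * u k (\<alpha> + \<gamma>)\<close> and \<open>u i (\<alpha> + \<gamma>) \<le> C * (u k \<alpha> * u k \<gamma>)\<close> give estimates for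
  \<open>S\<close> on \<open>IP \<times> PI\<close> and on \<open>PI \<times> IP\<close> that are uniform over bounded subsets of \<open>PI\<close>. By a gliding
  hump argument a convergent sequence in \<open>PI\<close> is bounded in a step of each inner inductive limit,
  which yields joint sequential continuity. Uniqueness holds because truncations converge in both
  kinds of spaces and evaluations are continuous.
\<close>

section \<open>Locally convex limit topologies\<close>

text \<open>Three obstacles shape the argument. For a zero index the weight is infinite outside a
  finite set, so its inverse vanishes there; the weights are therefore real functions that may be 0,
  bounds are written without division (\<open>bnd\<close>), and a single estimate controls
  \<open>S\<close> only at those \<gamma> where a weight is positive. For p < 1 the steps need not
  be locally convex, which is why the exponent is changed to \<infinity> before the topology is
  studied. Finally, no regularity of the inner inductive limits is at hand, so boundedness in one
  step is proved for convergent sequences. The bounds s < 1/2 and s \<le> 1/2 of the two cases come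
  from the gap condition: inverse weights must absorb 2^|\<alpha>| by shrinking r, direct weights
  may enlarge r. The kernel is the square root of a product of binomial coefficients, hence at most
  2^|\<alpha> + \<gamma>|; a further factor 2^|\<alpha>| is reserved to make the sum over \<alpha>
  converge, and 4^|\<alpha> + \<gamma>| pays for both.\<close>

definition lin_space :: "('a \<Rightarrow> complex) set \<Rightarrow> bool" where
  "lin_space E \<longleftrightarrow> (\<lambda>_. 0) \<in> E \<and> (\<forall>c\<in>E. \<forall>d\<in>E. \<forall>a b. (\<lambda>\<alpha>. a * c \<alpha> + b * d \<alpha>) \<in> E)"

text \<open>Less than a full topological vector space: only the maps sending \<open>d\<close> to
  \<open>t d + x\<close> with real \<open>t > 0\<close> have to be continuous. Together with a base
  of absolutely convex zero neighbourhoods this suffices to test limits and continuity at zero, and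
  it passes through both kinds of limits.\<close>

definition lc_top :: "('a \<Rightarrow> complex) topology \<Rightarrow> bool" where
  "lc_top X \<longleftrightarrow> lin_space (topspace X) \<and>
     (\<forall>t>0. \<forall>x\<in>topspace X. continuous_map X X (\<lambda>d \<alpha>. of_real t * d \<alpha> + x \<alpha>)) \<and>
     (\<forall>V. nhd_zero X V \<longrightarrow> (\<exists>W. W \<subseteq> V \<and> abs_convex W \<and> nhd_zero X W))"

lemma lin_space_comb: "lin_space E \<Longrightarrow> c \<in> E \<Longrightarrow> d \<in> E \<Longrightarrow> (\<lambda>\<alpha>. a * c \<alpha> + b * d \<alpha>) \<in> E"
  by (simp add: lin_space_def)

lemma lin_space_zero: "lin_space E \<Longrightarrow> (\<lambda>_. 0) \<in> E"
  by (simp add: lin_space_def)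

lemma lin_space_scale: "lin_space E \<Longrightarrow> c \<in> E \<Longrightarrow> (\<lambda>\<alpha>. a * c \<alpha>) \<in> E"
  using lin_space_comb[of E c c a 0] by simp

lemma lin_space_add: "lin_space E \<Longrightarrow> c \<in> E \<Longrightarrow> d \<in> E \<Longrightarrow> (\<lambda>\<alpha>. c \<alpha> + d \<alpha>) \<in> E"
  using lin_space_comb[of E c d 1 1] by simp

lemma lin_space_diff: "lin_space E \<Longrightarrow> c \<in> E \<Longrightarrow> d \<in> E \<Longrightarrow> (\<lambda>\<alpha>. c \<alpha> - d \<alpha>) \<in> E"
  using lin_space_comb[of E c d 1 "-1"] by simp

lemma abs_convexD:
  "abs_convex V \<Longrightarrow> c \<in> V \<Longrightarrow> d \<in> V \<Longrightarrow> norm a + norm b \<le> 1 \<Longrightarrow> (\<lambda>\<alpha>. a * c \<alpha> + b * d \<alpha>) \<in> V"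
  by (simp add: abs_convex_def)

lemma abs_convex_Int: "abs_convex V \<Longrightarrow> abs_convex W \<Longrightarrow> abs_convex (V \<inter> W)"
  by (simp add: abs_convex_def)

lemma abs_convex_lin_space: "lin_space E \<Longrightarrow> abs_convex E"
  by (simp add: abs_convex_def lin_space_def)

lemma abs_convex_scale: "abs_convex V \<Longrightarrow> c \<in> V \<Longrightarrow> norm a \<le> 1 \<Longrightarrow> (\<lambda>\<alpha>. a * c \<alpha>) \<in> V"
  using abs_convexD[of V c c a 0] by simp

lemma abs_convex_add_half:
  assumes "abs_convex V" "(\<lambda>\<alpha>. 2 * c \<alpha>) \<in> V" "(\<lambda>\<alpha>. 2 * d \<alpha>) \<in> V"
  shows "(\<lambda>\<alpha>. c \<alpha> + d \<alpha>) \<in> V"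
  using abs_convexD[OF assms, of "1/2" "1/2"] by (simp add: norm_divide)

text \<open>One statement for three kinds of sets: balls of the weighted sup-norm (\<open>A\<close>
  the identity), conditions on one coefficient (\<open>k\<close> of type \<open>unit\<close>), and
  bounds along a sequence of indices as in the gliding hump argument.\<close>

lemma abs_convex_pointwise:
  fixes t e :: "'k \<Rightarrow> real" and A :: "'k \<Rightarrow> 'a"
  assumes t: "\<And>k. 0 \<le> t k" and e: "\<And>k. 0 \<le> e k"
  shows "abs_convex {c. \<forall>k. norm (c (A k)) * t k \<le> e k}"
  unfolding abs_convex_def
proof (intro ballI allI impI CollectI)
  fix c d :: "'a \<Rightarrow> complex" and a b :: complex and k
  assume c: "c \<in> {c. \<forall>k. norm (c (A k)) * t k \<le> e k}" and d: "d \<in> {c. \<forall>k. norm (c (A k)) * t k \<le> e k}"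
    and ab: "norm a + norm b \<le> 1"
  have "norm (a * c (A k) + b * d (A k)) * t k \<le> (norm a * norm (c (A k)) + norm b * norm (d (A k))) * t k"
    using norm_triangle_ineq[of "a * c (A k)" "b * d (A k)"] t
    by (intro mult_right_mono) (simp_all add: norm_mult)
  also have "\<dots> = norm a * (norm (c (A k)) * t k) + norm b * (norm (d (A k)) * t k)"
    by (simp add: algebra_simps)
  also have "\<dots> \<le> norm a * e k + norm b * e k"
    using c d by (intro add_mono mult_left_mono) auto
  also have "\<dots> \<le> e k"
    using mult_right_mono[OF ab e, of k] by (simp add: distrib_right)
  finally show "norm (a * c (A k) + b * d (A k)) * t k \<le> e k" .
qed

lemma abs_convex_dilate:
  assumes "abs_convex V" shows "abs_convex {c. (\<lambda>\<alpha>. t * c \<alpha>) \<in> V}"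
  unfolding abs_convex_def
proof (intro ballI allI impI)
  fix c d a b assume "c \<in> {c. (\<lambda>\<alpha>. t * c \<alpha>) \<in> V}" "d \<in> {c. (\<lambda>\<alpha>. t * c \<alpha>) \<in> V}"
    and "norm (a::complex) + norm (b::complex) \<le> 1"
  then show "(\<lambda>\<alpha>. a * c \<alpha> + b * d \<alpha>) \<in> {c. (\<lambda>\<alpha>. t * c \<alpha>) \<in> V}"
    using abs_convexD[OF assms, of "\<lambda>\<alpha>. t * c \<alpha>" "\<lambda>\<alpha>. t * d \<alpha>" a b]
    by (simp add: algebra_simps)
qed

section \<open>Zero neighbourhoods and their transfer between topologies\<close>

lemma nhd_zero_mono: "nhd_zero X V \<Longrightarrow> V \<subseteq> W \<Longrightarrow> nhd_zero X W"
  unfolding nhd_zero_def by blast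

lemma nhd_zero_Int:
  assumes "nhd_zero X V" "nhd_zero X W" shows "nhd_zero X (V \<inter> W)"
proof -
  obtain U U' where "openin X U" "(\<lambda>_. 0) \<in> U" "U \<subseteq> V" "openin X U'" "(\<lambda>_. 0) \<in> U'" "U' \<subseteq> W"
    using assms unfolding nhd_zero_def by blast
  then show ?thesis
    unfolding nhd_zero_def by (intro exI[of _ "U \<inter> U'"]) auto
qed

lemma nhd_zero_topspace: "(\<lambda>_. 0) \<in> topspace X \<Longrightarrow> nhd_zero X (topspace X)"
  unfolding nhd_zero_def by blast

lemma nhd_zero_INT:
  assumes "finite F" "(\<lambda>_. 0) \<in> topspace X" "\<And>i. i \<in> F \<Longrightarrow> nhd_zero X (V i)"
  shows "nhd_zero X (\<Inter>i\<in>F. V i)"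
  using assms
proof (induction F rule: finite_induct)
  case empty
  then show ?case using nhd_zero_mono[OF nhd_zero_topspace] by auto
next
  case (insert i F)
  then show ?case using nhd_zero_Int by auto
qed

lemma zero_in_nhd_zero: "nhd_zero X V \<Longrightarrow> (\<lambda>_. 0) \<in> V \<and> (\<lambda>_. 0) \<in> topspace X"
  unfolding nhd_zero_def using openin_subset by blast

lemma nhd_zero_finer:
  assumes "finer_step X Y" "(\<lambda>_. 0) \<in> topspace X" "nhd_zero Y V" shows "nhd_zero X V"
proof -
  obtain U where U: "openin Y U" "(\<lambda>_. 0) \<in> U" "U \<subseteq> V"
    using assms unfolding nhd_zero_def by blast
  have "openin X {x \<in> topspace X. id x \<in> U}"
    using assms U(1) unfolding finer_step_def continuous_map_def by blast
  then show ?thesis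
    unfolding nhd_zero_def using U assms(2) by (intro exI[of _ "{x \<in> topspace X. id x \<in> U}"]) auto
qed

section \<open>Topologies determined by their zero neighbourhoods\<close>

lemma lc_topD:
  assumes "lc_top X"
  shows "lin_space (topspace X)"
    and "0 < t \<Longrightarrow> x \<in> topspace X \<Longrightarrow> continuous_map X X (\<lambda>d \<alpha>. of_real t * d \<alpha> + x \<alpha>)"
    and "nhd_zero X V \<Longrightarrow> \<exists>W. W \<subseteq> V \<and> abs_convex W \<and> nhd_zero X W"
  using assms unfolding lc_top_def by blast+

lemma lc_top_zero: "lc_top X \<Longrightarrow> (\<lambda>_. 0) \<in> topspace X"
  using lc_topD(1) lin_space_zero by blast

lemma lc_top_translate:
  assumes X: "lc_top X" and x: "x \<in> topspace X" and U: "openin X U"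
  shows "openin X {d \<in> topspace X. (\<lambda>\<alpha>. d \<alpha> - x \<alpha>) \<in> U}"
proof -
  have "(\<lambda>\<alpha>. - 1 * x \<alpha>) \<in> topspace X"
    using lin_space_scale[OF lc_topD(1)[OF X] x] .
  from openin_continuous_map_preimage[OF lc_topD(2)[OF X zero_less_one this] U]
  show ?thesis by simp
qed

lemma nhd_zero_dilate:
  assumes X: "lc_top X" and V: "nhd_zero X V" and t: "0 < t"
  shows "nhd_zero X {c. (\<lambda>\<alpha>. of_real t * c \<alpha>) \<in> V}"
proof -
  obtain U where U: "openin X U" "(\<lambda>_. 0) \<in> U" "U \<subseteq> V"
    using V unfolding nhd_zero_def by blast
  have "openin X {d \<in> topspace X. (\<lambda>\<alpha>. of_real t * d \<alpha> + 0) \<in> U}"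
    using openin_continuous_map_preimage[OF lc_topD(2)[OF X t lc_top_zero[OF X]] U(1)] .
  then show ?thesis
    unfolding nhd_zero_def using U lc_top_zero[OF X]
    by (intro exI[of _ "{d \<in> topspace X. (\<lambda>\<alpha>. of_real t * d \<alpha> + 0) \<in> U}"]) auto
qed

lemma lc_top_openinI:
  assumes X: "lc_top X" and sub: "U \<subseteq> topspace X"
    and U: "\<And>c. c \<in> U \<Longrightarrow> \<exists>V. nhd_zero X V \<and> (\<forall>d\<in>topspace X. (\<lambda>\<alpha>. d \<alpha> - c \<alpha>) \<in> V \<longrightarrow> d \<in> U)"
  shows "openin X U"
proof (subst openin_subopen, intro ballI)
  fix c assume c: "c \<in> U"
  then obtain V where V: "nhd_zero X V" "\<And>d. d \<in> topspace X \<Longrightarrow> (\<lambda>\<alpha>. d \<alpha> - c \<alpha>) \<in> V \<Longrightarrow> d \<in> U"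
    using U by blast
  then obtain O' where O': "openin X O'" "(\<lambda>_. 0) \<in> O'" "O' \<subseteq> V"
    unfolding nhd_zero_def by blast
  have "openin X {d \<in> topspace X. (\<lambda>\<alpha>. d \<alpha> - c \<alpha>) \<in> O'}"
    using lc_top_translate[OF X _ O'(1)] c sub by blast
  then show "\<exists>T. openin X T \<and> c \<in> T \<and> T \<subseteq> U"
    using V(2) O' c sub by (intro exI[of _ "{d \<in> topspace X. (\<lambda>\<alpha>. d \<alpha> - c \<alpha>) \<in> O'}"]) auto
qed

lemma lc_top_openinD:
  assumes X: "lc_top X" and U: "openin X U" "c \<in> U"
  shows "\<exists>V. nhd_zero X V \<and> (\<forall>d\<in>topspace X. (\<lambda>\<alpha>. d \<alpha> - c \<alpha>) \<in> V \<longrightarrow> d \<in> U)"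
proof -
  have c: "c \<in> topspace X" using U openin_subset by blast
  let ?V = "{d \<in> topspace X. (\<lambda>\<alpha>. of_real 1 * d \<alpha> + c \<alpha>) \<in> U}"
  have "openin X ?V"
    using openin_continuous_map_preimage[OF lc_topD(2)[OF X zero_less_one c] U(1)] .
  then have "nhd_zero X ?V"
    unfolding nhd_zero_def using lc_top_zero[OF X] U(2) by (intro exI[of _ ?V]) auto
  then show ?thesis by (intro exI[of _ ?V]) auto
qed

lemma limitin_lc_top:
  assumes X: "lc_top X"
  shows "limitin X f l F \<longleftrightarrow> l \<in> topspace X \<and>
    (\<forall>V. nhd_zero X V \<longrightarrow> eventually (\<lambda>n. f n \<in> topspace X \<and> (\<lambda>\<alpha>. f n \<alpha> - l \<alpha>) \<in> V) F)" (is "?L \<longleftrightarrow> ?R")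
proof
  assume L: ?L
  then have l: "l \<in> topspace X" by (simp add: limitin_def)
  have "eventually (\<lambda>n. f n \<in> topspace X \<and> (\<lambda>\<alpha>. f n \<alpha> - l \<alpha>) \<in> V) F" if V: "nhd_zero X V" for V
  proof -
    obtain U where U: "openin X U" "(\<lambda>_. 0) \<in> U" "U \<subseteq> V"
      using V unfolding nhd_zero_def by blast
    have "eventually (\<lambda>n. f n \<in> {d \<in> topspace X. (\<lambda>\<alpha>. d \<alpha> - l \<alpha>) \<in> U}) F"
      using L l U lc_top_translate[OF X l U(1)] unfolding limitin_def by auto
    then show ?thesis by eventually_elim (use U in auto)
  qed
  then show ?R using l by blast
next
  assume R: ?R
  show ?L unfolding limitin_def
  proof (intro conjI allI impI)
    fix U assume "openin X U \<and> l \<in> U"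
    then obtain V where V: "nhd_zero X V" "\<forall>d\<in>topspace X. (\<lambda>\<alpha>. d \<alpha> - l \<alpha>) \<in> V \<longrightarrow> d \<in> U"
      using lc_top_openinD[OF X] by blast
    then have "eventually (\<lambda>n. f n \<in> topspace X \<and> (\<lambda>\<alpha>. f n \<alpha> - l \<alpha>) \<in> V) F" using R by blast
    then show "eventually (\<lambda>n. f n \<in> U) F" by eventually_elim (use V in blast)
  qed (use R in blast)
qed

text \<open>Translation reduces continuity to zero. Additivity is asked for only on differences of
  elements of \<open>topspace X\<close>, because a series that does not converge has the value 0 by
  convention and \<open>S\<close> is not additive beyond the spaces where it converges.\<close>

lemma continuous_map_lc_top:
  assumes X: "lc_top X" and Y: "lc_top Y"
    and map: "\<And>c. c \<in> topspace X \<Longrightarrow> f c \<in> topspace Y"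
    and diff: "\<And>c d. c \<in> topspace X \<Longrightarrow> d \<in> topspace X \<Longrightarrow> f (\<lambda>\<alpha>. d \<alpha> - c \<alpha>) = (\<lambda>\<alpha>. f d \<alpha> - f c \<alpha>)"
    and nhd: "\<And>V. nhd_zero Y V \<Longrightarrow> nhd_zero X {c \<in> topspace X. f c \<in> V}"
  shows "continuous_map X Y f"
  unfolding continuous_map_def
proof (intro conjI allI impI)
  fix U assume U: "openin Y U"
  show "openin X {x \<in> topspace X. f x \<in> U}"
  proof (rule lc_top_openinI[OF X])
    fix c assume "c \<in> {x \<in> topspace X. f x \<in> U}"
    then have c: "c \<in> topspace X" "f c \<in> U" by auto
    obtain V where V: "nhd_zero Y V" "\<And>d. d \<in> topspace Y \<Longrightarrow> (\<lambda>\<alpha>. d \<alpha> - f c \<alpha>) \<in> V \<Longrightarrow> d \<in> U"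
      using lc_top_openinD[OF Y U c(2)] by blast
    have "\<forall>d\<in>topspace X. (\<lambda>\<alpha>. d \<alpha> - c \<alpha>) \<in> {c \<in> topspace X. f c \<in> V} \<longrightarrow> d \<in> {x \<in> topspace X. f x \<in> U}"
      using V(2) map diff[OF c(1)] by auto
    then show "\<exists>V. nhd_zero X V \<and> (\<forall>d\<in>topspace X. (\<lambda>\<alpha>. d \<alpha> - c \<alpha>) \<in> V \<longrightarrow> d \<in> {x \<in> topspace X. f x \<in> U})"
      using nhd[OF V(1)] by blast
  qed blast
qed (use map in auto)

subsection \<open>Projective limits\<close>

lemma openin_proj_limI:
  assumes "i \<in> I" "openin (X i) U" shows "openin (proj_lim I X) (U \<inter> (\<Inter>i\<in>I. topspace (X i)))"
  unfolding proj_lim_def using assms by (intro topology_generated_by_Basis) blast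

lemma continuous_map_proj_lim_step:
  assumes "i \<in> I" shows "continuous_map (proj_lim I X) (X i) id"
proof -
  have ne: "I \<noteq> {}" using assms by blast
  show ?thesis
    unfolding continuous_map_def topspace_proj_lim[OF ne]
  proof (intro conjI allI impI)
    fix U assume U: "openin (X i) U"
    then have "{x \<in> \<Inter>i\<in>I. topspace (X i). id x \<in> U} = U \<inter> (\<Inter>i\<in>I. topspace (X i))" by auto
    then show "openin (proj_lim I X) {x \<in> \<Inter>i\<in>I. topspace (X i). id x \<in> U}"
      using openin_proj_limI[where X=X, OF assms U] by simp
  qed (use assms in auto)
qed

lemma finer_step_proj_lim:
  assumes "i \<in> I" shows "finer_step (proj_lim I X) (X i)"
  using continuous_map_proj_lim_step[OF assms, of X] topspace_proj_lim[of I X] assms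
  unfolding finer_step_def by auto

lemma continuous_map_into_proj_lim:
  assumes ne: "I \<noteq> {}" and f: "\<And>i. i \<in> I \<Longrightarrow> continuous_map Z (X i) f"
  shows "continuous_map Z (proj_lim I X) f"
proof -
  have im: "f ` topspace Z \<subseteq> (\<Inter>i\<in>I. topspace (X i))"
    using f unfolding continuous_map_def by fastforce
  let ?S = "{U \<inter> (\<Inter>i\<in>I. topspace (X i)) | i U. i \<in> I \<and> openin (X i) U}"
  have "\<Union>?S = (\<Inter>i\<in>I. topspace (X i))"
    using topspace_proj_lim[OF ne, of X] unfolding proj_lim_def topology_generated_by_topspace .
  then show ?thesis
    unfolding proj_lim_def
  proof (intro continuous_on_generated_topo)
    fix W assume "W \<in> ?S"
    then obtain i U where W: "W = U \<inter> (\<Inter>i\<in>I. topspace (X i))" "i \<in> I" "openin (X i) U" by blast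
    have "f -` W \<inter> topspace Z = {x \<in> topspace Z. f x \<in> U}"
      using im W by auto
    then show "openin Z (f -` W \<inter> topspace Z)"
      using openin_continuous_map_preimage[OF f[OF W(2)] W(3)] by simp
  qed (use im in simp)
qed

lemma nhd_zero_proj_limI:
  assumes "i \<in> I" "\<And>i. i \<in> I \<Longrightarrow> (\<lambda>_. 0) \<in> topspace (X i)" "nhd_zero (X i) V"
  shows "nhd_zero (proj_lim I X) V"
proof (rule nhd_zero_finer)
  show "finer_step (proj_lim I X) (X i)" by (rule finer_step_proj_lim) (rule assms)
  show "(\<lambda>_. 0) \<in> topspace (proj_lim I X)"
    using assms(1,2) topspace_proj_lim[of I X] by auto
qed (rule assms)

text \<open>Induction over the generation of the topology, with the claim made for those generated
  sets that contain zero; an intersection merges the two finite index sets.\<close>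

lemma nhd_zero_proj_limD:
  assumes zero: "\<And>i. i \<in> I \<Longrightarrow> (\<lambda>_. 0) \<in> topspace (X i)" and V: "nhd_zero (proj_lim I X) V"
  shows "\<exists>F W. finite F \<and> F \<subseteq> I \<and> (\<forall>i\<in>F. nhd_zero (X i) (W i)) \<and>
    (\<Inter>i\<in>I. topspace (X i)) \<inter> (\<Inter>i\<in>F. W i) \<subseteq> V"
proof -
  let ?S = "{U \<inter> (\<Inter>i\<in>I. topspace (X i)) | i U. i \<in> I \<and> openin (X i) U}"
  let ?P = "\<lambda>V. \<exists>F W. finite F \<and> F \<subseteq> I \<and> (\<forall>i\<in>F. nhd_zero (X i) (W i)) \<and>
    (\<Inter>i\<in>I. topspace (X i)) \<inter> (\<Inter>i\<in>F. W i) \<subseteq> V"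
  obtain U where U: "openin (proj_lim I X) U" "(\<lambda>_. 0) \<in> U" "U \<subseteq> V"
    using V unfolding nhd_zero_def by blast
  have "generate_topology_on ?S U"
    using U(1) unfolding proj_lim_def openin_topology_generated_by_iff .
  then have "(\<lambda>_. 0) \<in> U \<longrightarrow> ?P U"
  proof induction
    case Empty
    then show ?case by simp
  next
    case (Int A B)
    show ?case
    proof
      assume "(\<lambda>_. 0) \<in> A \<inter> B"
      then have z: "(\<lambda>_. 0) \<in> A" "(\<lambda>_. 0) \<in> B" by simp_all
      from mp[OF Int.IH(1) z(1)] obtain F W where F: "finite F" "F \<subseteq> I" "\<forall>i\<in>F. nhd_zero (X i) (W i)"
          "(\<Inter>i\<in>I. topspace (X i)) \<inter> (\<Inter>i\<in>F. W i) \<subseteq> A"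
        by metis
      from mp[OF Int.IH(2) z(2)] obtain F' W' where F': "finite F'" "F' \<subseteq> I" "\<forall>i\<in>F'. nhd_zero (X i) (W' i)"
          "(\<Inter>i\<in>I. topspace (X i)) \<inter> (\<Inter>i\<in>F'. W' i) \<subseteq> B"
        by metis
      \<comment> \<open>An index that occurs in one family only gets no restriction from the
        other.\<close>
      let ?W = "\<lambda>i. (if i \<in> F then W i else UNIV) \<inter> (if i \<in> F' then W' i else UNIV)"
      have "nhd_zero (X i) (?W i)" if "i \<in> F \<union> F'" for i
        using that F(3) F'(3) nhd_zero_Int[of "X i" "W i" "W' i"] by auto
      moreover have "(\<Inter>i\<in>I. topspace (X i)) \<inter> (\<Inter>i\<in>F \<union> F'. ?W i) \<subseteq> A \<inter> B"
      proof
        fix x assume x: "x \<in> (\<Inter>i\<in>I. topspace (X i)) \<inter> (\<Inter>i\<in>F \<union> F'. ?W i)"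
        have "x \<in> W i" if "i \<in> F" for i
          using x that by (auto dest: bspec[of _ _ i])
        moreover have "x \<in> W' i" if "i \<in> F'" for i
          using x that by (auto dest: bspec[of _ _ i])
        ultimately show "x \<in> A \<inter> B" using x F(4) F'(4) by auto
      qed
      ultimately show "?P (A \<inter> B)"
        using F(1,2) F'(1,2) by (intro exI[of _ "F \<union> F'"] exI[of _ ?W]) auto
    qed
  next
    case (UN K)
    show ?case
    proof
      assume "(\<lambda>_. 0) \<in> \<Union>K"
      then obtain A where A: "A \<in> K" "(\<lambda>_. 0) \<in> A" by blast
      from mp[OF UN.IH[OF A(1)] A(2)] obtain F W where
        "finite F" "F \<subseteq> I" "\<forall>i\<in>F. nhd_zero (X i) (W i)"
        "(\<Inter>i\<in>I. topspace (X i)) \<inter> (\<Inter>i\<in>F. W i) \<subseteq> A" by metis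
      then show "?P (\<Union>K)" using A(1) by (intro exI[of _ F] exI[of _ W]) auto
    qed
  next
    case (Basis A)
    then obtain i O' where "A = O' \<inter> (\<Inter>i\<in>I. topspace (X i))" "i \<in> I" "openin (X i) O'" by blast
    then show ?case
      by (intro impI exI[of _ "{i}"] exI[of _ "\<lambda>_. O'"]) (auto simp: nhd_zero_def)
  qed
  from mp[OF this U(2)] obtain F W where
    "finite F" "F \<subseteq> I" "\<forall>i\<in>F. nhd_zero (X i) (W i)"
    "(\<Inter>i\<in>I. topspace (X i)) \<inter> (\<Inter>i\<in>F. W i) \<subseteq> U" by metis
  then show ?thesis using U(3) by (intro exI[of _ F] exI[of _ W]) auto
qed

lemma lc_top_proj_lim:
  assumes ne: "I \<noteq> {}" and X: "\<And>i. i \<in> I \<Longrightarrow> lc_top (X i)"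
  shows "lc_top (proj_lim I X)"
  unfolding lc_top_def
proof (intro conjI allI ballI impI)
  have zero: "(\<lambda>_. 0) \<in> topspace (X i)" if "i \<in> I" for i
    using X[OF that] lc_top_zero by blast
  show "lin_space (topspace (proj_lim I X))"
    unfolding topspace_proj_lim[OF ne] using lc_topD(1)[OF X] by (auto simp: lin_space_def)
  fix V assume V: "nhd_zero (proj_lim I X) V"
  obtain F W where F: "finite F" "F \<subseteq> I" "\<And>i. i \<in> F \<Longrightarrow> nhd_zero (X i) (W i)"
    "(\<Inter>i\<in>I. topspace (X i)) \<inter> (\<Inter>i\<in>F. W i) \<subseteq> V"
    using nhd_zero_proj_limD[where I=I and X=X, OF zero V] by metis
  have "\<forall>i\<in>F. \<exists>W'. W' \<subseteq> W i \<and> abs_convex W' \<and> nhd_zero (X i) W'"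
    using F X lc_topD(3) by (metis subsetD)
  then obtain W' where W': "\<And>i. i \<in> F \<Longrightarrow> W' i \<subseteq> W i \<and> abs_convex (W' i) \<and> nhd_zero (X i) (W' i)"
    by metis
  let ?V = "topspace (proj_lim I X) \<inter> (\<Inter>i\<in>F. W' i)"
  have z: "(\<lambda>_. 0) \<in> topspace (proj_lim I X)"
    unfolding topspace_proj_lim[OF ne] using zero by blast
  have "nhd_zero (proj_lim I X) (W' i)" if "i \<in> F" for i
    using nhd_zero_proj_limI[where I=I and X=X and i=i] zero F W' that by blast
  then have "nhd_zero (proj_lim I X) ?V"
    by (intro nhd_zero_Int[OF nhd_zero_topspace[OF z] nhd_zero_INT[OF F(1) z]])
  moreover have "abs_convex (\<Inter>i\<in>F. W' i)"
    unfolding abs_convex_def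
    by (intro ballI allI impI INT_I) (rule abs_convexD, use W' in auto)
  then have "abs_convex ?V"
    by (rule abs_convex_Int[OF abs_convex_lin_space[OF \<open>lin_space (topspace (proj_lim I X))\<close>]])
  moreover have "(\<Inter>i\<in>F. W' i) \<subseteq> (\<Inter>i\<in>F. W i)"
    using W' by fast
  then have "?V \<subseteq> V"
    using F(4) unfolding topspace_proj_lim[OF ne] by (meson Int_mono order_refl subset_trans)
  ultimately show "\<exists>W. W \<subseteq> V \<and> abs_convex W \<and> nhd_zero (proj_lim I X) W" by blast
next
  fix t :: real and x assume t: "0 < t" and x: "x \<in> topspace (proj_lim I X)"
  show "continuous_map (proj_lim I X) (proj_lim I X) (\<lambda>d \<alpha>. of_real t * d \<alpha> + x \<alpha>)"
  proof (rule continuous_map_into_proj_lim[OF ne])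
    fix i assume i: "i \<in> I"
    then have xi: "x \<in> topspace (X i)" using x topspace_proj_lim[OF ne, of X] by blast
    have "continuous_map (proj_lim I X) (X i) ((\<lambda>d \<alpha>. of_real t * d \<alpha> + x \<alpha>) \<circ> id)"
      by (rule continuous_map_compose[OF continuous_map_proj_lim_step[where X=X, OF i] lc_topD(2)[OF X[OF i] t xi]])
    then show "continuous_map (proj_lim I X) (X i) (\<lambda>d \<alpha>. of_real t * d \<alpha> + x \<alpha>)"
      unfolding comp_id .
  qed
qed

lemma finer_step_proj_limI:
  assumes "J \<noteq> {}" "\<And>j. j \<in> J \<Longrightarrow> \<exists>i\<in>I. finer_step (X i) (Y j)"
  shows "finer_step (proj_lim I X) (proj_lim J Y)"
proof -
  have ne: "I \<noteq> {}" using assms by blast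
  have "continuous_map (proj_lim I X) (Y j) id" if j: "j \<in> J" for j
  proof -
    obtain i where i: "i \<in> I" "finer_step (X i) (Y j)" using assms(2)[OF j] by blast
    show ?thesis
      using continuous_map_compose[OF continuous_map_proj_lim_step[OF i(1)], of X "Y j" id] i(2)
      unfolding finer_step_def comp_id by blast
  qed
  then have "continuous_map (proj_lim I X) (proj_lim J Y) id"
    by (intro continuous_map_into_proj_lim assms(1))
  moreover have "topspace (proj_lim I X) \<subseteq> topspace (proj_lim J Y)"
    using assms unfolding topspace_proj_lim[OF ne] topspace_proj_lim[OF assms(1)] finer_step_def
    by blast
  ultimately show ?thesis by (simp add: finer_step_def)
qed

lemma finer_step_antisym:
  assumes "finer_step X Y" "finer_step Y X" shows "X = Y"
proof -
  have top: "topspace X = topspace Y" using assms by (auto simp: finer_step_def)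
  have "openin X U" if "openin Y U" "finer_step X Y" "topspace X = topspace Y" for X Y :: "'a topology" and U
  proof -
    have "{x \<in> topspace X. id x \<in> U} = U" using that openin_subset[of Y U] by auto
    then show ?thesis using that openin_continuous_map_preimage[of X Y id U] by (simp add: finer_step_def)
  qed
  then show ?thesis unfolding topology_eq using assms top by metis
qed

subsection \<open>Inductive limits\<close>

lemma openin_ind_limD:
  assumes "openin (ind_lim I X) U" "c \<in> U"
  obtains V where "abs_convex V" "\<forall>i\<in>I. nhd_zero (X i) V"
    "\<forall>i\<in>I. \<forall>d\<in>topspace (X i). (\<lambda>\<alpha>. d \<alpha> - c \<alpha>) \<in> V \<longrightarrow> d \<in> U"
proof -
  from bspec[OF conjunct2[OF assms(1)[unfolded openin_ind_lim]] assms(2)]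
  obtain V where V: "abs_convex V \<and> (\<forall>i\<in>I. nhd_zero (X i) V) \<and>
      (\<forall>d\<in>(\<Union>i\<in>I. topspace (X i)). (\<lambda>\<alpha>. d \<alpha> - c \<alpha>) \<in> V \<longrightarrow> d \<in> U)"
    by (rule exE)
  show ?thesis by (rule that[of V]) (use V in auto)
qed

lemma nhd_zero_ind_limD:
  assumes X: "(\<lambda>_. 0) \<in> topspace (X i)" and i: "i \<in> I" and V: "nhd_zero (ind_lim I X) V"
  shows "nhd_zero (X i) V"
proof -
  obtain U where U: "openin (ind_lim I X) U" "(\<lambda>_. 0) \<in> U" "U \<subseteq> V"
    using V unfolding nhd_zero_def by blast
  obtain W where W: "abs_convex W" "\<forall>i\<in>I. nhd_zero (X i) W"
    "\<forall>i\<in>I. \<forall>d\<in>topspace (X i). (\<lambda>\<alpha>. d \<alpha> - 0) \<in> W \<longrightarrow> d \<in> U"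
    by (rule openin_ind_limD[OF U(1,2)])
  have "nhd_zero (X i) (W \<inter> topspace (X i))"
    using W(2) i X by (intro nhd_zero_Int nhd_zero_topspace) auto
  then show ?thesis
    by (rule nhd_zero_mono) (use W(3) i U in auto)
qed

text \<open>The definition of \<open>ind_lim\<close> describes open sets, so an open set inside
  \<open>W\<close> has to be exhibited: the points \<open>t w\<close> with \<open>t < 1\<close>,
  that is, the open unit ball of the gauge of \<open>W\<close>.\<close>

lemma nhd_zero_ind_limI:
  assumes X: "\<And>i. i \<in> I \<Longrightarrow> lc_top (X i)" and ne: "I \<noteq> {}"
    and W: "abs_convex W" "\<And>i. i \<in> I \<Longrightarrow> nhd_zero (X i) W"
  shows "nhd_zero (ind_lim I X) W"
proof -
  let ?E = "\<Union>i\<in>I. topspace (X i)"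
  let ?U = "{c \<in> ?E. \<exists>t w. 0 \<le> t \<and> t < 1 \<and> w \<in> W \<and> c = (\<lambda>\<alpha>. of_real t * w \<alpha>)}"
  obtain i where i: "i \<in> I" using ne by blast
  have zero: "(\<lambda>_. 0) \<in> W" "(\<lambda>_. 0) \<in> ?E"
    using zero_in_nhd_zero[OF W(2)[OF i]] i by auto
  have "openin (ind_lim I X) ?U"
    unfolding openin_ind_lim
  proof (intro conjI ballI)
    fix c assume "c \<in> ?U"
    then obtain t w where t: "0 \<le> t" "t < (1::real)" and w: "w \<in> W" "c = (\<lambda>\<alpha>. of_real t * w \<alpha>)" by blast
    \<comment> \<open>A perturbation lying in \<open>(1 - t) / 2\<close> times \<open>W\<close>
      moves \<open>t w\<close> into \<open>t + (1 - t) / 2 = (1 + t) / 2\<close> times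
      \<open>W\<close>, and this factor is still below 1.\<close>
    let ?k = "2 / (1 - t)"
    let ?V = "{d. (\<lambda>\<alpha>. of_real ?k * d \<alpha>) \<in> W}"
    have k: "0 < ?k" using t by simp
    have "nhd_zero (X i) ?V" if "i \<in> I" for i
      using nhd_zero_dilate[OF X[OF that] W(2)[OF that] k] .
    moreover have "abs_convex ?V" using abs_convex_dilate[OF W(1)] .
    moreover have "d \<in> ?U" if d: "d \<in> ?E" "(\<lambda>\<alpha>. d \<alpha> - c \<alpha>) \<in> ?V" for d
    proof -
      let ?s = "(1 + t) / 2"
      let ?w = "\<lambda>\<alpha>. of_real (t / ?s) * w \<alpha> + of_real ((1 - t) / 2 / ?s) * (of_real ?k * (d \<alpha> - c \<alpha>))"
      have s: "0 < ?s" "?s < 1" using t by auto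
      have "t / ?s + (1 - t) / 2 / ?s = (t + (1 - t) / 2) / ?s"
        by (simp only: add_divide_distrib)
      also have "\<dots> = 1" using s by (simp add: field_simps)
      finally have "t / ?s + (1 - t) / 2 / ?s = 1" .
      then have "?w \<in> W"
        using t s d(2) by (intro abs_convexD[OF W(1) w(1)]) (simp_all add: norm_mult norm_divide del: of_real_divide)
      moreover have "d \<alpha> = of_real ?s * ?w \<alpha>" for \<alpha>
      proof -
        have "of_real ?s * ?w \<alpha> = of_real (?s * (t / ?s)) * w \<alpha> + of_real (?s * ((1 - t) / 2 / ?s) * ?k) * (d \<alpha> - c \<alpha>)"
          by (simp only: of_real_mult distrib_left mult.assoc)
        also have "?s * (t / ?s) = t"
          using s(1) nonzero_mult_div_cancel_left[of ?s t] unfolding times_divide_eq_right by simp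
        also have "?s * ((1 - t) / 2 / ?s) * ?k = (1 - t) / 2 * ?k"
          using s(1) nonzero_mult_div_cancel_left[of ?s "(1 - t) / 2"] unfolding times_divide_eq_right by simp
        also have "\<dots> = 1" using t(2) by simp
        finally show ?thesis using w(2) by simp
      qed
      then have "d = (\<lambda>\<alpha>. of_real ?s * ?w \<alpha>)" by blast
      ultimately have "\<exists>t w. 0 \<le> t \<and> t < 1 \<and> w \<in> W \<and> d = (\<lambda>\<alpha>. of_real t * w \<alpha>)"
        using s by (intro exI[of _ ?s] exI[of _ ?w] conjI) auto
      then show ?thesis using d(1) by blast
    qed
    ultimately show "\<exists>V. abs_convex V \<and> (\<forall>i\<in>I. nhd_zero (X i) V) \<and> (\<forall>d\<in>?E. (\<lambda>\<alpha>. d \<alpha> - c \<alpha>) \<in> V \<longrightarrow> d \<in> ?U)"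
      by blast
  qed blast
  moreover have "(\<lambda>_. 0) \<in> ?U"
    using zero by (auto intro!: exI[of _ "0::real"])
  moreover have "?U \<subseteq> W"
    using abs_convex_scale[OF W(1)] by fastforce
  ultimately show ?thesis unfolding nhd_zero_def by blast
qed

text \<open>Directedness makes the union of the steps a subspace. Continuity of the affine maps
  holds because the absolutely convex sets that witness openness may be dilated.\<close>

lemma lc_top_ind_lim:
  assumes X: "\<And>i. i \<in> I \<Longrightarrow> lc_top (X i)" and ne: "I \<noteq> {}"
    and dir: "\<And>i j. i \<in> I \<Longrightarrow> j \<in> I \<Longrightarrow> \<exists>k\<in>I. topspace (X i) \<subseteq> topspace (X k) \<and> topspace (X j) \<subseteq> topspace (X k)"
  shows "lc_top (ind_lim I X)"
  unfolding lc_top_def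
proof (intro conjI allI ballI impI)
  have zero: "(\<lambda>_. 0) \<in> topspace (X i)" if "i \<in> I" for i
    using X[OF that] lc_top_zero by blast
  have top: "topspace (ind_lim I X) = (\<Union>i\<in>I. topspace (X i))"
    by (rule topspace_ind_lim) (rule zero)
  show lin: "lin_space (topspace (ind_lim I X))"
    unfolding top lin_space_def
  proof (intro conjI ballI allI)
    show "(\<lambda>_. 0) \<in> (\<Union>i\<in>I. topspace (X i))" using zero ne by blast
    fix c d a b assume "c \<in> (\<Union>i\<in>I. topspace (X i))" "d \<in> (\<Union>i\<in>I. topspace (X i))"
    then obtain i j where ij: "i \<in> I" "c \<in> topspace (X i)" "j \<in> I" "d \<in> topspace (X j)" by blast
    then obtain k where "k \<in> I" "c \<in> topspace (X k)" "d \<in> topspace (X k)" using dir by blast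
    then show "(\<lambda>\<alpha>. a * c \<alpha> + b * d \<alpha>) \<in> (\<Union>i\<in>I. topspace (X i))"
      using lin_space_comb[OF lc_topD(1)[OF X]] by blast
  qed
  {
    fix V assume V: "nhd_zero (ind_lim I X) V"
    then obtain U where U: "openin (ind_lim I X) U" "(\<lambda>_. 0) \<in> U" "U \<subseteq> V"
      unfolding nhd_zero_def by blast
    obtain W where W: "abs_convex W" "\<forall>i\<in>I. nhd_zero (X i) W"
      "\<forall>i\<in>I. \<forall>d\<in>topspace (X i). (\<lambda>\<alpha>. d \<alpha> - 0) \<in> W \<longrightarrow> d \<in> U"
      by (rule openin_ind_limD[OF U(1,2)])
    have "nhd_zero (ind_lim I X) (W \<inter> topspace (ind_lim I X))"
      using nhd_zero_ind_limI[OF X ne W(1) bspec[OF W(2)]] lin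
      by (intro nhd_zero_Int nhd_zero_topspace lin_space_zero) auto
    moreover have "W \<inter> topspace (ind_lim I X) \<subseteq> V"
      using W(3) U(3) unfolding top by auto
    moreover have "abs_convex (W \<inter> topspace (ind_lim I X))"
      by (rule abs_convex_Int[OF W(1) abs_convex_lin_space[OF lin]])
    ultimately show "\<exists>W. W \<subseteq> V \<and> abs_convex W \<and> nhd_zero (ind_lim I X) W" by blast
  }
  fix t :: real and x assume t: "0 < t" and x: "x \<in> topspace (ind_lim I X)"
  let ?f = "\<lambda>d \<alpha>. of_real t * d \<alpha> + x \<alpha>"
  have map: "?f d \<in> topspace (ind_lim I X)" if "d \<in> topspace (ind_lim I X)" for d
    using lin_space_comb[OF lin that x, of "of_real t" 1] by simp
  show "continuous_map (ind_lim I X) (ind_lim I X) ?f"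
    unfolding continuous_map_def
  proof (intro conjI allI impI)
    fix U assume U: "openin (ind_lim I X) U"
    show "openin (ind_lim I X) {c \<in> topspace (ind_lim I X). ?f c \<in> U}"
      unfolding openin_ind_lim
    proof (intro conjI ballI)
      fix c assume c: "c \<in> {c \<in> topspace (ind_lim I X). ?f c \<in> U}"
      then have "?f c \<in> U" by simp
      obtain V where V: "abs_convex V" "\<forall>i\<in>I. nhd_zero (X i) V"
        "\<forall>i\<in>I. \<forall>d\<in>topspace (X i). (\<lambda>\<alpha>. d \<alpha> - ?f c \<alpha>) \<in> V \<longrightarrow> d \<in> U"
        by (rule openin_ind_limD[OF U \<open>?f c \<in> U\<close>])
      let ?V = "{d. (\<lambda>\<alpha>. of_real t * d \<alpha>) \<in> V}"
      have "d \<in> {c \<in> topspace (ind_lim I X). ?f c \<in> U}"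
        if d: "d \<in> (\<Union>i\<in>I. topspace (X i))" "(\<lambda>\<alpha>. d \<alpha> - c \<alpha>) \<in> ?V" for d
      proof -
        have "(\<lambda>\<alpha>. ?f d \<alpha> - ?f c \<alpha>) \<in> V" using d(2) by (simp add: algebra_simps)
        moreover obtain i where "i \<in> I" "?f d \<in> topspace (X i)" using map[of d] d(1) unfolding top by blast
        ultimately have "?f d \<in> U" using bspec[OF bspec[OF V(3)]] by simp
        then show ?thesis using d(1) top by blast
      qed
      then show "\<exists>V. abs_convex V \<and> (\<forall>i\<in>I. nhd_zero (X i) V) \<and>
        (\<forall>d\<in>\<Union>i\<in>I. topspace (X i). (\<lambda>\<alpha>. d \<alpha> - c \<alpha>) \<in> V \<longrightarrow> d \<in> {c \<in> topspace (ind_lim I X). ?f c \<in> U})"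
        using abs_convex_dilate[OF V(1)] nhd_zero_dilate[OF X bspec[OF V(2)] t] by (intro exI[of _ ?V]) blast
    qed (use top in blast)
  qed (use map in auto)
qed

lemma finer_step_ind_limI:
  fixes X :: "'i \<Rightarrow> ('a \<Rightarrow> complex) topology" and Y :: "'j \<Rightarrow> ('a \<Rightarrow> complex) topology"
  assumes zero: "\<And>i. i \<in> I \<Longrightarrow> (\<lambda>_. 0) \<in> topspace (X i)" "\<And>j. j \<in> J \<Longrightarrow> (\<lambda>_. 0) \<in> topspace (Y j)"
    and XY: "\<And>i. i \<in> I \<Longrightarrow> \<exists>j\<in>J. finer_step (X i) (Y j)"
  shows "finer_step (ind_lim I X) (ind_lim J Y)"
proof -
  have topX: "topspace (ind_lim I X) = (\<Union>i\<in>I. topspace (X i))"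
    by (rule topspace_ind_lim) (rule zero)
  have topY: "topspace (ind_lim J Y) = (\<Union>i\<in>J. topspace (Y i))"
    by (rule topspace_ind_lim) (rule zero)
  have sub: "(\<Union>i\<in>I. topspace (X i)) \<subseteq> (\<Union>i\<in>J. topspace (Y i))"
    using XY unfolding finer_step_def by blast
  have "openin (ind_lim I X) {x \<in> \<Union>i\<in>I. topspace (X i). id x \<in> U}" if U: "openin (ind_lim J Y) U" for U
    unfolding openin_ind_lim
  proof (intro conjI ballI)
    fix c assume "c \<in> {x \<in> \<Union>i\<in>I. topspace (X i). id x \<in> U}"
    then have "c \<in> U" by simp
    obtain V where V: "abs_convex V" "\<forall>i\<in>J. nhd_zero (Y i) V"
        "\<forall>i\<in>J. \<forall>d\<in>topspace (Y i). (\<lambda>\<alpha>. d \<alpha> - c \<alpha>) \<in> V \<longrightarrow> d \<in> U"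
      by (rule openin_ind_limD[OF U \<open>c \<in> U\<close>])
    have "nhd_zero (X i) V" if i: "i \<in> I" for i
      using XY[OF i] V(2) nhd_zero_finer[OF _ zero(1)[OF i]] by blast
    then show "\<exists>V. abs_convex V \<and> (\<forall>i\<in>I. nhd_zero (X i) V) \<and>
        (\<forall>d\<in>\<Union>i\<in>I. topspace (X i). (\<lambda>\<alpha>. d \<alpha> - c \<alpha>) \<in> V \<longrightarrow> d \<in> {x \<in> \<Union>i\<in>I. topspace (X i). id x \<in> U})"
      using V(1,3) sub by (intro exI[of _ V]) (simp, blast)
  qed blast
  then show ?thesis
    unfolding finer_step_def continuous_map_def topX topY using sub by (simp only: Pi_iff id_apply) blast
qed

section \<open>Weighted sup-norm spaces and independence of the exponent\<close>

text \<open>For nonnegative weights, division in the extended reals gives 0 where both vanish and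
  \<infinity> where only the denominator does. This is exactly how quotients of \<open>theta\<close>
  behave at infinite values.\<close>

definition quot :: "('a \<Rightarrow> real) \<Rightarrow> ('a \<Rightarrow> real) \<Rightarrow> 'a \<Rightarrow> ennreal" where
  "quot u v \<alpha> = ennreal (u \<alpha>) / ennreal (v \<alpha>)"

definition bnd :: "('a \<Rightarrow> real) \<Rightarrow> ('a \<Rightarrow> real) \<Rightarrow> real \<Rightarrow> ('a \<Rightarrow> complex) \<Rightarrow> bool" where
  "bnd u v C c \<longleftrightarrow> (\<forall>\<alpha>. norm (c \<alpha>) * u \<alpha> \<le> C * v \<alpha>)"

lemma bndI: "(\<And>\<alpha>. norm (c \<alpha>) * u \<alpha> \<le> C * v \<alpha>) \<Longrightarrow> bnd u v C c"
  by (simp add: bnd_def)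

lemma bndD: "bnd u v C c \<Longrightarrow> norm (c \<alpha>) * u \<alpha> \<le> C * v \<alpha>"
  by (simp add: bnd_def)

lemma bnd_mono: "bnd u v C c \<Longrightarrow> C \<le> C' \<Longrightarrow> (\<And>\<alpha>. 0 \<le> v \<alpha>) \<Longrightarrow> bnd u v C' c"
  unfolding bnd_def by (meson mult_right_mono order_trans)

lemma bnd_comb:
  assumes "bnd u v C c" "bnd u v D d" "\<And>\<alpha>. 0 \<le> u \<alpha>"
  shows "bnd u v (norm a * C + norm b * D) (\<lambda>\<alpha>. a * c \<alpha> + b * d \<alpha>)"
proof (rule bndI)
  fix \<alpha>
  have "norm (a * c \<alpha> + b * d \<alpha>) * u \<alpha> \<le> (norm a * norm (c \<alpha>) + norm b * norm (d \<alpha>)) * u \<alpha>"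
    using assms(3) norm_triangle_ineq[of "a * c \<alpha>" "b * d \<alpha>"] by (intro mult_right_mono) (simp_all add: norm_mult)
  also have "\<dots> = norm a * (norm (c \<alpha>) * u \<alpha>) + norm b * (norm (d \<alpha>) * u \<alpha>)"
    by (simp add: algebra_simps)
  also have "\<dots> \<le> norm a * (C * v \<alpha>) + norm b * (D * v \<alpha>)"
    using assms bndD by (intro add_mono mult_left_mono) auto
  finally show "norm (a * c \<alpha> + b * d \<alpha>) * u \<alpha> \<le> (norm a * C + norm b * D) * v \<alpha>"
    by (simp add: algebra_simps)
qed

text \<open>Where \<open>v\<close> vanishes both sides say
  \<open>c \<alpha> * u \<alpha> = 0\<close>, since otherwise the weighted entry is infinite. From
  here on all norms are handled through the real inequality \<open>bnd\<close>.\<close>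

lemma ell_norm_infinity_le_iff:
  assumes u: "\<And>\<alpha>. 0 \<le> u \<alpha>" and v: "\<And>\<alpha>. 0 \<le> v \<alpha>" and C: "0 \<le> C"
  shows "ell_norm \<infinity> (quot u v) c \<le> ennreal C \<longleftrightarrow> bnd u v C c"
proof -
  have "ennreal (norm (c \<alpha>)) * quot u v \<alpha> \<le> ennreal C \<longleftrightarrow> norm (c \<alpha>) * u \<alpha> \<le> C * v \<alpha>" for \<alpha>
  proof (cases "v \<alpha> = 0")
    case True
    show ?thesis
    proof (cases "norm (c \<alpha>) * u \<alpha> = 0")
      case True
      then show ?thesis using \<open>v \<alpha> = 0\<close> by (auto simp: quot_def)
    next
      case False
      then have "ennreal (norm (c \<alpha>)) * quot u v \<alpha> = \<infinity>"
        using \<open>v \<alpha> = 0\<close> u[of \<alpha>] by (auto simp: quot_def ennreal_divide_zero ennreal_mult_top)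
      then show ?thesis
        using False True u[of \<alpha>] by (auto simp: top_unique mult_le_0_iff)
    qed
  next
    case False
    then have v': "0 < v \<alpha>" using v[of \<alpha>] by simp
    then have "ennreal (norm (c \<alpha>)) * quot u v \<alpha> = ennreal (norm (c \<alpha>) * u \<alpha> / v \<alpha>)"
      using u[of \<alpha>] by (simp add: quot_def divide_ennreal flip: ennreal_mult)
    then show ?thesis
      using v' u[of \<alpha>] C by (simp add: divide_le_eq)
  qed
  then show ?thesis
    by (simp add: ell_norm_def lp_norm_def SUP_le_iff bnd_def)
qed

abbreviation wstep :: "('a \<Rightarrow> real) \<Rightarrow> ('a \<Rightarrow> real) \<Rightarrow> ('a \<Rightarrow> complex) topology" where
  "wstep u v \<equiv> ell \<infinity> (quot u v)"

context
  fixes u v :: "'a \<Rightarrow> real"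
  assumes u: "\<And>\<alpha>. 0 \<le> u \<alpha>" and v: "\<And>\<alpha>. 0 \<le> v \<alpha>"
begin

lemma topspace_wstep: "topspace (wstep u v) = {c. \<exists>C\<ge>0. bnd u v C c}"
proof -
  have "ell_norm \<infinity> (quot u v) c < \<infinity> \<longleftrightarrow> (\<exists>C\<ge>0. bnd u v C c)" for c
  proof
    assume "ell_norm \<infinity> (quot u v) c < \<infinity>"
    then obtain C where "0 \<le> C" "ell_norm \<infinity> (quot u v) c = ennreal C"
      by (metis infinity_ennreal_def less_top_ennreal)
    then show "\<exists>C\<ge>0. bnd u v C c"
      using ell_norm_infinity_le_iff[of u v C c] u v by auto
  next
    assume "\<exists>C\<ge>0. bnd u v C c"
    then obtain C where "0 \<le> C" "ell_norm \<infinity> (quot u v) c \<le> ennreal C"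
      using ell_norm_infinity_le_iff[of u v] u v by blast
    then show "ell_norm \<infinity> (quot u v) c < \<infinity>"
      by (metis ennreal_less_top infinity_ennreal_def le_less_trans)
  qed
  then show ?thesis by (simp add: ell_set_def)
qed

lemma wstepI: "bnd u v C c \<Longrightarrow> 0 \<le> C \<Longrightarrow> c \<in> topspace (wstep u v)"
  unfolding topspace_wstep by blast

lemma bnd_less_if: "ell_norm \<infinity> (quot u v) c < ennreal C \<Longrightarrow> bnd u v C c"
  using ell_norm_infinity_le_iff[of u v C c] u v
  by (metis ennreal_neg leI less_imp_le not_less_zero)

lemma ell_norm_less_if: "bnd u v C c \<Longrightarrow> 0 \<le> C \<Longrightarrow> C < D \<Longrightarrow> ell_norm \<infinity> (quot u v) c < ennreal D"
  using ell_norm_infinity_le_iff[of u v C c] u v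
  by (metis ennreal_lessI le_less_trans)

lemma nhd_zero_wstep:
  "nhd_zero (wstep u v) V \<longleftrightarrow> (\<exists>\<epsilon>>0. \<forall>d. bnd u v \<epsilon> d \<longrightarrow> d \<in> V)"
proof
  assume "nhd_zero (wstep u v) V"
  then obtain U where U: "openin (wstep u v) U" "(\<lambda>_. 0) \<in> U" "U \<subseteq> V"
    unfolding nhd_zero_def by blast
  from bspec[OF conjunct2[OF U(1)[unfolded openin_ell]] U(2)] obtain \<epsilon> where \<epsilon>: "\<epsilon> > 0"
    "\<forall>d\<in>ell_set \<infinity> (quot u v). ell_norm \<infinity> (quot u v) (\<lambda>\<alpha>. d \<alpha> - 0) < ennreal \<epsilon> \<longrightarrow> d \<in> U"
    by blast
  \<comment> \<open>Half the radius, because \<open>bnd\<close> is a non-strict bound and the balls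
    of the topology are strict.\<close>
  have "d \<in> V" if d: "bnd u v (\<epsilon> / 2) d" for d
  proof -
    have "d \<in> ell_set \<infinity> (quot u v)" using wstepI[OF d] \<epsilon>(1) by simp
    moreover have "ell_norm \<infinity> (quot u v) (\<lambda>\<alpha>. d \<alpha> - 0) < ennreal \<epsilon>"
      using ell_norm_less_if[OF d] \<epsilon>(1) by simp
    ultimately show ?thesis using \<epsilon>(2) U(3) by blast
  qed
  then show "\<exists>\<epsilon>>0. \<forall>d. bnd u v \<epsilon> d \<longrightarrow> d \<in> V"
    using \<epsilon>(1) by (intro exI[of _ "\<epsilon> / 2"]) auto
next
  assume "\<exists>\<epsilon>>0. \<forall>d. bnd u v \<epsilon> d \<longrightarrow> d \<in> V"
  then obtain \<epsilon> where \<epsilon>: "\<epsilon> > 0" "\<And>d. bnd u v \<epsilon> d \<Longrightarrow> d \<in> V" by blast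
  \<comment> \<open>Constants strictly below \<epsilon> leave a slack, half of which is the radius
    of a ball around \<open>c\<close>; this is what makes the set open.\<close>
  let ?U = "{c. \<exists>\<delta>\<ge>0. \<delta> < \<epsilon> \<and> bnd u v \<delta> c}"
  have "openin (wstep u v) ?U"
    unfolding openin_ell
  proof (intro conjI ballI)
    show "?U \<subseteq> ell_set \<infinity> (quot u v)" using wstepI by auto
    fix c assume "c \<in> ?U"
    then obtain \<delta> where \<delta>: "0 \<le> \<delta>" "\<delta> < \<epsilon>" "bnd u v \<delta> c" by blast
    let ?e = "(\<epsilon> - \<delta>) / 2"
    have "d \<in> ?U" if "ell_norm \<infinity> (quot u v) (\<lambda>\<alpha>. d \<alpha> - c \<alpha>) < ennreal ?e" for d
    proof -
      have "bnd u v (\<delta> + ?e) d"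
        using bnd_comb[OF \<delta>(3) bnd_less_if[OF that] u, of 1 1] by simp
      moreover have "0 \<le> \<delta> + ?e" "\<delta> + ?e < \<epsilon>" using \<delta> by (auto simp: field_simps)
      ultimately show ?thesis by blast
    qed
    then show "\<exists>\<epsilon>>0. \<forall>d\<in>ell_set \<infinity> (quot u v). ell_norm \<infinity> (quot u v) (\<lambda>\<alpha>. d \<alpha> - c \<alpha>) < ennreal \<epsilon> \<longrightarrow> d \<in> ?U"
      using \<delta>(2) by (intro exI[of _ ?e]) auto
  qed
  moreover have "(\<lambda>_. 0) \<in> ?U"
    using \<epsilon>(1) by (intro CollectI exI[of _ 0]) (simp add: bnd_def)
  moreover have "?U \<subseteq> V"
    using \<epsilon>(2) bnd_mono[of u v _ _ \<epsilon>] v by (auto dest: less_imp_le)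
  ultimately show "nhd_zero (wstep u v) V" unfolding nhd_zero_def by blast
qed

lemma lc_top_wstep: "lc_top (wstep u v)"
  unfolding lc_top_def
proof (intro conjI allI ballI impI)
  have "(\<lambda>\<alpha>. a * c \<alpha> + b * d \<alpha>) \<in> topspace (wstep u v)"
    if "c \<in> topspace (wstep u v)" "d \<in> topspace (wstep u v)" for c d a b
  proof -
    obtain C D where C: "0 \<le> C" "bnd u v C c" "0 \<le> D" "bnd u v D d"
      using \<open>c \<in> topspace _\<close> \<open>d \<in> topspace _\<close> unfolding topspace_wstep by blast
    then show ?thesis using wstepI[OF bnd_comb[OF C(2,4) u, of a b]] by simp
  qed
  moreover have "(\<lambda>_. 0) \<in> topspace (wstep u v)" by (rule wstepI[of 0]) (simp_all add: bnd_def)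
  ultimately show lin: "lin_space (topspace (wstep u v))"
    unfolding lin_space_def by blast
  {
    fix V assume "nhd_zero (wstep u v) V"
    then obtain \<epsilon> where \<epsilon>: "\<epsilon> > 0" "\<And>d. bnd u v \<epsilon> d \<Longrightarrow> d \<in> V"
      unfolding nhd_zero_wstep by blast
    have "abs_convex {d. bnd u v \<epsilon> d}"
      unfolding bnd_def using abs_convex_pointwise[of u "\<lambda>\<alpha>. \<epsilon> * v \<alpha>" "\<lambda>\<alpha>. \<alpha>"] u v \<epsilon>(1) by simp
    then show "\<exists>W. W \<subseteq> V \<and> abs_convex W \<and> nhd_zero (wstep u v) W"
      unfolding nhd_zero_wstep using \<epsilon> by (intro exI[of _ "{d. bnd u v \<epsilon> d}"]) blast
  }
  fix t :: real and x assume t: "0 < t" and x: "x \<in> topspace (wstep u v)"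
  let ?f = "\<lambda>d \<alpha>. of_real t * d \<alpha> + x \<alpha>"
  have map: "?f d \<in> ell_set \<infinity> (quot u v)" if "d \<in> ell_set \<infinity> (quot u v)" for d
    using lin_space_comb[OF lin _ x, of d "of_real t" 1] that by simp
  show "continuous_map (wstep u v) (wstep u v) ?f"
    unfolding continuous_map_def topspace_ell
  proof (intro conjI allI impI)
    fix U assume U: "openin (wstep u v) U"
    show "openin (wstep u v) {c \<in> ell_set \<infinity> (quot u v). ?f c \<in> U}"
      unfolding openin_ell
    proof (intro conjI ballI)
      fix c assume c: "c \<in> {c \<in> ell_set \<infinity> (quot u v). ?f c \<in> U}"
      then have "?f c \<in> U" by simp
      from bspec[OF conjunct2[OF U[unfolded openin_ell]] this] obtain \<epsilon> where \<epsilon>: "\<epsilon> > 0"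
        "\<forall>d\<in>ell_set \<infinity> (quot u v). ell_norm \<infinity> (quot u v) (\<lambda>\<alpha>. d \<alpha> - ?f c \<alpha>) < ennreal \<epsilon> \<longrightarrow> d \<in> U"
        by blast
      \<comment> \<open>The dilation costs the factor \<open>t\<close>, the passage through a
        non-strict bound the factor 2.\<close>
      let ?e = "\<epsilon> / (2 * t)"
      have "?f d \<in> U" if d: "d \<in> ell_set \<infinity> (quot u v)"
        "ell_norm \<infinity> (quot u v) (\<lambda>\<alpha>. d \<alpha> - c \<alpha>) < ennreal ?e" for d
      proof -
        have "bnd u v (\<epsilon> / 2) (\<lambda>\<alpha>. ?f d \<alpha> - ?f c \<alpha>)"
          using bnd_comb[OF bnd_less_if[OF d(2)] bnd_less_if[OF d(2)] u, of "of_real t" 0] t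
          by (simp add: algebra_simps)
        then have "ell_norm \<infinity> (quot u v) (\<lambda>\<alpha>. ?f d \<alpha> - ?f c \<alpha>) < ennreal \<epsilon>"
          by (rule ell_norm_less_if) (use \<epsilon>(1) in auto)
        then show ?thesis using bspec[OF \<epsilon>(2) map[OF d(1)]] by blast
      qed
      then show "\<exists>\<epsilon>>0. \<forall>d\<in>ell_set \<infinity> (quot u v). ell_norm \<infinity> (quot u v) (\<lambda>\<alpha>. d \<alpha> - c \<alpha>) < ennreal \<epsilon> \<longrightarrow>
          d \<in> {c \<in> ell_set \<infinity> (quot u v). ?f c \<in> U}"
        using t \<epsilon>(1) by (intro exI[of _ ?e]) auto
    qed blast
  qed (use map in blast)
qed

end

subsection \<open>Comparison of the exponents\<close>

lemma ennreal_powr_ennreal: "0 \<le> x \<Longrightarrow> ennreal_powr (ennreal x) a = ennreal (x powr a)"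
  by (simp add: ennreal_powr_def)

lemma ennreal_powr_inverse:
  assumes "0 < a" shows "ennreal_powr (ennreal_powr x a) (1 / a) = x"
proof (cases "x = \<infinity>")
  case False
  then obtain r where "0 \<le> r" "x = ennreal r" by (metis ennreal_cases infinity_ennreal_def)
  then show ?thesis using assms by (simp add: ennreal_powr_ennreal powr_powr)
qed (simp add: ennreal_powr_def)

text \<open>Each p-th power of an entry is one term of the sum of all of them.\<close>

lemma ell_norm_infinity_le: 
  assumes p: "0 < p" shows "ell_norm \<infinity> w c \<le> ell_norm p w c"
proof (cases "p = \<infinity>")
  case False
  have p': "0 < enn2real p" using p False by (simp add: enn2real_positive_iff less_top)
  let ?f = "\<lambda>\<alpha>. ennreal (norm (c \<alpha>)) * w \<alpha>"
  have "?f \<alpha> \<le> ell_norm p w c" for \<alpha>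
  proof -
    have "ennreal_powr (?f \<alpha>) (enn2real p) = (\<Sum>\<^sub>\<infinity>\<alpha>\<in>{\<alpha>}. ennreal_powr (?f \<alpha>) (enn2real p))" by simp
    also have "\<dots> \<le> (\<Sum>\<^sub>\<infinity>\<alpha>. ennreal_powr (?f \<alpha>) (enn2real p))"
      by (rule infsum_mono_neutral) (auto intro: nonneg_summable_on_complete)
    finally have "ennreal_powr (ennreal_powr (?f \<alpha>) (enn2real p)) (1 / enn2real p) \<le> ell_norm p w c"
      unfolding ell_norm_def lp_norm_def using False p' by (auto intro: ennreal_powr_mono)
    then show ?thesis using ennreal_powr_inverse[OF p'] by simp
  qed
  then show ?thesis
    unfolding ell_norm_def[of \<infinity>] lp_norm_def by (simp add: SUP_le_iff)
qed simp

lemma finer_step_ell_bounded: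
  assumes le: "\<And>c. ell_norm q w' c \<le> ennreal K * ell_norm p w c" and K: "0 < K"
  shows "finer_step (ell p w) (ell q w')"
proof -
  have sub: "ell_set p w \<subseteq> ell_set q w'"
  proof
    fix c assume "c \<in> ell_set p w"
    then have "ennreal K * ell_norm p w c < \<infinity>" by (simp add: ell_set_def ennreal_mult_less_top)
    then show "c \<in> ell_set q w'" using le[of c] by (auto simp: ell_set_def intro: le_less_trans)
  qed
  have "openin (ell p w) {x \<in> ell_set p w. id x \<in> U}" if U: "openin (ell q w') U" for U
    unfolding openin_ell
  proof (intro conjI ballI)
    fix c assume "c \<in> {x \<in> ell_set p w. id x \<in> U}"
    then have "c \<in> U" by simp
    from bspec[OF conjunct2[OF U[unfolded openin_ell]] this] obtain e where e: "e > 0"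
      "\<forall>d\<in>ell_set q w'. ell_norm q w' (\<lambda>\<alpha>. d \<alpha> - c \<alpha>) < ennreal e \<longrightarrow> d \<in> U"
      by blast
    have "d \<in> U" if d: "d \<in> ell_set p w" "ell_norm p w (\<lambda>\<alpha>. d \<alpha> - c \<alpha>) < ennreal (e / K)" for d
    proof -
      have "ennreal K * ell_norm p w (\<lambda>\<alpha>. d \<alpha> - c \<alpha>) < ennreal K * ennreal (e / K)"
        using d(2) K by (intro ennreal_mult_strict_left_mono) auto
      also have "\<dots> = ennreal e" using K e(1) by (simp flip: ennreal_mult)
      finally have "ell_norm q w' (\<lambda>\<alpha>. d \<alpha> - c \<alpha>) < ennreal e"
        using le le_less_trans by blast
      then show ?thesis using e(2) d(1) sub by blast
    qed
    then show "\<exists>\<epsilon>>0. \<forall>d\<in>ell_set p w. ell_norm p w (\<lambda>\<alpha>. d \<alpha> - c \<alpha>) < ennreal \<epsilon> \<longrightarrow> d \<in> {x \<in> ell_set p w. id x \<in> U}"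
      using K e(1) by (intro exI[of _ "e / K"]) auto
  qed blast
  then show ?thesis
    unfolding finer_step_def continuous_map_def using sub by auto
qed

lemma finer_step_ell_infinity: "0 < p \<Longrightarrow> finer_step (ell p w) (ell \<infinity> w)"
  using finer_step_ell_bounded[of \<infinity> w 1 p w] ell_norm_infinity_le[of p w] by simp

lemma infsum_ennreal_le:
  fixes f :: "'a \<Rightarrow> ennreal"
  assumes le: "\<And>\<alpha>. f \<alpha> \<le> ennreal (g \<alpha>)" and g: "\<And>\<alpha>. 0 \<le> g \<alpha>" "g summable_on UNIV"
  shows "infsum f UNIV \<le> ennreal (infsum g UNIV)"
proof (rule infsum_le_finite_sums)
  fix F :: "'a set" assume F: "finite F"
  have "sum f F \<le> (\<Sum>\<alpha>\<in>F. ennreal (g \<alpha>))" using le by (intro sum_mono)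
  also have "\<dots> = ennreal (sum g F)" using g(1) by (intro sum_ennreal)
  also have "\<dots> \<le> ennreal (infsum g UNIV)"
    using F g by (intro ennreal_leI finite_sum_le_infsum) auto
  finally show "sum f F \<le> ennreal (infsum g UNIV)" .
qed (simp add: nonneg_summable_on_complete)

text \<open>Each entry weighted by \<open>w'\<close> is at most \<open>g\<close> times the sup-norm
  of \<open>c\<close> for \<open>w\<close>, so the p-norm is at most the p-norm of \<open>g\<close>
  times this sup-norm. In the application \<open>g\<close> is geometric in the degree; its powers
  are summable for every positive exponent, which covers small \<open>p\<close> as well.\<close>

lemma finer_step_ell_exponent:
  assumes p: "0 < p" and w: "\<And>\<alpha>. w' \<alpha> \<le> ennreal (g \<alpha>) * w \<alpha>" and g: "\<And>\<alpha>. 0 \<le> g \<alpha>" "\<And>\<alpha>. g \<alpha> \<le> G"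
    and sum: "\<And>a. 0 < a \<Longrightarrow> (\<lambda>\<alpha>. g \<alpha> powr a) summable_on UNIV"
  shows "finer_step (ell \<infinity> w) (ell p w')"
proof -
  have pw: "ennreal (norm (c \<alpha>)) * w' \<alpha> \<le> ennreal (g \<alpha>) * ell_norm \<infinity> w c" for c \<alpha>
  proof -
    have "ennreal (norm (c \<alpha>)) * w' \<alpha> \<le> ennreal (norm (c \<alpha>)) * (ennreal (g \<alpha>) * w \<alpha>)"
      using w by (intro mult_left_mono) auto
    also have "\<dots> = ennreal (g \<alpha>) * (ennreal (norm (c \<alpha>)) * w \<alpha>)" by (simp add: ac_simps)
    also have "\<dots> \<le> ennreal (g \<alpha>) * ell_norm \<infinity> w c"
      unfolding ell_norm_def lp_norm_def by (auto intro!: mult_left_mono SUP_upper2)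
    finally show ?thesis .
  qed
  have G: "0 \<le> G" using g order_trans by blast
  show ?thesis
  proof (cases "p = \<infinity>")
    case True
    have "ell_norm p w' c \<le> ennreal (G + 1) * ell_norm \<infinity> w c" for c
    proof -
      have "ennreal (norm (c \<alpha>)) * w' \<alpha> \<le> ennreal (G + 1) * ell_norm \<infinity> w c" for \<alpha>
      proof -
      have "ennreal (g \<alpha>) * ell_norm \<infinity> w c \<le> ennreal (G + 1) * ell_norm \<infinity> w c"
        using g(2)[of \<alpha>] by (intro mult_right_mono ennreal_leI) auto
        then show ?thesis
          using pw[of c \<alpha>] by (rule order_trans[rotated])
      qed
      then show ?thesis
        unfolding True ell_norm_def[of _ w'] lp_norm_def by (simp add: SUP_le_iff)
    qed
    moreover have "0 < G + 1" using G by simp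
    ultimately show ?thesis by (rule finer_step_ell_bounded)
  next
    case False
    define a where "a = enn2real p"
    have a: "0 < a" using p False unfolding a_def by (simp add: enn2real_positive_iff less_top)
    define S where "S = (\<Sum>\<^sub>\<infinity>\<alpha>. g \<alpha> powr a)"
    have S: "0 \<le> S" unfolding S_def by (intro infsum_nonneg) simp
    \<comment> \<open>The added 1 keeps the factor positive, so that an infinite sup-norm yields an
      infinite bound.\<close>
    have "ell_norm p w' c \<le> ennreal (S powr (1 / a) + 1) * ell_norm \<infinity> w c" for c
    proof (cases "ell_norm \<infinity> w c = \<infinity>")
      case True
      moreover have "0 < S powr (1 / a) + 1" by (simp add: add_nonneg_pos)
      then have "ennreal (S powr (1 / a) + 1) \<noteq> 0" by (simp only: ennreal_eq_0_iff not_le)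
      ultimately show ?thesis by (simp only: infinity_ennreal_def ennreal_mult_top if_False top_greatest)
    next
      case False
      then obtain N where N: "0 \<le> N" "ell_norm \<infinity> w c = ennreal N"
        by (metis ennreal_cases infinity_ennreal_def)
      let ?f = "\<lambda>\<alpha>. ennreal (norm (c \<alpha>)) * w' \<alpha>"
      have "ennreal_powr (?f \<alpha>) a \<le> ennreal (g \<alpha> powr a * N powr a)" for \<alpha>
      proof -
        have "?f \<alpha> \<le> ennreal (g \<alpha> * N)" using pw[of c \<alpha>] N g(1) by (simp add: ennreal_mult)
        then have "ennreal_powr (?f \<alpha>) a \<le> ennreal_powr (ennreal (g \<alpha> * N)) a"
          using a by (intro ennreal_powr_mono) auto
        then show ?thesis using N g(1) by (simp add: ennreal_powr_ennreal powr_mult)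
      qed
      then have "(\<Sum>\<^sub>\<infinity>\<alpha>. ennreal_powr (?f \<alpha>) a) \<le> ennreal (\<Sum>\<^sub>\<infinity>\<alpha>. g \<alpha> powr a * N powr a)"
        using sum[OF a] by (intro infsum_ennreal_le summable_on_cmult_left) auto
      also have "(\<Sum>\<^sub>\<infinity>\<alpha>. g \<alpha> powr a * N powr a) = S * N powr a"
        unfolding S_def using sum[OF a] by (intro infsum_cmult_left) auto
      finally have "ell_norm p w' c \<le> ennreal_powr (ennreal (S * N powr a)) (1 / a)"
        unfolding ell_norm_def lp_norm_def a_def[symmetric] using \<open>p \<noteq> \<infinity>\<close> a
        by (auto intro: ennreal_powr_mono)
      also have "\<dots> = ennreal (S powr (1 / a) * N)"
        using S N a by (simp add: ennreal_powr_ennreal powr_mult powr_powr)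
      also have "\<dots> \<le> ennreal ((S powr (1 / a) + 1) * N)"
        using N by (intro ennreal_leI mult_right_mono) auto
      also have "\<dots> = ennreal (S powr (1 / a) + 1) * ell_norm \<infinity> w c"
        using N by (simp add: ennreal_mult)
      finally show ?thesis .
    qed
    moreover have "0 < S powr (1 / a) + 1" by (simp add: add_nonneg_pos)
    ultimately show ?thesis by (rule finer_step_ell_bounded)
  qed
qed

text \<open>The care is for zeros: if \<open>v' \<alpha> = 0\<close> then \<open>v \<alpha>\<close>
  is not positive, so the right-hand side is infinite unless \<open>u' \<alpha> = 0\<close>, and in
  that case the left-hand side vanishes too.\<close>

lemma quot_le_quot:
  assumes u: "\<And>\<alpha>. 0 \<le> u' \<alpha>" "u \<alpha> \<le> k * u' \<alpha>" and v: "0 \<le> v' \<alpha>" "v \<alpha> \<le> l * v' \<alpha>"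
    and kl: "0 < k" "0 < l"
  shows "quot u v' \<alpha> \<le> ennreal (k * l) * quot u' v \<alpha>"
proof (cases "v' \<alpha> = 0")
  case True
  then have v0: "ennreal (v \<alpha>) = 0" using v by (simp add: ennreal_neg)
  show ?thesis
  proof (cases "u \<alpha> \<le> 0")
    case True
    then show ?thesis by (simp add: quot_def ennreal_neg)
  next
    case False
    then have "0 < k * u' \<alpha>" using u(2) by linarith
    then have "ennreal (u' \<alpha>) \<noteq> 0" using kl(1) by (simp add: zero_less_mult_iff)
    then show ?thesis
      using kl by (simp add: quot_def v0 ennreal_divide_zero ennreal_mult_top)
  qed
next
  case False
  then have v': "0 < v' \<alpha>" using v by simp
  have "quot u v' \<alpha> \<le> ennreal (k * u' \<alpha>) / ennreal (v' \<alpha>)"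
    unfolding quot_def using u(2) by (intro divide_right_mono_ennreal ennreal_leI)
  also have "\<dots> \<le> ennreal (k * l) * quot u' v \<alpha>"
  proof (cases "0 < v \<alpha>")
    case True
    have "k * u' \<alpha> / v' \<alpha> \<le> k * l * (u' \<alpha> / v \<alpha>)"
    proof -
      have "u' \<alpha> * v \<alpha> \<le> u' \<alpha> * (l * v' \<alpha>)" using u(1) v by (intro mult_left_mono)
      then have "k * (u' \<alpha> * v \<alpha>) \<le> k * (u' \<alpha> * (l * v' \<alpha>))" using kl by (simp only: mult_left_mono less_imp_le)
      then have "k * u' \<alpha> * v \<alpha> \<le> k * l * u' \<alpha> * v' \<alpha>" by (simp only: ac_simps)
      then show ?thesis using True v' by (simp add: divide_le_eq le_divide_eq)
    qed
    then show ?thesis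
      using True v' u(1)[of \<alpha>] kl
      by (simp add: quot_def divide_ennreal ennreal_leI flip: ennreal_mult)
  next
    case False
    show ?thesis
    proof (cases "u' \<alpha> = 0")
      case False
      then show ?thesis using \<open>\<not> 0 < v \<alpha>\<close> u(1)[of \<alpha>] kl
        by (simp add: quot_def ennreal_neg ennreal_divide_zero ennreal_mult_top)
    qed simp
  qed
  finally show ?thesis .
qed

section \<open>Weight families\<close>

text \<open>The degree \<open>h\<close> measures the geometric factor that a change of index can
  absorb; \<open>super\<close> and \<open>sub\<close> replace multiplicativity up to a change of
  index and a constant. Weights may vanish, hence \<open>pos\<close>. The cofinal sequence yields
  directedness and drives the gliding hump argument, which runs through countably many
  steps.\<close>

locale weight_family =
  fixes I :: "'i set" and u :: "'i \<Rightarrow> 'a::comm_monoid_add \<Rightarrow> real" and h :: "'a \<Rightarrow> nat"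
  assumes cofinal: "\<exists>f::nat \<Rightarrow> 'i. range f \<subseteq> I \<and> (\<forall>i\<in>I. \<exists>k. \<forall>m\<ge>k. \<forall>\<alpha>. u i \<alpha> \<le> u (f m) \<alpha>)"
    and nonneg: "i \<in> I \<Longrightarrow> 0 \<le> u i \<alpha>"
    and gap: "i \<in> I \<Longrightarrow> \<exists>k\<in>I. \<exists>C>0. \<forall>\<alpha>. 2 ^ h \<alpha> * u i \<alpha> \<le> C * u k \<alpha>"
    and super: "i \<in> I \<Longrightarrow> \<exists>k\<in>I. \<exists>C>0. \<forall>\<alpha> \<gamma>. u i \<alpha> * u i \<gamma> \<le> C * u k (\<alpha> + \<gamma>)"
    and sub: "i \<in> I \<Longrightarrow> \<exists>k\<in>I. \<exists>C>0. \<forall>\<alpha> \<gamma>. u i (\<alpha> + \<gamma>) \<le> C * (u k \<alpha> * u k \<gamma>)"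
    and pos: "\<exists>i\<in>I. 0 < u i \<alpha>"
begin

lemma index_ne: "I \<noteq> {}"
  using cofinal by blast

lemma directed:
  assumes "i \<in> I" "j \<in> I"
  shows "\<exists>k\<in>I. (\<forall>\<alpha>. u i \<alpha> \<le> u k \<alpha>) \<and> (\<forall>\<alpha>. u j \<alpha> \<le> u k \<alpha>)"
proof -
  obtain f :: "nat \<Rightarrow> 'i" where f: "range f \<subseteq> I" "\<forall>i\<in>I. \<exists>k. \<forall>m\<ge>k. \<forall>\<alpha>. u i \<alpha> \<le> u (f m) \<alpha>"
    using cofinal by blast
  obtain k where k: "\<forall>m\<ge>k. \<forall>\<alpha>. u i \<alpha> \<le> u (f m) \<alpha>"
    using bspec[OF f(2) assms(1)] by (rule exE)
  obtain l where l: "\<forall>m\<ge>l. \<forall>\<alpha>. u j \<alpha> \<le> u (f m) \<alpha>"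
    using bspec[OF f(2) assms(2)] by (rule exE)
  have "f (max k l) \<in> I" using f(1) by blast
  then show ?thesis using k l by (intro bexI[of _ "f (max k l)"]) simp_all
qed

text \<open>Two gaps of factor 2 in succession. The factor 4 is what the kernel will cost.\<close>

lemma gap4:
  assumes "i \<in> I"
  shows "\<exists>k\<in>I. \<exists>C>0. \<forall>\<alpha>. 4 ^ h \<alpha> * u i \<alpha> \<le> C * u k \<alpha>"
proof -
  obtain k C where k: "k \<in> I" "C > 0" "\<And>\<alpha>. 2 ^ h \<alpha> * u i \<alpha> \<le> C * u k \<alpha>"
    using gap[OF assms] by blast
  obtain l D where l: "l \<in> I" "D > 0" "\<And>\<alpha>. 2 ^ h \<alpha> * u k \<alpha> \<le> D * u l \<alpha>"
    using gap[OF k(1)] by blast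
  have "4 ^ h \<alpha> * u i \<alpha> \<le> (C * D) * u l \<alpha>" for \<alpha>
  proof -
    have "4 ^ h \<alpha> * u i \<alpha> = 2 ^ h \<alpha> * (2 ^ h \<alpha> * u i \<alpha>)"
      by (simp flip: power_mult_distrib)
    also have "\<dots> \<le> 2 ^ h \<alpha> * (C * u k \<alpha>)" using k(3) by (intro mult_left_mono) auto
    also have "\<dots> = C * (2 ^ h \<alpha> * u k \<alpha>)" by (simp add: ac_simps)
    also have "\<dots> \<le> C * (D * u l \<alpha>)" using k(2) l(3) by (intro mult_left_mono) auto
    finally show ?thesis by (simp add: ac_simps)
  qed
  then show ?thesis using k(2) l(1,2) by (intro bexI[of _ l] exI[of _ "C * D"]) auto
qed

text \<open>Different indices are first raised to a common one, because \<open>super\<close>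
  compares a weight with itself.\<close>

lemma super4:
  assumes i: "i \<in> I" "j \<in> I"
  shows "\<exists>k\<in>I. \<exists>C>0. \<forall>\<alpha> \<gamma>. 4 ^ h (\<alpha> + \<gamma>) * (u i \<alpha> * u j \<gamma>) \<le> C * u k (\<alpha> + \<gamma>)"
proof -
  obtain m where m: "m \<in> I" "\<And>\<alpha>. u i \<alpha> \<le> u m \<alpha>" "\<And>\<alpha>. u j \<alpha> \<le> u m \<alpha>"
    using directed[OF i] by blast
  obtain k C where k: "k \<in> I" "C > 0" "\<And>\<alpha> \<gamma>. u m \<alpha> * u m \<gamma> \<le> C * u k (\<alpha> + \<gamma>)"
    using super[OF m(1)] by blast
  obtain l D where l: "l \<in> I" "D > 0" "\<And>\<alpha>. 4 ^ h \<alpha> * u k \<alpha> \<le> D * u l \<alpha>"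
    using gap4[OF k(1)] by blast
  have "4 ^ h (\<alpha> + \<gamma>) * (u i \<alpha> * u j \<gamma>) \<le> (C * D) * u l (\<alpha> + \<gamma>)" for \<alpha> \<gamma>
  proof -
    have "u i \<alpha> * u j \<gamma> \<le> u m \<alpha> * u m \<gamma>"
      using m nonneg i by (intro mult_mono) auto
    also have "\<dots> \<le> C * u k (\<alpha> + \<gamma>)" by (rule k(3))
    finally have "4 ^ h (\<alpha> + \<gamma>) * (u i \<alpha> * u j \<gamma>) \<le> 4 ^ h (\<alpha> + \<gamma>) * (C * u k (\<alpha> + \<gamma>))"
      by (rule mult_left_mono) simp
    also have "\<dots> = C * (4 ^ h (\<alpha> + \<gamma>) * u k (\<alpha> + \<gamma>))" by (simp add: ac_simps)
    also have "\<dots> \<le> C * (D * u l (\<alpha> + \<gamma>))" using k(2) l(3) by (intro mult_left_mono) auto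
    finally show ?thesis by (simp add: ac_simps)
  qed
  then show ?thesis using k(2) l(1,2) by (intro bexI[of _ l] exI[of _ "C * D"]) auto
qed

lemma sub4:
  assumes i: "i \<in> I"
  shows "\<exists>k\<in>I. \<exists>C>0. \<forall>\<alpha> \<gamma>. 4 ^ h (\<alpha> + \<gamma>) * u i (\<alpha> + \<gamma>) \<le> C * (u k \<alpha> * u k \<gamma>)"
proof -
  obtain k C where k: "k \<in> I" "C > 0" "\<And>\<alpha>. 4 ^ h \<alpha> * u i \<alpha> \<le> C * u k \<alpha>"
    using gap4[OF i] by blast
  obtain l D where l: "l \<in> I" "D > 0" "\<And>\<alpha> \<gamma>. u k (\<alpha> + \<gamma>) \<le> D * (u l \<alpha> * u l \<gamma>)"
    using sub[OF k(1)] by blast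
  have "4 ^ h (\<alpha> + \<gamma>) * u i (\<alpha> + \<gamma>) \<le> (C * D) * (u l \<alpha> * u l \<gamma>)" for \<alpha> \<gamma>
  proof -
    have "4 ^ h (\<alpha> + \<gamma>) * u i (\<alpha> + \<gamma>) \<le> C * u k (\<alpha> + \<gamma>)" by (rule k(3))
    also have "\<dots> \<le> C * (D * (u l \<alpha> * u l \<gamma>))" using k(2) l(3) by (intro mult_left_mono) auto
    finally show ?thesis by (simp add: ac_simps)
  qed
  then show ?thesis using k(2) l(1,2) by (intro bexI[of _ l] exI[of _ "C * D"]) auto
qed

end

subsection \<open>Families on products\<close>

text \<open>Turns a family in one variable into one on pairs, with \<open>g\<close> a projection;
  the degree then counts this variable only.\<close>

lemma weight_family_pullback:
  assumes "weight_family I u h" and add: "\<And>\<alpha> \<gamma>. g (\<alpha> + \<gamma>) = g \<alpha> + g \<gamma>"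
  shows "weight_family I (\<lambda>i \<alpha>. u i (g \<alpha>)) (\<lambda>\<alpha>. h (g \<alpha>))"
proof -
  interpret weight_family I u h by fact
  show ?thesis
  proof
    show "\<exists>f::nat \<Rightarrow> _. range f \<subseteq> I \<and> (\<forall>i\<in>I. \<exists>k. \<forall>m\<ge>k. \<forall>\<alpha>. u i (g \<alpha>) \<le> u (f m) (g \<alpha>))"
      using cofinal by meson
    fix i assume i: "i \<in> I"
    show "\<And>\<alpha>. 0 \<le> u i (g \<alpha>)" by (rule nonneg[OF i])
    show "\<exists>k\<in>I. \<exists>C>0. \<forall>\<alpha>. 2 ^ h (g \<alpha>) * u i (g \<alpha>) \<le> C * u k (g \<alpha>)"
      using gap[OF i] by meson
    show "\<exists>k\<in>I. \<exists>C>0. \<forall>\<alpha> \<gamma>. u i (g \<alpha>) * u i (g \<gamma>) \<le> C * u k (g (\<alpha> + \<gamma>))"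
      unfolding add using super[OF i] by meson
    show "\<exists>k\<in>I. \<exists>C>0. \<forall>\<alpha> \<gamma>. u i (g (\<alpha> + \<gamma>)) \<le> C * (u k (g \<alpha>) * u k (g \<gamma>))"
      unfolding add using sub[OF i] by meson
  qed (rule pos)
qed

text \<open>Its degree is zero, so the other family of a pair carries the whole degree.\<close>

lemma weight_family_trivial: "weight_family {()} (\<lambda>_ _. 1) (\<lambda>_. 0)"
  by unfold_locales (auto intro: exI[of _ "\<lambda>_. ()"] exI[of _ 1])

lemma weight_family_mult:
  assumes "weight_family I u hu" "weight_family J v hv"
  shows "weight_family (I \<times> J) (\<lambda>ij \<alpha>. u (fst ij) \<alpha> * v (snd ij) \<alpha>) (\<lambda>\<alpha>. hu \<alpha> + hv \<alpha>)"
proof -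
  interpret U: weight_family I u hu by fact
  interpret V: weight_family J v hv by fact
  show ?thesis
  proof
    obtain f :: "nat \<Rightarrow> _" where f: "range f \<subseteq> I" "\<forall>i\<in>I. \<exists>k. \<forall>m\<ge>k. \<forall>\<alpha>. u i \<alpha> \<le> u (f m) \<alpha>"
      using U.cofinal by blast
    obtain g :: "nat \<Rightarrow> _" where g: "range g \<subseteq> J" "\<forall>i\<in>J. \<exists>k. \<forall>m\<ge>k. \<forall>\<alpha>. v i \<alpha> \<le> v (g m) \<alpha>"
      using V.cofinal by blast
    let ?f = "\<lambda>m. (f m, g m)"
    have "\<exists>k. \<forall>m\<ge>k. \<forall>\<alpha>. u (fst ij) \<alpha> * v (snd ij) \<alpha> \<le> u (fst (?f m)) \<alpha> * v (snd (?f m)) \<alpha>"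
      if "ij \<in> I \<times> J" for ij
    proof -
      have ij: "fst ij \<in> I" "snd ij \<in> J" using \<open>ij \<in> I \<times> J\<close> by auto
      obtain k where k: "\<forall>m\<ge>k. \<forall>\<alpha>. u (fst ij) \<alpha> \<le> u (f m) \<alpha>"
        using bspec[OF f(2) ij(1)] by (rule exE)
      obtain l where l: "\<forall>m\<ge>l. \<forall>\<alpha>. v (snd ij) \<alpha> \<le> v (g m) \<alpha>"
        using bspec[OF g(2) ij(2)] by (rule exE)
      have "u (fst ij) \<alpha> * v (snd ij) \<alpha> \<le> u (f m) \<alpha> * v (g m) \<alpha>" if "m \<ge> max k l" for m \<alpha>
        using k l that f(1) g(1) ij by (intro mult_mono U.nonneg V.nonneg) auto
      then show ?thesis by (intro exI[of _ "max k l"]) simp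
    qed
    then show "\<exists>f::nat \<Rightarrow> _. range f \<subseteq> I \<times> J \<and>
        (\<forall>ij\<in>I \<times> J. \<exists>k. \<forall>m\<ge>k. \<forall>\<alpha>. u (fst ij) \<alpha> * v (snd ij) \<alpha> \<le> u (fst (f m)) \<alpha> * v (snd (f m)) \<alpha>)"
      using f(1) g(1) by (intro exI[of _ ?f]) auto
  next
    fix ij assume "ij \<in> I \<times> J"
    then have i: "fst ij \<in> I" and j: "snd ij \<in> J" by auto
    show "0 \<le> u (fst ij) \<alpha> * v (snd ij) \<alpha>" for \<alpha>
      using U.nonneg[OF i] V.nonneg[OF j] by simp
    show "\<exists>k\<in>I \<times> J. \<exists>C>0. \<forall>\<alpha>. 2 ^ (hu \<alpha> + hv \<alpha>) * (u (fst ij) \<alpha> * v (snd ij) \<alpha>) \<le> C * (u (fst k) \<alpha> * v (snd k) \<alpha>)"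
    proof -
      obtain k C where k: "k \<in> I" "C > 0" "\<And>\<alpha>. 2 ^ hu \<alpha> * u (fst ij) \<alpha> \<le> C * u k \<alpha>"
        using U.gap[OF i] by blast
      obtain l D where l: "l \<in> J" "D > 0" "\<And>\<alpha>. 2 ^ hv \<alpha> * v (snd ij) \<alpha> \<le> D * v l \<alpha>"
        using V.gap[OF j] by blast
      have "(2 ^ hu \<alpha> * u (fst ij) \<alpha>) * (2 ^ hv \<alpha> * v (snd ij) \<alpha>) \<le> (C * u k \<alpha>) * (D * v l \<alpha>)" for \<alpha>
        by (rule mult_mono[OF k(3) l(3)]) (use k(2) U.nonneg[OF k(1)] V.nonneg[OF j] in auto)
      then have "2 ^ (hu \<alpha> + hv \<alpha>) * (u (fst ij) \<alpha> * v (snd ij) \<alpha>) \<le> (C * D) * (u k \<alpha> * v l \<alpha>)" for \<alpha>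
        by (simp add: power_add ac_simps)
      then show ?thesis using k l by (intro bexI[of _ "(k, l)"] exI[of _ "C * D"]) auto
    qed
    show "\<exists>k\<in>I \<times> J. \<exists>C>0. \<forall>\<alpha> \<gamma>. (u (fst ij) \<alpha> * v (snd ij) \<alpha>) * (u (fst ij) \<gamma> * v (snd ij) \<gamma>) \<le>
        C * (u (fst k) (\<alpha> + \<gamma>) * v (snd k) (\<alpha> + \<gamma>))"
    proof -
      obtain k C where k: "k \<in> I" "C > 0" "\<And>\<alpha> \<gamma>. u (fst ij) \<alpha> * u (fst ij) \<gamma> \<le> C * u k (\<alpha> + \<gamma>)"
        using U.super[OF i] by blast
      obtain l D where l: "l \<in> J" "D > 0" "\<And>\<alpha> \<gamma>. v (snd ij) \<alpha> * v (snd ij) \<gamma> \<le> D * v l (\<alpha> + \<gamma>)"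
        using V.super[OF j] by blast
      have "(u (fst ij) \<alpha> * u (fst ij) \<gamma>) * (v (snd ij) \<alpha> * v (snd ij) \<gamma>) \<le> (C * u k (\<alpha> + \<gamma>)) * (D * v l (\<alpha> + \<gamma>))" for \<alpha> \<gamma>
        by (rule mult_mono[OF k(3) l(3)]) (use k(2) U.nonneg[OF k(1)] V.nonneg[OF j] in auto)
      then have "(u (fst ij) \<alpha> * v (snd ij) \<alpha>) * (u (fst ij) \<gamma> * v (snd ij) \<gamma>) \<le>
          (C * D) * (u k (\<alpha> + \<gamma>) * v l (\<alpha> + \<gamma>))" for \<alpha> \<gamma>
        by (simp add: ac_simps)
      then show ?thesis using k l by (intro bexI[of _ "(k, l)"] exI[of _ "C * D"]) auto
    qed
    show "\<exists>k\<in>I \<times> J. \<exists>C>0. \<forall>\<alpha> \<gamma>. u (fst ij) (\<alpha> + \<gamma>) * v (snd ij) (\<alpha> + \<gamma>) \<le>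
        C * ((u (fst k) \<alpha> * v (snd k) \<alpha>) * (u (fst k) \<gamma> * v (snd k) \<gamma>))"
    proof -
      obtain k C where k: "k \<in> I" "C > 0" "\<And>\<alpha> \<gamma>. u (fst ij) (\<alpha> + \<gamma>) \<le> C * (u k \<alpha> * u k \<gamma>)"
        using U.sub[OF i] by blast
      obtain l D where l: "l \<in> J" "D > 0" "\<And>\<alpha> \<gamma>. v (snd ij) (\<alpha> + \<gamma>) \<le> D * (v l \<alpha> * v l \<gamma>)"
        using V.sub[OF j] by blast
      have "u (fst ij) (\<alpha> + \<gamma>) * v (snd ij) (\<alpha> + \<gamma>) \<le> (C * (u k \<alpha> * u k \<gamma>)) * (D * (v l \<alpha> * v l \<gamma>))" for \<alpha> \<gamma>
        by (rule mult_mono[OF k(3) l(3)]) (use k(2) U.nonneg[OF k(1)] V.nonneg[OF j] in auto)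
      then have "u (fst ij) (\<alpha> + \<gamma>) * v (snd ij) (\<alpha> + \<gamma>) \<le>
          (C * D) * ((u k \<alpha> * v l \<alpha>) * (u k \<gamma> * v l \<gamma>))" for \<alpha> \<gamma>
        by (simp add: ac_simps)
      then show ?thesis using k l by (intro bexI[of _ "(k, l)"] exI[of _ "C * D"]) auto
    qed
  next
    fix \<alpha>
    obtain i j where "i \<in> I" "0 < u i \<alpha>" "j \<in> J" "0 < v j \<alpha>" using U.pos V.pos by blast
    then show "\<exists>ij\<in>I \<times> J. 0 < u (fst ij) \<alpha> * v (snd ij) \<alpha>"
      by (intro bexI[of _ "(i, j)"]) auto
  qed
qed

section \<open>Pairs of weight families\<close>

text \<open>The degree is shared between the two families, and only the total \<open>hu + hv\<close>
  meets the kernel. In \<open>kernel_le\<close> the factor at \<alpha> is the reserve for the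
  summation over \<alpha>. Summability is assumed for every ratio below 1, since the comparison of
  exponents sums arbitrary positive powers of a geometric weight.\<close>

locale weight_pair = U: weight_family I u hu + V: weight_family J v hv
  for I :: "'i set" and u :: "'i \<Rightarrow> 'a::comm_monoid_add \<Rightarrow> real" and hu
    and J :: "'j set" and v :: "'j \<Rightarrow> 'a \<Rightarrow> real" and hv +
  fixes \<kappa> :: "'a \<Rightarrow> 'a \<Rightarrow> real"
  assumes kernel_nonneg: "0 \<le> \<kappa> \<alpha> \<gamma>"
    and kernel_le: "2 ^ (hu \<alpha> + hv \<alpha>) * \<kappa> \<alpha> \<gamma> \<le> 4 ^ (hu (\<alpha> + \<gamma>) + hv (\<alpha> + \<gamma>))"
    and summable: "0 < x \<Longrightarrow> x < (1::real) \<Longrightarrow> (\<lambda>\<alpha>. x ^ (hu \<alpha> + hv \<alpha>)) summable_on UNIV"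
begin

definition E :: "ennreal \<Rightarrow> 'i \<Rightarrow> ('a \<Rightarrow> complex) topology" where
  "E p i = ind_lim J (\<lambda>j. ell p (quot (u i) (v j)))"

definition G :: "ennreal \<Rightarrow> 'i \<Rightarrow> ('a \<Rightarrow> complex) topology" where
  "G p i = proj_lim J (\<lambda>j. ell p (quot (v j) (u i)))"

definition PI :: "ennreal \<Rightarrow> ('a \<Rightarrow> complex) topology" where
  "PI p = proj_lim I (E p)"

definition IP :: "ennreal \<Rightarrow> ('a \<Rightarrow> complex) topology" where
  "IP p = ind_lim I (G p)"

lemma lc_top_step: "i \<in> I \<Longrightarrow> j \<in> J \<Longrightarrow> lc_top (wstep (u i) (v j))"
  by (intro lc_top_wstep U.nonneg V.nonneg)

lemma lc_top_step': "i \<in> I \<Longrightarrow> j \<in> J \<Longrightarrow> lc_top (wstep (v j) (u i))"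
  by (intro lc_top_wstep U.nonneg V.nonneg)

text \<open>Gaps in \<open>u\<close> and \<open>v\<close> together gain the factor (1/2)^(hu + hv),
  all of whose positive powers are summable. The index \<open>k\<close> is chosen from
  \<open>i\<close> before any index of \<open>J\<close> appears, because the steps are compared
  inside an outer limit over \<open>I\<close>.\<close>

lemma finer_step_gap:
  assumes p: "0 < p" and i: "i \<in> I" and j: "j \<in> J"
  shows "\<exists>k\<in>I. \<forall>j\<in>J. \<exists>l\<in>J. finer_step (ell \<infinity> (quot (u k) (v j))) (ell p (quot (u i) (v l)))"
    and "\<exists>k\<in>I. \<forall>l\<in>J. \<exists>j\<in>J. finer_step (ell \<infinity> (quot (v j) (u i))) (ell p (quot (v l) (u k)))"
proof -
  have summ: "(\<lambda>\<alpha>. (K * (1/2) ^ (hu \<alpha> + hv \<alpha>)) powr a) summable_on UNIV" if "0 < a" "0 < K" for a K :: real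
  proof -
    have "(K * (1/2) ^ (hu \<alpha> + hv \<alpha>)) powr a = K powr a * ((1/2) powr a) ^ (hu \<alpha> + hv \<alpha>)" for \<alpha>
      using that by (simp add: powr_mult powr_realpow[symmetric] powr_powr ac_simps del: of_nat_add)
    moreover have "(1/2) powr a < (1::real)"
      using that by (simp add: powr01_less_one)
    ultimately show ?thesis
      using summable_on_cmult_right[OF summable[of "(1/2) powr a"], of "K powr a"] by simp
  qed
  have half: "x \<le> (1/2) ^ n * y" if "2 ^ n * x \<le> (y::real)" for n x y
    using that by (simp add: power_one_over field_simps)
  obtain k C where k: "k \<in> I" "C > 0" "\<And>\<alpha>. 2 ^ hu \<alpha> * u i \<alpha> \<le> C * u k \<alpha>"
    using U.gap[OF i] by blast
  \<comment> \<open>One pair of gaps serves both claims, the weights being reciprocal quotients; in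
    the second claim the two indices of \<open>J\<close> exchange their roles.\<close>
  have fs: "\<exists>l\<in>J. finer_step (ell \<infinity> (quot (u k) (v j))) (ell p (quot (u i) (v l))) \<and>
      finer_step (ell \<infinity> (quot (v l) (u i))) (ell p (quot (v j) (u k)))" if j: "j \<in> J" for j
  proof -
    obtain l D where l: "l \<in> J" "D > 0" "\<And>\<alpha>. 2 ^ hv \<alpha> * v j \<alpha> \<le> D * v l \<alpha>"
      using V.gap[OF j] by blast
    have ui: "u i \<alpha> \<le> C * (1/2) ^ hu \<alpha> * u k \<alpha>" for \<alpha>
      using half[OF k(3)[of \<alpha>]] by (simp only: ac_simps)
    have vj: "v j \<alpha> \<le> D * (1/2) ^ hv \<alpha> * v l \<alpha>" for \<alpha>
      using half[OF l(3)[of \<alpha>]] by (simp only: ac_simps)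
    have le1: "quot (u i) (v l) \<alpha> \<le> ennreal ((C * D) * (1/2) ^ (hu \<alpha> + hv \<alpha>)) * quot (u k) (v j) \<alpha>" for \<alpha>
      using quot_le_quot[of "u k" "u i" \<alpha> _ "v l" "v j", OF U.nonneg[OF k(1)] ui V.nonneg[OF l(1)] vj] k l
      by (simp add: power_add ac_simps)
    have le2: "quot (v j) (u k) \<alpha> \<le> ennreal ((C * D) * (1/2) ^ (hu \<alpha> + hv \<alpha>)) * quot (v l) (u i) \<alpha>" for \<alpha>
      using quot_le_quot[of "v l" "v j" \<alpha> _ "u k" "u i", OF V.nonneg[OF l(1)] vj U.nonneg[OF k(1)] ui] k l
      by (simp add: power_add ac_simps)
    have CD: "0 < C * D" using k l by simp
    have bd: "(C * D) * (1/2) ^ (hu \<alpha> + hv \<alpha>) \<le> C * D" for \<alpha>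
      using mult_left_mono[of "(1/2) ^ (hu \<alpha> + hv \<alpha>)" 1 "C * D"] CD by (simp add: power_le_one)
    have nn: "0 \<le> (C * D) * (1/2) ^ (hu \<alpha> + hv \<alpha>)" for \<alpha> using CD by simp
    show ?thesis
      using finer_step_ell_exponent[OF p le1 nn bd summ] finer_step_ell_exponent[OF p le2 nn bd summ] CD l(1)
      by blast
  qed
  then show "\<exists>k\<in>I. \<forall>j\<in>J. \<exists>l\<in>J. finer_step (ell \<infinity> (quot (u k) (v j))) (ell p (quot (u i) (v l)))"
    "\<exists>k\<in>I. \<forall>l\<in>J. \<exists>j\<in>J. finer_step (ell \<infinity> (quot (v j) (u i))) (ell p (quot (v l) (u k)))"
    using k(1) by blast+
qed

lemma zero_in_G: assumes "0 < p" shows "(\<lambda>_. 0) \<in> topspace (G p i)"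
  unfolding G_def topspace_proj_lim[OF V.index_ne] by (simp add: zero_in_ell_set assms)

text \<open>The comparison is between limits and not between steps: passing from the sup-norm to the
  exponent \<open>p\<close> costs a gap, that is, a change of both indices, which the limits
  absorb.\<close>

lemma PI_exponent: assumes p: "0 < p" shows "PI p = PI \<infinity>"
proof (rule finer_step_antisym)
  obtain j0 where j0: "j0 \<in> J" using V.index_ne by blast
  have pinf: "(0::ennreal) < \<infinity>" by simp
  show "finer_step (PI p) (PI \<infinity>)"
    unfolding PI_def E_def
    using finer_step_ell_infinity[OF p]
    by (intro finer_step_proj_limI[OF U.index_ne] bexI finer_step_ind_limI)
      (simp_all only: topspace_ell zero_in_ell_set p pinf)
  show "finer_step (PI \<infinity>) (PI p)"
    unfolding PI_def
  proof (rule finer_step_proj_limI[OF U.index_ne])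
    fix i assume "i \<in> I"
    from finer_step_gap(1)[OF p this j0] obtain k where k: "k \<in> I"
      "\<forall>j\<in>J. \<exists>l\<in>J. finer_step (ell \<infinity> (quot (u k) (v j))) (ell p (quot (u i) (v l)))" by blast
    then have "finer_step (E \<infinity> k) (E p i)"
      unfolding E_def by (intro finer_step_ind_limI) (auto simp: zero_in_ell_set p)
    then show "\<exists>k\<in>I. finer_step (E \<infinity> k) (E p i)" using k(1) by blast
  qed
qed

lemma IP_exponent: assumes p: "0 < p" shows "IP p = IP \<infinity>"
proof (rule finer_step_antisym)
  obtain j0 where j0: "j0 \<in> J" using V.index_ne by blast
  have "finer_step (G p i) (G \<infinity> i)" for i
    unfolding G_def
    using finer_step_ell_infinity[OF p] by (intro finer_step_proj_limI[OF V.index_ne]) blast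
  then show "finer_step (IP p) (IP \<infinity>)"
    unfolding IP_def
    by (intro finer_step_ind_limI) (auto simp: zero_in_G p)
  show "finer_step (IP \<infinity>) (IP p)"
    unfolding IP_def
  proof (rule finer_step_ind_limI)
    fix i assume "i \<in> I"
    from finer_step_gap(2)[OF p this j0] obtain k where k: "k \<in> I"
      "\<forall>l\<in>J. \<exists>j\<in>J. finer_step (ell \<infinity> (quot (v j) (u i))) (ell p (quot (v l) (u k)))" by blast
    then have "finer_step (G \<infinity> i) (G p k)"
      unfolding G_def by (intro finer_step_proj_limI[OF V.index_ne]) blast
    then show "\<exists>k\<in>I. finer_step (G \<infinity> i) (G p k)" using k(1) by blast
  qed (simp_all add: zero_in_G p)
qed

section \<open>The product on coefficients\<close>

abbreviation h where "h \<alpha> \<equiv> hu \<alpha> + hv \<alpha>"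

definition summand :: "('a \<Rightarrow> complex) \<Rightarrow> ('a \<Rightarrow> complex) \<Rightarrow> 'a \<Rightarrow> 'a \<Rightarrow> complex" where
  "summand c d \<gamma> \<alpha> = c \<alpha> * d (\<alpha> + \<gamma>) * of_real (\<kappa> \<alpha> \<gamma>)"

definition S :: "('a \<Rightarrow> complex) \<Rightarrow> ('a \<Rightarrow> complex) \<Rightarrow> 'a \<Rightarrow> complex" where
  "S c d \<gamma> = (\<Sum>\<^sub>\<infinity>\<alpha>. summand c d \<gamma> \<alpha>)"

definition \<Sigma>h :: real where "\<Sigma>h = (\<Sum>\<^sub>\<infinity>\<alpha>. (1/2) ^ h \<alpha>)"

lemma half_summable: "(\<lambda>\<alpha>. (1/2::real) ^ h \<alpha>) summable_on UNIV"
  by (rule summable) auto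

lemma \<Sigma>h_nonneg: "0 \<le> \<Sigma>h"
  unfolding \<Sigma>h_def by (intro infsum_nonneg) simp

text \<open>The weights are abstract because the two families exchange roles for the two orders of
  the factors. After multiplication by \<open>a \<alpha>\<close>, inequality \<open>A\<close> moves
  \<open>a \<alpha> * b \<gamma>\<close> to the index \<alpha> + \<gamma>, the bound on
  \<open>y\<close> trades \<open>e\<close> for \<open>d\<close>, inequality \<open>B\<close> splits
  \<open>d\<close> again, and the bound on \<open>x\<close> returns \<open>a \<alpha>\<close>, which
  is then cancelled.\<close>

lemma summand_bound:
  assumes hh: "\<And>\<alpha>. h1 \<alpha> + h2 \<alpha> = h \<alpha>"
    and A: "\<And>\<alpha> \<gamma>. 4 ^ h1 (\<alpha> + \<gamma>) * (a \<alpha> * b \<gamma>) \<le> C * e (\<alpha> + \<gamma>)"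
    and B: "\<And>\<alpha> \<gamma>. 4 ^ h2 (\<alpha> + \<gamma>) * d (\<alpha> + \<gamma>) \<le> D * (f \<alpha> * g \<gamma>)"
    and x: "bnd f a C1 x" and y: "bnd e d C2 y"
    and zero: "(\<forall>\<alpha>. a \<alpha> = 0 \<longrightarrow> x \<alpha> = 0) \<or> (\<forall>\<alpha>. d \<alpha> = 0 \<longrightarrow> y \<alpha> = 0)"
    and nonneg: "\<And>\<alpha>. 0 \<le> a \<alpha>" "\<And>\<alpha>. 0 \<le> b \<alpha>" "\<And>\<alpha>. 0 \<le> d \<alpha>" "\<And>\<alpha>. 0 \<le> f \<alpha>" "\<And>\<alpha>. 0 \<le> g \<alpha>"
    and const: "0 \<le> C" "0 \<le> D" "0 \<le> C1" "0 \<le> C2"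
  shows "norm (summand x y \<gamma> \<alpha>) * b \<gamma> \<le> (1/2) ^ h \<alpha> * (C * D * C1 * C2 * g \<gamma>)"
proof -
  let ?P = "4 ^ h1 (\<alpha> + \<gamma>) :: real" and ?Q = "4 ^ h2 (\<alpha> + \<gamma>) :: real"
  let ?x = "norm (x \<alpha>)" and ?y = "norm (y (\<alpha> + \<gamma>))"
  have main: "?P * ?Q * ?x * ?y * b \<gamma> \<le> C * D * C1 * C2 * g \<gamma>"
  proof (cases "?x = 0 \<or> ?y = 0")
    case True
    then show ?thesis using nonneg const by auto
  next
    case xy: False
    have Q_le: "?Q * (?P * (?y * (a \<alpha> * b \<gamma>))) \<le> C * C2 * D * (f \<alpha> * g \<gamma>)"
    proof -
      have "?P * (?y * (a \<alpha> * b \<gamma>)) = ?y * (?P * (a \<alpha> * b \<gamma>))" by (simp only: ac_simps)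
      also have "\<dots> \<le> ?y * (C * e (\<alpha> + \<gamma>))" by (intro mult_left_mono A) simp
      also have "\<dots> = C * (?y * e (\<alpha> + \<gamma>))" by (simp only: ac_simps)
      also have "\<dots> \<le> C * (C2 * d (\<alpha> + \<gamma>))" by (intro mult_left_mono bndD[OF y] const)
      finally have "?Q * (?P * (?y * (a \<alpha> * b \<gamma>))) \<le> ?Q * (C * (C2 * d (\<alpha> + \<gamma>)))"
        by (rule mult_left_mono) simp
      also have "\<dots> = C * C2 * (?Q * d (\<alpha> + \<gamma>))" by (simp only: ac_simps)
      also have "\<dots> \<le> C * C2 * (D * (f \<alpha> * g \<gamma>))" by (intro mult_left_mono B mult_nonneg_nonneg const)
      finally show ?thesis by (simp only: ac_simps)
    qed
    have "?x * (?Q * (?P * (?y * (a \<alpha> * b \<gamma>)))) \<le> ?x * (C * C2 * D * (f \<alpha> * g \<gamma>))"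
      by (rule mult_left_mono[OF Q_le]) simp
    also have "\<dots> = C * C2 * D * g \<gamma> * (?x * f \<alpha>)" by (simp only: ac_simps)
    also have "\<dots> \<le> C * C2 * D * g \<gamma> * (C1 * a \<alpha>)"
      by (intro mult_left_mono bndD[OF x] mult_nonneg_nonneg const nonneg)
    finally have *: "(?P * ?Q * ?x * ?y * b \<gamma>) * a \<alpha> \<le> (C * D * C1 * C2 * g \<gamma>) * a \<alpha>"
      by (simp only: ac_simps)
    show ?thesis
    proof (cases "a \<alpha> = 0")
      case False
      then have "0 < a \<alpha>" using nonneg(1)[of \<alpha>] by simp
      with * show ?thesis by simp
    next
      case True
      \<comment> \<open>Nothing can be cancelled if \<open>a \<alpha> = 0\<close>. But then the
        bound on \<open>x\<close> forces \<open>f \<alpha> = 0\<close>, next \<open>B\<close> forces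
        \<open>d (\<alpha> + \<gamma>) = 0\<close>, and \<open>zero\<close> makes one of the two
        factors vanish.\<close>
      then have "\<forall>\<alpha>. d \<alpha> = 0 \<longrightarrow> y \<alpha> = 0" using zero xy by auto
      moreover have "?x * f \<alpha> \<le> 0" using bndD[OF x, of \<alpha>] True by simp
      then have "f \<alpha> = 0" using xy nonneg(4)[of \<alpha>] by (simp add: mult_le_0_iff)
      then have "?Q * d (\<alpha> + \<gamma>) \<le> 0" using B[of \<alpha> \<gamma>] by simp
      then have "d (\<alpha> + \<gamma>) = 0"
        using nonneg(3)[of "\<alpha> + \<gamma>"] zero_less_power[of "4::real" "h2 (\<alpha> + \<gamma>)"]
        by (auto simp: mult_le_0_iff simp del: zero_less_power)
      ultimately show ?thesis using xy by simp
    qed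
  qed
  \<comment> \<open>The kernel together with the reserve at \<alpha> costs 4^h at \<alpha> +
    \<gamma>, which is the product of the two powers already paid for.\<close>
  have "2 ^ h \<alpha> * (norm (summand x y \<gamma> \<alpha>) * b \<gamma>) = (2 ^ h \<alpha> * \<kappa> \<alpha> \<gamma>) * (?x * ?y * b \<gamma>)"
    using kernel_nonneg[of \<alpha> \<gamma>] by (simp add: summand_def norm_mult ac_simps)
  also have "\<dots> \<le> 4 ^ h (\<alpha> + \<gamma>) * (?x * ?y * b \<gamma>)"
    by (intro mult_right_mono kernel_le mult_nonneg_nonneg nonneg) auto
  also have "\<dots> = ?P * ?Q * ?x * ?y * b \<gamma>"
    by (simp add: hh[symmetric] power_add)
  also note main
  finally show ?thesis by (simp add: power_one_over field_simps)
qed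

text \<open>Where \<open>b \<gamma> = 0\<close> the hypothesis says nothing about the series, but
  there the bound on \<open>S\<close> is trivial. Hence summability is concluded only for
  \<open>b \<gamma> > 0\<close>.\<close>

lemma S_bound:
  assumes K: "\<And>\<alpha> \<gamma>. norm (summand x y \<gamma> \<alpha>) * b \<gamma> \<le> (1/2) ^ h \<alpha> * (K * g \<gamma>)"
    and b: "\<And>\<gamma>. 0 \<le> b \<gamma>" and g: "\<And>\<gamma>. 0 \<le> g \<gamma>" and K0: "0 \<le> K"
  shows "0 < b \<gamma> \<Longrightarrow> summand x y \<gamma> summable_on UNIV" and "bnd b g (\<Sigma>h * K) (S x y)"
proof -
  have ptw: "norm (summand x y \<gamma> \<alpha>) \<le> (1/2) ^ h \<alpha> * (K * g \<gamma> / b \<gamma>)" if "0 < b \<gamma>" for \<alpha> \<gamma>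
    using K[of \<gamma> \<alpha>] that by (simp add: field_simps)
  have summ: "(\<lambda>\<alpha>. (1/2) ^ h \<alpha> * (K * g \<gamma> / b \<gamma>)) summable_on UNIV" for \<gamma>
    using summable_on_cmult_left[OF half_summable] .
  have abs: "(\<lambda>\<alpha>. norm (summand x y \<gamma> \<alpha>)) summable_on UNIV" if "0 < b \<gamma>" for \<gamma>
    by (rule summable_on_comparison_test[OF summ]) (use ptw that in auto)
  then show "0 < b \<gamma> \<Longrightarrow> summand x y \<gamma> summable_on UNIV"
    using abs_summable_summable by blast
  show "bnd b g (\<Sigma>h * K) (S x y)"
  proof (rule bndI)
    fix \<gamma>
    show "norm (S x y \<gamma>) * b \<gamma> \<le> \<Sigma>h * K * g \<gamma>"
    proof (cases "b \<gamma> = 0")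
      case True
      then show ?thesis using \<Sigma>h_nonneg K0 g by simp
    next
      case False
      then have b0: "0 < b \<gamma>" using b[of \<gamma>] by simp
      have "norm (S x y \<gamma>) \<le> (\<Sum>\<^sub>\<infinity>\<alpha>. norm (summand x y \<gamma> \<alpha>))"
        unfolding S_def using norm_infsum_bound[OF abs[OF b0]] .
      also have "\<dots> \<le> (\<Sum>\<^sub>\<infinity>\<alpha>. (1/2) ^ h \<alpha> * (K * g \<gamma> / b \<gamma>))"
        using abs[OF b0] summ ptw[OF b0] by (intro infsum_mono)
      also have "\<dots> = \<Sigma>h * (K * g \<gamma> / b \<gamma>)"
        unfolding \<Sigma>h_def using half_summable by (intro infsum_cmult_left) auto
      finally show ?thesis using b0 by (simp add: field_simps)
    qed
  qed
qed

lemma S_comb_left: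
  assumes "summand c y \<gamma> summable_on UNIV" "summand d y \<gamma> summable_on UNIV"
  shows "S (\<lambda>\<alpha>. a * c \<alpha> + b * d \<alpha>) y \<gamma> = a * S c y \<gamma> + b * S d y \<gamma>"
proof -
  have "S (\<lambda>\<alpha>. a * c \<alpha> + b * d \<alpha>) y \<gamma> = (\<Sum>\<^sub>\<infinity>\<alpha>. a * summand c y \<gamma> \<alpha> + b * summand d y \<gamma> \<alpha>)"
    unfolding S_def summand_def by (simp add: algebra_simps)
  then show ?thesis
    using assms by (simp add: S_def infsum_add infsum_cmult_right summable_on_cmult_right)
qed

lemma S_comb_right:
  assumes "summand x c \<gamma> summable_on UNIV" "summand x d \<gamma> summable_on UNIV"
  shows "S x (\<lambda>\<alpha>. a * c \<alpha> + b * d \<alpha>) \<gamma> = a * S x c \<gamma> + b * S x d \<gamma>"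
proof -
  have "S x (\<lambda>\<alpha>. a * c \<alpha> + b * d \<alpha>) \<gamma> = (\<Sum>\<^sub>\<infinity>\<alpha>. a * summand x c \<gamma> \<alpha> + b * summand x d \<gamma> \<alpha>)"
    unfolding S_def summand_def by (simp add: algebra_simps)
  then show ?thesis
    using assms by (simp add: S_def infsum_add infsum_cmult_right summable_on_cmult_right)
qed

subsection \<open>The limit spaces\<close>

definition Es :: "'i \<Rightarrow> ('a \<Rightarrow> complex) set" where
  "Es i = {c. \<exists>j\<in>J. \<exists>C\<ge>0. bnd (u i) (v j) C c}"

definition Gs :: "'i \<Rightarrow> ('a \<Rightarrow> complex) set" where
  "Gs i = {c. \<forall>j\<in>J. \<exists>C\<ge>0. bnd (v j) (u i) C c}"

lemma zero_step: "(\<lambda>_. 0) \<in> topspace (wstep a b)"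
  by (simp add: zero_in_ell_set)

lemma topspace_E: "i \<in> I \<Longrightarrow> topspace (E \<infinity> i) = Es i"
  unfolding E_def Es_def topspace_ind_lim[OF zero_step]
  using topspace_wstep[of "u i" "v _"] U.nonneg V.nonneg by auto

lemma topspace_G: "i \<in> I \<Longrightarrow> topspace (G \<infinity> i) = Gs i"
  unfolding G_def Gs_def topspace_proj_lim[OF V.index_ne]
  using topspace_wstep[of "v _" "u i"] U.nonneg V.nonneg by auto

lemma lc_top_E: "i \<in> I \<Longrightarrow> lc_top (E \<infinity> i)"
  unfolding E_def
proof (rule lc_top_ind_lim)
  fix j k assume i: "i \<in> I" and jk: "j \<in> J" "k \<in> J"
  obtain l where l: "l \<in> J" "\<And>\<alpha>. v j \<alpha> \<le> v l \<alpha>" "\<And>\<alpha>. v k \<alpha> \<le> v l \<alpha>"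
    using V.directed[OF jk] by blast
  have "topspace (wstep (u i) (v m)) \<subseteq> topspace (wstep (u i) (v l))" if m: "m \<in> J" and "\<And>\<alpha>. v m \<alpha> \<le> v l \<alpha>" for m
  proof
    fix c assume "c \<in> topspace (wstep (u i) (v m))"
    then obtain C where "0 \<le> C" "bnd (u i) (v m) C c"
      using topspace_wstep[of "u i" "v m"] U.nonneg[OF i] V.nonneg[OF m] by blast
    then have "bnd (u i) (v l) C c"
      using that(2) by (intro bndI) (meson bndD mult_left_mono order_trans)
    then show "c \<in> topspace (wstep (u i) (v l))"
      using \<open>0 \<le> C\<close> topspace_wstep[of "u i" "v l"] U.nonneg[OF i] V.nonneg[OF l(1)] by blast
  qed
  then show "\<exists>l\<in>J. topspace (wstep (u i) (v j)) \<subseteq> topspace (wstep (u i) (v l)) \<and>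
      topspace (wstep (u i) (v k)) \<subseteq> topspace (wstep (u i) (v l))"
    using l jk by blast
qed (use lc_top_step V.index_ne in auto)

lemma lc_top_G: "i \<in> I \<Longrightarrow> lc_top (G \<infinity> i)"
  unfolding G_def using lc_top_step' by (intro lc_top_proj_lim[OF V.index_ne])

lemma lc_top_PI: "lc_top (PI \<infinity>)"
  unfolding PI_def by (intro lc_top_proj_lim[OF U.index_ne] lc_top_E)

lemma Gs_mono:
  assumes "i \<in> I" "k \<in> I" "\<And>\<alpha>. u i \<alpha> \<le> u k \<alpha>" shows "Gs i \<subseteq> Gs k"
proof
  fix c assume c: "c \<in> Gs i"
  have "\<exists>C\<ge>0. bnd (v j) (u k) C c" if "j \<in> J" for j
  proof -
    obtain C where "0 \<le> C" "bnd (v j) (u i) C c" using c \<open>j \<in> J\<close> unfolding Gs_def by blast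
    then have "bnd (v j) (u k) C c"
      using assms(3) by (intro bndI) (meson bndD mult_left_mono order_trans)
    then show ?thesis using \<open>0 \<le> C\<close> by blast
  qed
  then show "c \<in> Gs k" unfolding Gs_def by blast
qed

lemma lc_top_IP: "lc_top (IP \<infinity>)"
  unfolding IP_def
proof (rule lc_top_ind_lim)
  fix i k assume ik: "i \<in> I" "k \<in> I"
  obtain l where l: "l \<in> I" "\<And>\<alpha>. u i \<alpha> \<le> u l \<alpha>" "\<And>\<alpha>. u k \<alpha> \<le> u l \<alpha>"
    using U.directed[OF ik] by blast
  then show "\<exists>l\<in>I. topspace (G \<infinity> i) \<subseteq> topspace (G \<infinity> l) \<and> topspace (G \<infinity> k) \<subseteq> topspace (G \<infinity> l)"
    using Gs_mono[of i l] Gs_mono[of k l] ik by (intro bexI[of _ l]) (simp_all only: topspace_G)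
qed (use lc_top_G U.index_ne in auto)

lemma topspace_PI: "topspace (PI \<infinity>) = (\<Inter>i\<in>I. Es i)"
  unfolding PI_def topspace_proj_lim[OF U.index_ne] by (simp only: topspace_E cong: INF_cong)

lemma topspace_IP: "topspace (IP \<infinity>) = (\<Union>i\<in>I. Gs i)"
proof -
  have "topspace (IP \<infinity>) = (\<Union>i\<in>I. topspace (G \<infinity> i))"
    unfolding IP_def by (rule topspace_ind_lim) (simp add: zero_in_G)
  then show ?thesis by (simp only: topspace_G cong: SUP_cong)
qed

text \<open>Some \<open>v j\<close> is positive at \<alpha>, and the bound for this \<open>j\<close>
  leaves no room. This supplies the condition \<open>zero\<close> of
  \<open>summand_bound\<close>.\<close>

lemma Gs_zero:
  assumes "i \<in> I" "x \<in> Gs i" "u i \<alpha> = 0" shows "x \<alpha> = 0"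
proof -
  obtain j where j: "j \<in> J" "0 < v j \<alpha>" using V.pos by blast
  then obtain C where "bnd (v j) (u i) C x" using assms unfolding Gs_def by blast
  then have "norm (x \<alpha>) * v j \<alpha> \<le> 0" using bndD[of "v j" "u i" C x \<alpha>] assms(3) by simp
  then show ?thesis using j by (simp add: mult_le_0_iff)
qed

text \<open>Packaged so that the quantifiers over the indices stay readable. The index
  \<open>l\<close> has two tasks: it selects the bound used for \<open>x\<close>, and it is the step
  in which the product lies.\<close>

definition bound_IP_PI :: "'i \<Rightarrow> 'i \<Rightarrow> 'i \<Rightarrow> 'j \<Rightarrow> 'j \<Rightarrow> real \<Rightarrow> bool" where
  "bound_IP_PI i0 i2 i j l K \<longleftrightarrow> 0 \<le> K \<and> (\<forall>x y C1 C2. 0 \<le> C1 \<longrightarrow> 0 \<le> C2 \<longrightarrow> x \<in> Gs i0 \<longrightarrow>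
    bnd (v l) (u i0) C1 x \<longrightarrow> bnd (u i) (v j) C2 y \<longrightarrow>
    bnd (u i2) (v l) (K * (C1 * C2)) (S x y) \<and> (\<forall>\<gamma>. 0 < u i2 \<gamma> \<longrightarrow> summand x y \<gamma> summable_on UNIV))"

text \<open>Here \<open>i\<close> has two tasks, for \<open>y\<close> and for the product. The index
  \<open>k\<close> is prescribed by the target, and \<open>l\<close> may depend on it, as an element
  of \<open>Gs i0\<close> has a bound for every \<open>l\<close>.\<close>

definition bound_PI_IP :: "'i \<Rightarrow> 'i \<Rightarrow> 'j \<Rightarrow> 'j \<Rightarrow> 'j \<Rightarrow> real \<Rightarrow> bool" where
  "bound_PI_IP i0 i j k l K \<longleftrightarrow> 0 \<le> K \<and> (\<forall>y x C1 C2. 0 \<le> C1 \<longrightarrow> 0 \<le> C2 \<longrightarrow> x \<in> Gs i0 \<longrightarrow>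
    bnd (u i) (v j) C1 y \<longrightarrow> bnd (v l) (u i0) C2 x \<longrightarrow>
    bnd (v k) (u i) (K * (C1 * C2)) (S y x) \<and> (\<forall>\<gamma>. 0 < v k \<gamma> \<longrightarrow> summand y x \<gamma> summable_on UNIV))"

lemma bound_IP_PID:
  assumes "bound_IP_PI i0 i2 i j l K" "0 \<le> C1" "0 \<le> C2" "x \<in> Gs i0"
    "bnd (v l) (u i0) C1 x" "bnd (u i) (v j) C2 y"
  shows "bnd (u i2) (v l) (K * (C1 * C2)) (S x y)" "0 < u i2 \<gamma> \<Longrightarrow> summand x y \<gamma> summable_on UNIV"
  using assms unfolding bound_IP_PI_def by auto

lemma bound_PI_IPD:
  assumes "bound_PI_IP i0 i j k l K" "0 \<le> C1" "0 \<le> C2" "x \<in> Gs i0"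
    "bnd (u i) (v j) C1 y" "bnd (v l) (u i0) C2 x"
  shows "bnd (v k) (u i) (K * (C1 * C2)) (S y x)" "0 < v k \<gamma> \<Longrightarrow> summand y x \<gamma> summable_on UNIV"
  using assms unfolding bound_PI_IP_def by auto

text \<open>\<open>super\<close> in the first family yields \<open>i\<close> from \<open>i0\<close>
  and \<open>i2\<close>; \<open>sub\<close> in the second yields \<open>l\<close> from
  \<open>j\<close>. The order matters: an element of \<open>PI\<close> reveals its \<open>j\<close>
  only after \<open>i\<close> is given, whereas an element of \<open>Gs i0\<close> has a bound for
  whatever \<open>l\<close> results.\<close>

lemma S_bound_IP_PI:
  assumes i0: "i0 \<in> I" and i2: "i2 \<in> I"
  shows "\<exists>i\<in>I. \<forall>j\<in>J. \<exists>l\<in>J. \<exists>K. bound_IP_PI i0 i2 i j l K"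
proof -
  obtain i C where i: "i \<in> I" "0 < C" "\<And>\<alpha> \<gamma>. 4 ^ hu (\<alpha> + \<gamma>) * (u i0 \<alpha> * u i2 \<gamma>) \<le> C * u i (\<alpha> + \<gamma>)"
    using U.super4[OF i0 i2] by blast
  have "\<exists>l\<in>J. \<exists>K. bound_IP_PI i0 i2 i j l K"
    if j: "j \<in> J" for j
  proof -
    obtain l D where l: "l \<in> J" "0 < D" "\<And>\<alpha> \<gamma>. 4 ^ hv (\<alpha> + \<gamma>) * v j (\<alpha> + \<gamma>) \<le> D * (v l \<alpha> * v l \<gamma>)"
      using V.sub4[OF j] by blast
    have "bnd (u i2) (v l) (\<Sigma>h * (C * D) * (C1 * C2)) (S x y) \<and> (\<forall>\<gamma>. 0 < u i2 \<gamma> \<longrightarrow> summand x y \<gamma> summable_on UNIV)"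
      if C: "0 \<le> C1" "0 \<le> C2" and x: "x \<in> Gs i0" "bnd (v l) (u i0) C1 x" and y: "bnd (u i) (v j) C2 y"
      for x y C1 C2
    proof -
      have nn: "\<And>\<alpha>. 0 \<le> u i0 \<alpha>" "\<And>\<alpha>. 0 \<le> u i2 \<alpha>" "\<And>\<alpha>. 0 \<le> v j \<alpha>" "\<And>\<alpha>. 0 \<le> v l \<alpha>"
        using U.nonneg V.nonneg i0 i2 j l(1) by auto
      have "norm (summand x y \<gamma> \<alpha>) * u i2 \<gamma> \<le> (1/2) ^ h \<alpha> * (C * D * C1 * C2 * v l \<gamma>)" for \<alpha> \<gamma>
        using Gs_zero[OF i0 x(1)] i(2) l(2) C nn
        by (intro summand_bound[OF refl i(3) l(3) x(2) y]) auto
      from S_bound[OF this nn(2,4)] show ?thesis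
        using i(2) l(2) C by (simp add: ac_simps)
    qed
    moreover have "0 \<le> \<Sigma>h * (C * D)" using \<Sigma>h_nonneg i(2) l(2) by simp
    ultimately have "bound_IP_PI i0 i2 i j l (\<Sigma>h * (C * D))" unfolding bound_IP_PI_def by blast
    then show ?thesis using l(1) by blast
  qed
  then show ?thesis using i(1) by blast
qed

text \<open>The mirror image, with \<open>sub\<close> in the first family and \<open>super\<close>
  in the second. The resulting \<open>i\<close> depends on \<open>i0\<close> alone, so the products
  lie in one fixed \<open>Gs i\<close>.\<close>

lemma S_bound_PI_IP:
  assumes i0: "i0 \<in> I"
  shows "\<exists>i\<in>I. \<forall>j\<in>J. \<forall>k\<in>J. \<exists>l\<in>J. \<exists>K. bound_PI_IP i0 i j k l K"
proof -
  obtain i D where i: "i \<in> I" "0 < D" "\<And>\<alpha> \<gamma>. 4 ^ hu (\<alpha> + \<gamma>) * u i0 (\<alpha> + \<gamma>) \<le> D * (u i \<alpha> * u i \<gamma>)"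
    using U.sub4[OF i0] by blast
  have "\<exists>l\<in>J. \<exists>K. bound_PI_IP i0 i j k l K"
    if j: "j \<in> J" and k: "k \<in> J" for j k
  proof -
    obtain l C where l: "l \<in> J" "0 < C" "\<And>\<alpha> \<gamma>. 4 ^ hv (\<alpha> + \<gamma>) * (v j \<alpha> * v k \<gamma>) \<le> C * v l (\<alpha> + \<gamma>)"
      using V.super4[OF j k] by blast
    have "bnd (v k) (u i) (\<Sigma>h * (C * D) * (C1 * C2)) (S y x) \<and> (\<forall>\<gamma>. 0 < v k \<gamma> \<longrightarrow> summand y x \<gamma> summable_on UNIV)"
      if C: "0 \<le> C1" "0 \<le> C2" and x: "x \<in> Gs i0" "bnd (v l) (u i0) C2 x" and y: "bnd (u i) (v j) C1 y"
      for x y C1 C2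
    proof -
      have nn: "\<And>\<alpha>. 0 \<le> v k \<alpha>" "\<And>\<alpha>. 0 \<le> u i \<alpha>" "\<And>\<alpha>. 0 \<le> v j \<alpha>" "\<And>\<alpha>. 0 \<le> u i0 \<alpha>"
        using U.nonneg V.nonneg i0 i(1) j k by auto
      have "norm (summand y x \<gamma> \<alpha>) * v k \<gamma> \<le> (1/2) ^ h \<alpha> * (C * D * C1 * C2 * u i \<gamma>)" for \<alpha> \<gamma>
        using Gs_zero[OF i0 x(1)] i(2) l(2) C nn
        by (intro summand_bound[OF add.commute l(3) i(3) y x(2)]) auto
      from S_bound[OF this nn(1,2)] show ?thesis
        using i(2) l(2) C by (simp add: ac_simps)
    qed
    moreover have "0 \<le> \<Sigma>h * (C * D)" using \<Sigma>h_nonneg i(2) l(2) by simp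
    ultimately have "bound_PI_IP i0 i j k l (\<Sigma>h * (C * D))" unfolding bound_PI_IP_def by blast
    then show ?thesis using l(1) by blast
  qed
  then show ?thesis using i(1) by blast
qed

section \<open>Continuity of the product\<close>

text \<open>A priori stronger than topological boundedness: for each \<open>i\<close> one step and
  one constant have to serve the whole set.\<close>

definition bdd :: "('a \<Rightarrow> complex) set \<Rightarrow> bool" where
  "bdd B \<longleftrightarrow> (\<forall>i\<in>I. \<exists>j\<in>J. \<exists>C\<ge>0. \<forall>y\<in>B. bnd (u i) (v j) C y)"

lemma bddD:
  assumes "bdd B" "i \<in> I"
  obtains j C where "j \<in> J" "0 \<le> C" "\<forall>y\<in>B. bnd (u i) (v j) C y"
  using assms unfolding bdd_def by blast

lemma EsD:
  assumes "y \<in> Es i"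
  obtains j C where "j \<in> J" "0 \<le> C" "bnd (u i) (v j) C y"
  using assms unfolding Es_def by blast

lemma GsD:
  assumes "x \<in> Gs i" "j \<in> J"
  obtains C where "0 \<le> C" "bnd (v j) (u i) C x"
  using assms unfolding Gs_def by blast

lemma bdd_singleton: "y \<in> topspace (PI \<infinity>) \<Longrightarrow> bdd {y}"
  unfolding topspace_PI bdd_def Es_def by blast

lemma lin_space_Es:
  assumes "i \<in> I" shows "lin_space (Es i)"
  using lc_topD(1)[OF lc_top_E[OF assms]] unfolding topspace_E[OF assms] .

text \<open>The estimates yield convergence only where the target weight is positive, so
  \<open>i2\<close> is chosen according to \<gamma>.\<close>

lemma summable_IP_PI:
  assumes i0: "i0 \<in> I" and x: "x \<in> Gs i0" and y: "y \<in> topspace (PI \<infinity>)"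
  shows "summand x y \<gamma> summable_on UNIV"
proof -
  obtain i2 where i2: "i2 \<in> I" "0 < u i2 \<gamma>" using U.pos by blast
  obtain i where i: "i \<in> I" "\<forall>j\<in>J. \<exists>l\<in>J. \<exists>K. bound_IP_PI i0 i2 i j l K"
    using S_bound_IP_PI[OF i0 i2(1)] by blast
  obtain j C2 where j: "j \<in> J" "0 \<le> C2" "bnd (u i) (v j) C2 y"
    using EsD[of y i] y i(1) unfolding topspace_PI by blast
  obtain l K where l: "l \<in> J" "bound_IP_PI i0 i2 i j l K" using i(2) j(1) by blast
  obtain C1 where "0 \<le> C1" "bnd (v l) (u i0) C1 x" using GsD[OF x l(1)] .
  then show ?thesis using bound_IP_PID(2)[OF l(2) _ j(2) x _ j(3) i2(2)] by blast
qed

lemma S_in_PI: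
  assumes x: "x \<in> topspace (IP \<infinity>)" and y: "y \<in> topspace (PI \<infinity>)"
  shows "S x y \<in> topspace (PI \<infinity>)"
  unfolding topspace_PI
proof
  fix i2 assume i2: "i2 \<in> I"
  obtain i0 where i0: "i0 \<in> I" "x \<in> Gs i0" using x unfolding topspace_IP by blast
  obtain i where i: "i \<in> I" "\<forall>j\<in>J. \<exists>l\<in>J. \<exists>K. bound_IP_PI i0 i2 i j l K"
    using S_bound_IP_PI[OF i0(1) i2] by blast
  obtain j C2 where j: "j \<in> J" "0 \<le> C2" "bnd (u i) (v j) C2 y"
    using EsD[of y i] y i(1) unfolding topspace_PI by blast
  obtain l K where l: "l \<in> J" "bound_IP_PI i0 i2 i j l K" using i(2) j(1) by blast
  obtain C1 where C1: "0 \<le> C1" "bnd (v l) (u i0) C1 x" using GsD[OF i0(2) l(1)] .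
  have "0 \<le> K * (C1 * C2)" using l(2) C1(1) j(2) by (simp add: bound_IP_PI_def)
  then show "S x y \<in> Es i2"
    using bound_IP_PID(1)[OF l(2) C1(1) j(2) i0(2) C1(2) j(3)] l(1) unfolding Es_def by blast
qed

text \<open>Stated for \<open>y\<close> in the larger space \<open>Es i\<close>, so that later a
  zero neighbourhood can be built on this single step.\<close>

lemma S_in_Gs:
  assumes i: "\<forall>j\<in>J. \<forall>k\<in>J. \<exists>l\<in>J. \<exists>K. bound_PI_IP i0 i j k l K"
    and x: "x \<in> Gs i0" and y: "y \<in> Es i"
  shows "S y x \<in> Gs i" and "summand y x \<gamma> summable_on UNIV"
proof -
  obtain j C1 where j: "j \<in> J" "0 \<le> C1" "bnd (u i) (v j) C1 y" using EsD[OF y] .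
  have *: "\<exists>C\<ge>0. bnd (v k) (u i) C (S y x) \<and> (0 < v k \<gamma> \<longrightarrow> summand y x \<gamma> summable_on UNIV)"
    if k: "k \<in> J" for k
  proof -
    obtain l K where l: "l \<in> J" "bound_PI_IP i0 i j k l K" using i(1) j(1) k by blast
    obtain C2 where C2: "0 \<le> C2" "bnd (v l) (u i0) C2 x" using GsD[OF x l(1)] .
    have "0 \<le> K * (C1 * C2)" using l(2) C2(1) j(2) by (simp add: bound_PI_IP_def)
    then show ?thesis using bound_PI_IPD[OF l(2) j(2) C2(1) x j(3) C2(2)] by blast
  qed
  then show "S y x \<in> Gs i" unfolding Gs_def by blast
  obtain k where "k \<in> J" "0 < v k \<gamma>" using V.pos by blast
  then show "summand y x \<gamma> summable_on UNIV" using * by blast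
qed

lemma S_in_IP:
  assumes x: "x \<in> topspace (IP \<infinity>)" and y: "y \<in> topspace (PI \<infinity>)"
  shows "S y x \<in> topspace (IP \<infinity>)" and "summand y x \<gamma> summable_on UNIV"
proof -
  obtain i0 where i0: "i0 \<in> I" "x \<in> Gs i0" using x unfolding topspace_IP by blast
  obtain i where i: "i \<in> I" "\<forall>j\<in>J. \<forall>k\<in>J. \<exists>l\<in>J. \<exists>K. bound_PI_IP i0 i j k l K"
    using S_bound_PI_IP[OF i0(1)] by blast
  have "y \<in> Es i" using y i(1) unfolding topspace_PI by blast
  then show "S y x \<in> topspace (IP \<infinity>)" "summand y x \<gamma> summable_on UNIV"
    using S_in_Gs[OF i(2) i0(2)] i(1) unfolding topspace_IP by blast+
qed

section \<open>Zero neighbourhoods of the steps and of the two limits\<close>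

lemma nhd_zero_stepD:
  assumes "i \<in> I" "j \<in> J" "nhd_zero (wstep (u i) (v j)) V"
  obtains \<epsilon> where "0 < \<epsilon>" "\<forall>d. bnd (u i) (v j) \<epsilon> d \<longrightarrow> d \<in> V"
  using assms nhd_zero_wstep[of "u i" "v j" V] U.nonneg V.nonneg by blast

lemma nhd_zero_stepI:
  assumes "i \<in> I" "j \<in> J" "0 < \<epsilon>" "\<And>d. bnd (u i) (v j) \<epsilon> d \<Longrightarrow> d \<in> V"
  shows "nhd_zero (wstep (u i) (v j)) V"
  using assms nhd_zero_wstep[of "u i" "v j" V] U.nonneg V.nonneg by blast

lemma nhd_zero_E_step:
  assumes "i \<in> I" "j \<in> J" "nhd_zero (E \<infinity> i) V" shows "nhd_zero (wstep (u i) (v j)) V"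
  using nhd_zero_ind_limD[of "\<lambda>j. wstep (u i) (v j)" j J V, OF zero_step assms(2)] assms(3)
  unfolding E_def by blast

lemma nhd_zero_EI:
  assumes i: "i \<in> I" and V: "abs_convex V" "\<And>j. j \<in> J \<Longrightarrow> nhd_zero (wstep (u i) (v j)) V"
  shows "nhd_zero (E \<infinity> i) V"
  unfolding E_def by (rule nhd_zero_ind_limI) (use i V lc_top_step V.index_ne in auto)

lemma nhd_zero_PI_step:
  assumes "i \<in> I" "nhd_zero (E \<infinity> i) V" shows "nhd_zero (PI \<infinity>) V"
  unfolding PI_def using assms(2)
  by (intro nhd_zero_proj_limI[where X = "E \<infinity>", OF assms(1)] lc_top_zero lc_top_E)

lemma nhd_zero_IP_step:
  assumes "i \<in> I" "nhd_zero (IP \<infinity>) V" shows "nhd_zero (G \<infinity> i) V"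
  using nhd_zero_ind_limD[of "G \<infinity>" i I V] lc_top_zero[OF lc_top_G] assms unfolding IP_def by blast

lemma nhd_zero_IPI:
  assumes "abs_convex V" "\<And>i. i \<in> I \<Longrightarrow> nhd_zero (G \<infinity> i) V" shows "nhd_zero (IP \<infinity>) V"
  unfolding IP_def by (rule nhd_zero_ind_limI[where X = "G \<infinity>", OF lc_top_G U.index_ne assms])

lemma nhd_zero_GI:
  assumes i: "i \<in> I" "j \<in> J" "0 < \<epsilon>" and V: "\<And>x. x \<in> Gs i \<Longrightarrow> bnd (v j) (u i) \<epsilon> x \<Longrightarrow> x \<in> V"
  shows "nhd_zero (G \<infinity> i) V"
proof -
  have "nhd_zero (wstep (v j) (u i)) {x. bnd (v j) (u i) \<epsilon> x}"
    using i nhd_zero_wstep[of "v j" "u i"] U.nonneg V.nonneg by blast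
  then have "nhd_zero (G \<infinity> i) {x. bnd (v j) (u i) \<epsilon> x}"
    unfolding G_def by (intro nhd_zero_proj_limI[OF i(2)] zero_step)
  moreover have "nhd_zero (G \<infinity> i) (Gs i)"
    using nhd_zero_topspace[OF lc_top_zero[OF lc_top_G[OF i(1)]]] unfolding topspace_G[OF i(1)] .
  ultimately have "nhd_zero (G \<infinity> i) ({x. bnd (v j) (u i) \<epsilon> x} \<inter> Gs i)" by (rule nhd_zero_Int)
  then show ?thesis by (rule nhd_zero_mono) (use V in blast)
qed

lemma nhd_zero_GD:
  assumes i: "i \<in> I" and V: "nhd_zero (G \<infinity> i) V"
  obtains F \<epsilon> where "finite F" "F \<subseteq> J" "\<forall>k\<in>F. 0 < \<epsilon> k"
    "\<forall>x\<in>Gs i. (\<forall>k\<in>F. bnd (v k) (u i) (\<epsilon> k) x) \<longrightarrow> x \<in> V"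
proof -
  from nhd_zero_proj_limD[of J "\<lambda>j. wstep (v j) (u i)" V, OF zero_step] V
  obtain F W where F: "finite F" "F \<subseteq> J" "\<forall>k\<in>F. nhd_zero (wstep (v k) (u i)) (W k)"
    "(\<Inter>j\<in>J. topspace (wstep (v j) (u i))) \<inter> (\<Inter>k\<in>F. W k) \<subseteq> V"
    unfolding G_def by metis
  have "\<forall>k\<in>F. \<exists>\<epsilon>>0. \<forall>d. bnd (v k) (u i) \<epsilon> d \<longrightarrow> d \<in> W k"
  proof
    fix k assume k: "k \<in> F"
    then have "nhd_zero (wstep (v k) (u i)) (W k)" "k \<in> J" using F by auto
    then show "\<exists>\<epsilon>>0. \<forall>d. bnd (v k) (u i) \<epsilon> d \<longrightarrow> d \<in> W k"
      using nhd_zero_wstep[of "v k" "u i" "W k"] U.nonneg[OF i] V.nonneg by blast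
  qed
  then obtain \<epsilon> where \<epsilon>: "\<forall>k\<in>F. 0 < \<epsilon> k \<and> (\<forall>d. bnd (v k) (u i) (\<epsilon> k) d \<longrightarrow> d \<in> W k)"
    by metis
  have Gs: "(\<Inter>j\<in>J. topspace (wstep (v j) (u i))) = Gs i"
    using topspace_G[OF i] unfolding G_def topspace_proj_lim[OF V.index_ne] .
  show ?thesis
  proof (rule that[of F \<epsilon>])
    show "\<forall>x\<in>Gs i. (\<forall>k\<in>F. bnd (v k) (u i) (\<epsilon> k) x) \<longrightarrow> x \<in> V"
    proof (intro ballI impI)
      fix x assume x: "x \<in> Gs i" "\<forall>k\<in>F. bnd (v k) (u i) (\<epsilon> k) x"
      then have "x \<in> (\<Inter>k\<in>F. W k)" using \<epsilon> by blast
      then show "x \<in> V" using F(4) x(1) unfolding Gs by blast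
    qed
  qed (use F \<epsilon> in auto)
qed

section \<open>Equicontinuity over bounded sets and continuity in each variable at zero\<close>

lemma nhd_zero_PI:
  assumes V: "nhd_zero (PI \<infinity>) V" and X: "lc_top X"
    and T: "\<And>x y. x \<in> topspace X \<Longrightarrow> y \<in> B \<Longrightarrow> T x y \<in> topspace (PI \<infinity>)"
    and step: "\<And>i W. i \<in> I \<Longrightarrow> nhd_zero (E \<infinity> i) W \<Longrightarrow> nhd_zero X {x \<in> topspace X. \<forall>y\<in>B. T x y \<in> W}"
  shows "nhd_zero X {x \<in> topspace X. \<forall>y\<in>B. T x y \<in> V}"
proof -
  have z: "(\<lambda>_. 0) \<in> topspace (E \<infinity> i)" if "i \<in> I" for i using lc_top_zero[OF lc_top_E[OF that]] .
  obtain F W where F: "finite F" "F \<subseteq> I" "\<forall>i\<in>F. nhd_zero (E \<infinity> i) (W i)"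
    "(\<Inter>i\<in>I. topspace (E \<infinity> i)) \<inter> (\<Inter>i\<in>F. W i) \<subseteq> V"
    using nhd_zero_proj_limD[of I "E \<infinity>" V, OF z] V unfolding PI_def by metis
  have PI: "topspace (PI \<infinity>) = (\<Inter>i\<in>I. topspace (E \<infinity> i))"
    unfolding PI_def topspace_proj_lim[OF U.index_ne] ..
  have "nhd_zero X (topspace X \<inter> (\<Inter>i\<in>F. {x \<in> topspace X. \<forall>y\<in>B. T x y \<in> W i}))"
    using F step by (intro nhd_zero_Int nhd_zero_topspace nhd_zero_INT lc_top_zero X) auto
  then show ?thesis
  proof (rule nhd_zero_mono, intro subsetI CollectI conjI ballI)
    fix x y assume x: "x \<in> topspace X \<inter> (\<Inter>i\<in>F. {x \<in> topspace X. \<forall>y\<in>B. T x y \<in> W i})" and y: "y \<in> B"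
    then have "T x y \<in> (\<Inter>i\<in>F. W i)" by blast
    moreover have "T x y \<in> (\<Inter>i\<in>I. topspace (E \<infinity> i))" using T[of x y] x y PI by blast
    ultimately show "T x y \<in> V" using F(4) by blast
  qed blast
qed

text \<open>The set in question can be taken absolutely convex, so it is a neighbourhood in the
  inductive limit once it is one in every \<open>G i0\<close>. There the common bound of
  \<open>B\<close> in one step makes the estimate uniform over \<open>B\<close>.\<close>

lemma S_equicontinuous_IP_PI:
  assumes B: "bdd B" "B \<subseteq> topspace (PI \<infinity>)" and V: "nhd_zero (PI \<infinity>) V"
  shows "nhd_zero (IP \<infinity>) {x \<in> topspace (IP \<infinity>). \<forall>y\<in>B. S x y \<in> V}"
proof (rule nhd_zero_PI[OF V])
  show "lc_top (IP \<infinity>)" by (rule lc_top_IP)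
  show "S x y \<in> topspace (PI \<infinity>)" if "x \<in> topspace (IP \<infinity>)" "y \<in> B" for x y
    using S_in_PI B(2) that by blast
  fix i2 W assume i2: "i2 \<in> I" and W: "nhd_zero (E \<infinity> i2) W"
  obtain W' where W': "W' \<subseteq> W" "abs_convex W'" "nhd_zero (E \<infinity> i2) W'"
    using lc_topD(3)[OF lc_top_E[OF i2] W] by blast
  let ?D = "{x \<in> topspace (IP \<infinity>). \<forall>y\<in>B. S x y \<in> W'}"
  have "abs_convex ?D"
    unfolding abs_convex_def
  proof (intro ballI allI impI)
    fix c d and a b :: complex assume c: "c \<in> ?D" and d: "d \<in> ?D" and ab: "norm a + norm b \<le> 1"
    have "S (\<lambda>\<alpha>. a * c \<alpha> + b * d \<alpha>) y \<in> W'" if y: "y \<in> B" for y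
    proof -
      have "summand x y \<gamma> summable_on UNIV" if "x \<in> ?D" for x \<gamma>
        using that y B(2) summable_IP_PI unfolding topspace_IP by blast
      then have "S (\<lambda>\<alpha>. a * c \<alpha> + b * d \<alpha>) y = (\<lambda>\<gamma>. a * S c y \<gamma> + b * S d y \<gamma>)"
        using c d by (intro ext S_comb_left)
      then show ?thesis using abs_convexD[OF W'(2) _ _ ab] c d y by simp
    qed
    moreover have "(\<lambda>\<alpha>. a * c \<alpha> + b * d \<alpha>) \<in> topspace (IP \<infinity>)"
      using lin_space_comb[OF lc_topD(1)[OF lc_top_IP]] c d by blast
    ultimately show "(\<lambda>\<alpha>. a * c \<alpha> + b * d \<alpha>) \<in> ?D" by blast
  qed
  moreover have "nhd_zero (G \<infinity> i0) ?D" if i0: "i0 \<in> I" for i0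
  proof -
    obtain i where i: "i \<in> I" "\<forall>j\<in>J. \<exists>l\<in>J. \<exists>K. bound_IP_PI i0 i2 i j l K"
      using S_bound_IP_PI[OF i0 i2] by blast
    obtain j C2 where j: "j \<in> J" "0 \<le> C2" "\<forall>y\<in>B. bnd (u i) (v j) C2 y"
      by (rule bddD[OF B(1) i(1)])
    obtain l K where l: "l \<in> J" "bound_IP_PI i0 i2 i j l K" using i(2) j(1) by blast
    then have K: "0 \<le> K" by (simp add: bound_IP_PI_def)
    obtain \<epsilon> where \<epsilon>: "0 < \<epsilon>" "\<forall>d. bnd (u i2) (v l) \<epsilon> d \<longrightarrow> d \<in> W'"
      using nhd_zero_stepD[OF i2 l(1) nhd_zero_E_step[OF i2 l(1) W'(3)]] .
    \<comment> \<open>The added 1 covers a vanishing \<open>K * C2\<close>.\<close>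
    define \<delta> where "\<delta> = \<epsilon> / (K * C2 + 1)"
    have pos: "0 < K * C2 + 1" using K j(2) by (simp add: add_nonneg_pos)
    then have \<delta>: "0 < \<delta>" "K * (\<delta> * C2) \<le> \<epsilon>"
      using \<epsilon>(1) by (simp_all add: \<delta>_def field_simps)
    show ?thesis
    proof (rule nhd_zero_GI[OF i0 l(1) \<delta>(1)])
      fix x assume x: "x \<in> Gs i0" "bnd (v l) (u i0) \<delta> x"
      have "S x y \<in> W'" if y: "y \<in> B" for y
        using bnd_mono[OF bound_IP_PID(1)[OF l(2) _ j(2) x bspec[OF j(3) y]] \<delta>(2)] \<delta>(1) V.nonneg[OF l(1)] \<epsilon>(2)
        by simp
      then show "x \<in> ?D" using x(1) i0 unfolding topspace_IP by blast
    qed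
  qed
  ultimately have "nhd_zero (IP \<infinity>) ?D" by (rule nhd_zero_IPI)
  then show "nhd_zero (IP \<infinity>) {x \<in> topspace (IP \<infinity>). \<forall>y\<in>B. S x y \<in> W}"
    by (rule nhd_zero_mono) (use W'(1) in blast)
qed

text \<open>The neighbourhood is built on one \<open>E i\<close> and then restricted to
  \<open>PI\<close>. Its absolute convexity requires linearity in \<open>y\<close> on all of
  \<open>Es i\<close>, where the product series is under control only for some \<gamma>. The
  quantifier over a singleton fits the form of \<open>nhd_zero_PI\<close>.\<close>

lemma S_right_nhd_PI:
  assumes x: "x \<in> topspace (IP \<infinity>)" and V: "nhd_zero (PI \<infinity>) V"
  shows "nhd_zero (PI \<infinity>) {y \<in> topspace (PI \<infinity>). \<forall>c\<in>{x}. S c y \<in> V}"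
proof (rule nhd_zero_PI[OF V])
  show "lc_top (PI \<infinity>)" by (rule lc_top_PI)
  show "S c y \<in> topspace (PI \<infinity>)" if "y \<in> topspace (PI \<infinity>)" "c \<in> {x}" for c y
    using S_in_PI x that by blast
  fix i2 W assume i2: "i2 \<in> I" and W: "nhd_zero (E \<infinity> i2) W"
  obtain W' where W': "W' \<subseteq> W" "abs_convex W'" "nhd_zero (E \<infinity> i2) W'"
    using lc_topD(3)[OF lc_top_E[OF i2] W] by blast
  obtain i0 where i0: "i0 \<in> I" "x \<in> Gs i0" using x unfolding topspace_IP by blast
  obtain i where i: "i \<in> I" "\<forall>j\<in>J. \<exists>l\<in>J. \<exists>K. bound_IP_PI i0 i2 i j l K"
    using S_bound_IP_PI[OF i0(1) i2] by blast
  \<comment> \<open>For \<open>y\<close> in the step \<open>Es i\<close> the series defining \<open>S x y \<gamma>\<close> need only converge where \<open>u i2 \<gamma> > 0\<close>,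
    so the product is cut down to these \<open>\<gamma>\<close>; the remaining part lies in every zero neighbourhood.\<close>
  define cut where "cut c \<gamma> = (if u i2 \<gamma> = 0 then 0 else c \<gamma>)" for c :: "'a \<Rightarrow> complex" and \<gamma>
  \<comment> \<open>The factor 2 leaves room for the remainder: \<open>S x y\<close> is the mean of
    twice its cut and twice the rest, and absolutely convex sets contain such means.\<close>
  let ?D = "{y \<in> Es i. (\<lambda>\<gamma>. 2 * cut (S x y) \<gamma>) \<in> W'}"
  have summ: "summand x y \<gamma> summable_on UNIV" if y: "y \<in> Es i" and \<gamma>: "u i2 \<gamma> \<noteq> 0" for y \<gamma>
  proof -
    obtain j C2 where j: "j \<in> J" "0 \<le> C2" "bnd (u i) (v j) C2 y" by (rule EsD[OF y])
    obtain l K where l: "l \<in> J" "bound_IP_PI i0 i2 i j l K" using i(2) j(1) by blast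
    obtain C1 where C1: "0 \<le> C1" "bnd (v l) (u i0) C1 x" by (rule GsD[OF i0(2) l(1)])
    show ?thesis
      using bound_IP_PID(2)[OF l(2) C1(1) j(2) i0(2) C1(2) j(3)] \<gamma> U.nonneg[OF i2, of \<gamma>] by simp
  qed
  have "abs_convex ?D"
    unfolding abs_convex_def
  proof (intro ballI allI impI)
    fix c d and a b :: complex assume c: "c \<in> ?D" and d: "d \<in> ?D" and ab: "norm a + norm b \<le> 1"
    have "2 * cut (S x (\<lambda>\<alpha>. a * c \<alpha> + b * d \<alpha>)) \<gamma> = a * (2 * cut (S x c) \<gamma>) + b * (2 * cut (S x d) \<gamma>)" for \<gamma>
      using S_comb_right[of x c \<gamma> d a b] summ[of c \<gamma>] summ[of d \<gamma>] c d
      by (simp add: cut_def algebra_simps)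
    then have "(\<lambda>\<gamma>. 2 * cut (S x (\<lambda>\<alpha>. a * c \<alpha> + b * d \<alpha>)) \<gamma>) \<in> W'"
      using abs_convexD[OF W'(2) _ _ ab] c d by simp
    moreover have "(\<lambda>\<alpha>. a * c \<alpha> + b * d \<alpha>) \<in> Es i"
      using lin_space_comb[OF lin_space_Es[OF i(1)]] c d by blast
    ultimately show "(\<lambda>\<alpha>. a * c \<alpha> + b * d \<alpha>) \<in> ?D" by blast
  qed
  moreover have "nhd_zero (wstep (u i) (v j)) ?D" if j: "j \<in> J" for j
  proof -
    obtain l K where l: "l \<in> J" "bound_IP_PI i0 i2 i j l K" using i(2) j by blast
    then have K: "0 \<le> K" by (simp add: bound_IP_PI_def)
    obtain C1 where C1: "0 \<le> C1" "bnd (v l) (u i0) C1 x" by (rule GsD[OF i0(2) l(1)])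
    obtain \<epsilon> where \<epsilon>: "0 < \<epsilon>" "\<forall>d. bnd (u i2) (v l) \<epsilon> d \<longrightarrow> d \<in> W'"
      using nhd_zero_stepD[OF i2 l(1) nhd_zero_E_step[OF i2 l(1) W'(3)]] .
    define \<delta> where "\<delta> = \<epsilon> / (2 * (K * C1 + 1))"
    have pos: "0 < K * C1 + 1" using K C1(1) by (simp add: add_nonneg_pos)
    then have \<delta>: "0 < \<delta>" "2 * (K * (C1 * \<delta>)) \<le> \<epsilon>"
      using \<epsilon>(1) by (simp_all add: \<delta>_def field_simps)
    show ?thesis
    proof (rule nhd_zero_stepI[OF i(1) j \<delta>(1)])
      fix y assume y: "bnd (u i) (v j) \<delta> y"
      have b: "bnd (u i2) (v l) (K * (C1 * \<delta>)) (S x y)"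
        using bound_IP_PID(1)[OF l(2) C1(1) _ i0(2) C1(2) y] \<delta>(1) by simp
      have "bnd (u i2) (v l) \<epsilon> (\<lambda>\<gamma>. 2 * cut (S x y) \<gamma>)"
      proof (rule bndI)
        fix \<gamma>
        have "norm (2 * cut (S x y) \<gamma>) * u i2 \<gamma> = 2 * (norm (S x y \<gamma>) * u i2 \<gamma>)"
          by (simp add: cut_def norm_mult)
        also have "\<dots> \<le> 2 * (K * (C1 * \<delta>) * v l \<gamma>)" using bndD[OF b, of \<gamma>] by simp
        also have "\<dots> = 2 * (K * (C1 * \<delta>)) * v l \<gamma>" by simp
        also have "\<dots> \<le> \<epsilon> * v l \<gamma>" using \<delta>(2) V.nonneg[OF l(1)] by (rule mult_right_mono)
        finally show "norm (2 * cut (S x y) \<gamma>) * u i2 \<gamma> \<le> \<epsilon> * v l \<gamma>" .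
      qed
      then show "y \<in> ?D"
        using \<epsilon>(2) y j \<delta>(1) unfolding Es_def by (auto intro: less_imp_le)
    qed
  qed
  ultimately have "nhd_zero (E \<infinity> i) ?D" by (rule nhd_zero_EI[OF i(1)])
  then have "nhd_zero (PI \<infinity>) ?D" by (rule nhd_zero_PI_step[OF i(1)])
  then have "nhd_zero (PI \<infinity>) (topspace (PI \<infinity>) \<inter> ?D)"
    by (intro nhd_zero_Int nhd_zero_topspace lc_top_zero lc_top_PI)
  then show "nhd_zero (PI \<infinity>) {y \<in> topspace (PI \<infinity>). \<forall>c\<in>{x}. S c y \<in> W}"
  proof (rule nhd_zero_mono, intro subsetI CollectI conjI ballI)
    fix y c assume y: "y \<in> topspace (PI \<infinity>) \<inter> ?D" and "c \<in> {x}"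
    obtain j where j: "j \<in> J" using V.index_ne by blast
    obtain \<epsilon> where \<epsilon>: "0 < \<epsilon>" "\<forall>d. bnd (u i2) (v j) \<epsilon> d \<longrightarrow> d \<in> W'"
      using nhd_zero_stepD[OF i2 j nhd_zero_E_step[OF i2 j W'(3)]] .
    have "bnd (u i2) (v j) \<epsilon> (\<lambda>\<gamma>. 2 * (S x y \<gamma> - cut (S x y) \<gamma>))"
      using V.nonneg[OF j] \<epsilon>(1) by (intro bndI) (simp add: cut_def)
    from abs_convex_add_half[OF W'(2) _ mp[OF spec[OF \<epsilon>(2)] this], of "cut (S x y)"]
    have "S x y \<in> W'" using y by simp
    then show "S c y \<in> W" using \<open>c \<in> {x}\<close> W'(1) by blast
  qed blast
qed

text \<open>The target index \<open>i\<close> is fixed by \<open>i0\<close> before the neighbourhood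
  is examined. Inside \<open>G i\<close> the neighbourhood amounts to finitely many bounds, and each
  of them holds for all \<open>y\<close> in \<open>B\<close> once \<open>x\<close> is in a suitable
  zero neighbourhood of \<open>G i0\<close>.\<close>

lemma S_equicontinuous_PI_IP:
  assumes B: "bdd B" "B \<subseteq> topspace (PI \<infinity>)" and V: "nhd_zero (IP \<infinity>) V"
  shows "nhd_zero (IP \<infinity>) {x \<in> topspace (IP \<infinity>). \<forall>y\<in>B. S y x \<in> V}"
proof -
  obtain V' where V': "V' \<subseteq> V" "abs_convex V'" "nhd_zero (IP \<infinity>) V'"
    using lc_topD(3)[OF lc_top_IP V] by blast
  let ?D = "{x \<in> topspace (IP \<infinity>). \<forall>y\<in>B. S y x \<in> V'}"
  have "abs_convex ?D"
    unfolding abs_convex_def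
  proof (intro ballI allI impI)
    fix c d and a b :: complex assume c: "c \<in> ?D" and d: "d \<in> ?D" and ab: "norm a + norm b \<le> 1"
    have "S y (\<lambda>\<alpha>. a * c \<alpha> + b * d \<alpha>) \<in> V'" if y: "y \<in> B" for y
    proof -
      have "summand y x \<gamma> summable_on UNIV" if "x \<in> ?D" for x \<gamma>
        using that y B(2) S_in_IP(2) by blast
      then have "S y (\<lambda>\<alpha>. a * c \<alpha> + b * d \<alpha>) = (\<lambda>\<gamma>. a * S y c \<gamma> + b * S y d \<gamma>)"
        using c d by (intro ext S_comb_right)
      then show ?thesis using abs_convexD[OF V'(2) _ _ ab] c d y by simp
    qed
    moreover have "(\<lambda>\<alpha>. a * c \<alpha> + b * d \<alpha>) \<in> topspace (IP \<infinity>)"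
      using lin_space_comb[OF lc_topD(1)[OF lc_top_IP]] c d by blast
    ultimately show "(\<lambda>\<alpha>. a * c \<alpha> + b * d \<alpha>) \<in> ?D" by blast
  qed
  moreover have "nhd_zero (G \<infinity> i0) ?D" if i0: "i0 \<in> I" for i0
  proof -
    obtain i where i: "i \<in> I" "\<forall>j\<in>J. \<forall>k\<in>J. \<exists>l\<in>J. \<exists>K. bound_PI_IP i0 i j k l K"
      using S_bound_PI_IP[OF i0] by blast
    obtain j C1 where j: "j \<in> J" "0 \<le> C1" "\<forall>y\<in>B. bnd (u i) (v j) C1 y"
      by (rule bddD[OF B(1) i(1)])
    have "nhd_zero (G \<infinity> i) V'" by (rule nhd_zero_IP_step[OF i(1) V'(3)])
    then obtain F \<epsilon> where F: "finite F" "F \<subseteq> J" "\<forall>k\<in>F. 0 < \<epsilon> k"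
      "\<forall>x\<in>Gs i. (\<forall>k\<in>F. bnd (v k) (u i) (\<epsilon> k) x) \<longrightarrow> x \<in> V'"
      by (rule nhd_zero_GD[OF i(1)])
    have "nhd_zero (G \<infinity> i0) {x \<in> Gs i0. \<forall>y\<in>B. bnd (v k) (u i) (\<epsilon> k) (S y x)}" if k: "k \<in> F" for k
    proof -
      have kJ: "k \<in> J" using F(2) k by blast
      then obtain l K where l: "l \<in> J" "bound_PI_IP i0 i j k l K" using i(2) j(1) by blast
      then have K: "0 \<le> K" by (simp add: bound_PI_IP_def)
      define \<delta> where "\<delta> = \<epsilon> k / (K * C1 + 1)"
      have pos: "0 < K * C1 + 1" using K j(2) by (simp add: add_nonneg_pos)
      then have \<delta>: "0 < \<delta>" "K * (C1 * \<delta>) \<le> \<epsilon> k"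
        using bspec[OF F(3) k] by (simp_all add: \<delta>_def field_simps)
      show ?thesis
      proof (rule nhd_zero_GI[OF i0 l(1) \<delta>(1)])
        fix x assume x: "x \<in> Gs i0" "bnd (v l) (u i0) \<delta> x"
        have "bnd (v k) (u i) (\<epsilon> k) (S y x)" if y: "y \<in> B" for y
          using bnd_mono[OF bound_PI_IPD(1)[OF l(2) j(2) _ x(1) bspec[OF j(3) y] x(2)] \<delta>(2)] \<delta>(1) U.nonneg[OF i(1)]
          by simp
        then show "x \<in> {x \<in> Gs i0. \<forall>y\<in>B. bnd (v k) (u i) (\<epsilon> k) (S y x)}" using x(1) by blast
      qed
    qed
    then have "nhd_zero (G \<infinity> i0) (topspace (G \<infinity> i0) \<inter> (\<Inter>k\<in>F. {x \<in> Gs i0. \<forall>y\<in>B. bnd (v k) (u i) (\<epsilon> k) (S y x)}))"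
      by (intro nhd_zero_Int nhd_zero_topspace nhd_zero_INT lc_top_zero lc_top_G i0 F(1))
    then show ?thesis
    proof (rule nhd_zero_mono, intro subsetI CollectI conjI ballI)
      fix x assume x: "x \<in> topspace (G \<infinity> i0) \<inter> (\<Inter>k\<in>F. {x \<in> Gs i0. \<forall>y\<in>B. bnd (v k) (u i) (\<epsilon> k) (S y x)})"
      then have xi: "x \<in> Gs i0" unfolding topspace_G[OF i0] by blast
      then show "x \<in> topspace (IP \<infinity>)" using i0 unfolding topspace_IP by blast
      fix y assume y: "y \<in> B"
      have "y \<in> Es i" using y B(2) i(1) unfolding topspace_PI by blast
      have "S y x \<in> Gs i" by (rule S_in_Gs(1)[OF i(2) xi \<open>y \<in> Es i\<close>])
      then show "S y x \<in> V'" using F(4) x y by blast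
    qed
  qed
  ultimately have "nhd_zero (IP \<infinity>) ?D" by (rule nhd_zero_IPI)
  then show ?thesis
    by (rule nhd_zero_mono) (use V'(1) in blast)
qed

text \<open>The index \<open>i\<close> comes from \<open>i0\<close> alone, and for every
  \<open>y\<close> in \<open>Es i\<close> the product series converge at all \<gamma>. So the
  neighbourhood can be built on this step directly, without cutting the product down.\<close>

lemma S_left_nhd_IP:
  assumes x: "x \<in> topspace (IP \<infinity>)" and V: "nhd_zero (IP \<infinity>) V"
  shows "nhd_zero (PI \<infinity>) {y \<in> topspace (PI \<infinity>). S y x \<in> V}"
proof -
  obtain V' where V': "V' \<subseteq> V" "abs_convex V'" "nhd_zero (IP \<infinity>) V'"
    using lc_topD(3)[OF lc_top_IP V] by blast
  obtain i0 where i0: "i0 \<in> I" "x \<in> Gs i0" using x unfolding topspace_IP by blast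
  obtain i where i: "i \<in> I" "\<forall>j\<in>J. \<forall>k\<in>J. \<exists>l\<in>J. \<exists>K. bound_PI_IP i0 i j k l K"
    using S_bound_PI_IP[OF i0(1)] by blast
  let ?D = "{y \<in> Es i. S y x \<in> V'}"
  have "abs_convex ?D"
    unfolding abs_convex_def
  proof (intro ballI allI impI)
    fix c d and a b :: complex assume c: "c \<in> ?D" and d: "d \<in> ?D" and ab: "norm a + norm b \<le> 1"
    have "S (\<lambda>\<alpha>. a * c \<alpha> + b * d \<alpha>) x = (\<lambda>\<gamma>. a * S c x \<gamma> + b * S d x \<gamma>)"
      using c d S_in_Gs(2)[OF i(2) i0(2)] by (intro ext S_comb_left) auto
    then have "S (\<lambda>\<alpha>. a * c \<alpha> + b * d \<alpha>) x \<in> V'"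
      using abs_convexD[OF V'(2) _ _ ab] c d by simp
    moreover have "(\<lambda>\<alpha>. a * c \<alpha> + b * d \<alpha>) \<in> Es i"
      using lin_space_comb[OF lin_space_Es[OF i(1)]] c d by blast
    ultimately show "(\<lambda>\<alpha>. a * c \<alpha> + b * d \<alpha>) \<in> ?D" by blast
  qed
  moreover have "nhd_zero (wstep (u i) (v j)) ?D" if j: "j \<in> J" for j
  proof -
    have "nhd_zero (G \<infinity> i) V'" by (rule nhd_zero_IP_step[OF i(1) V'(3)])
    then obtain F \<epsilon> where F: "finite F" "F \<subseteq> J" "\<forall>k\<in>F. 0 < \<epsilon> k"
      "\<forall>x\<in>Gs i. (\<forall>k\<in>F. bnd (v k) (u i) (\<epsilon> k) x) \<longrightarrow> x \<in> V'"
      by (rule nhd_zero_GD[OF i(1)])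
    have Es: "y \<in> Es i" if "bnd (u i) (v j) \<delta> y" "0 < \<delta>" for y \<delta>
      using that j unfolding Es_def by (auto intro: less_imp_le)
    have "nhd_zero (wstep (u i) (v j)) {y \<in> Es i. bnd (v k) (u i) (\<epsilon> k) (S y x)}" if k: "k \<in> F" for k
    proof -
      have kJ: "k \<in> J" using F(2) k by blast
      then obtain l K where l: "l \<in> J" "bound_PI_IP i0 i j k l K" using i(2) j(1) by blast
      then have K: "0 \<le> K" by (simp add: bound_PI_IP_def)
      obtain C2 where C2: "0 \<le> C2" "bnd (v l) (u i0) C2 x" by (rule GsD[OF i0(2) l(1)])
      define \<delta> where "\<delta> = \<epsilon> k / (K * C2 + 1)"
      have pos: "0 < K * C2 + 1" using K C2(1) by (simp add: add_nonneg_pos)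
      then have \<delta>: "0 < \<delta>" "K * (\<delta> * C2) \<le> \<epsilon> k"
        using bspec[OF F(3) k] by (simp_all add: \<delta>_def field_simps)
      show ?thesis
      proof (rule nhd_zero_stepI[OF i(1) j \<delta>(1)])
        fix y assume y: "bnd (u i) (v j) \<delta> y"
        have "bnd (v k) (u i) (\<epsilon> k) (S y x)"
          using bnd_mono[OF bound_PI_IPD(1)[OF l(2) _ C2(1) i0(2) y C2(2)] \<delta>(2)] \<delta>(1) U.nonneg[OF i(1)]
          by simp
        then show "y \<in> {y \<in> Es i. bnd (v k) (u i) (\<epsilon> k) (S y x)}" using Es[OF y \<delta>(1)] by blast
      qed
    qed
    moreover have "nhd_zero (wstep (u i) (v j)) (Es i)"
      using Es by (intro nhd_zero_stepI[OF i(1) j zero_less_one]) auto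
    ultimately have "nhd_zero (wstep (u i) (v j)) (Es i \<inter> (\<Inter>k\<in>F. {y \<in> Es i. bnd (v k) (u i) (\<epsilon> k) (S y x)}))"
      by (intro nhd_zero_Int nhd_zero_INT zero_step F(1))
    then show ?thesis
    proof (rule nhd_zero_mono, intro subsetI CollectI conjI)
      fix y assume y: "y \<in> Es i \<inter> (\<Inter>k\<in>F. {y \<in> Es i. bnd (v k) (u i) (\<epsilon> k) (S y x)})"
      then show yi: "y \<in> Es i" by blast
      have "S y x \<in> Gs i" by (rule S_in_Gs(1)[OF i(2) i0(2) yi])
      then show "S y x \<in> V'" using F(4) y by blast
    qed
  qed
  ultimately have "nhd_zero (E \<infinity> i) ?D" by (rule nhd_zero_EI[OF i(1)])
  then have "nhd_zero (PI \<infinity>) ?D" by (rule nhd_zero_PI_step[OF i(1)])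
  then have "nhd_zero (PI \<infinity>) (topspace (PI \<infinity>) \<inter> ?D)"
    by (intro nhd_zero_Int nhd_zero_topspace lc_top_zero lc_top_PI)
  then show ?thesis
    by (rule nhd_zero_mono) (use V'(1) in blast)
qed

section \<open>Sequences\<close>

text \<open>Were the sequence unbounded in every step of some \<open>E i\<close>, one could choose
  entries that beat the k-th cofinal weight by the factor k + 1. Thresholds made from these entries
  define a zero neighbourhood of \<open>E i\<close>; convergence bounds the sequence by a fixed
  multiple of it, against the choice of the entries.\<close>

lemma convergent_bdd:
  assumes lim: "limitin (PI \<infinity>) ys y sequentially" and ys: "\<And>n. ys n \<in> topspace (PI \<infinity>)"
  shows "bdd (range ys)"
  unfolding bdd_def
proof (rule ballI, rule ccontr)
  fix i assume i: "i \<in> I" and "\<not> (\<exists>j\<in>J. \<exists>C\<ge>0. \<forall>y\<in>range ys. bnd (u i) (v j) C y)"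
  then have "\<not> (\<forall>y\<in>range ys. bnd (u i) (v j) C y)" if "j \<in> J" "0 \<le> C" for j C using that by blast
  then have unbd: "\<exists>n \<alpha>. C * v j \<alpha> < norm (ys n \<alpha>) * u i \<alpha>" if "j \<in> J" "0 \<le> C" for j C
    using that by (auto simp: bnd_def not_le)
  obtain f :: "nat \<Rightarrow> 'j" where f: "range f \<subseteq> J" "\<forall>j\<in>J. \<exists>k. \<forall>m\<ge>k. \<forall>\<alpha>. v j \<alpha> \<le> v (f m) \<alpha>"
    using V.cofinal by blast
  have fJ: "f k \<in> J" for k using f(1) by blast
  have "\<forall>k. \<exists>n \<alpha>. real (k + 1) * v (f k) \<alpha> < norm (ys n \<alpha>) * u i \<alpha>"
    using unbd[OF fJ] by simp
  then obtain N A where NA: "\<And>k. real (k + 1) * v (f k) (A k) < norm (ys (N k) (A k)) * u i (A k)"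
    by metis
  \<comment> \<open>Still above the k-th weight, so that every step is absorbed, and yet exceeded by
    the chosen entry by the factor \<open>k + 1\<close>.\<close>
  define \<delta> where "\<delta> k = norm (ys (N k) (A k)) * u i (A k) / real (k + 1)" for k
  have \<delta>: "v (f k) (A k) < \<delta> k" for k
    using NA[of k] unfolding \<delta>_def by (simp add: field_simps)
  have \<delta>_pos: "0 < \<delta> k" for k
    using \<delta>[of k] V.nonneg[OF fJ, of k "A k"] by linarith
  let ?V = "{c :: 'a \<Rightarrow> complex. \<forall>k. norm (c (A k)) * u i (A k) \<le> \<delta> k}"
  \<comment> \<open>\<open>?V\<close> absorbs each step: the finitely many \<open>k\<close> with \<open>v j > v (f k)\<close>
    are handled by \<open>\<delta> k > 0\<close>\<close>
  have absorb: "\<exists>\<epsilon>>0. \<forall>c. bnd (u i) (v j) \<epsilon> c \<longrightarrow> c \<in> ?V" if j: "j \<in> J" for j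
  proof -
    obtain k0 where k0: "\<forall>m\<ge>k0. \<forall>\<alpha>. v j \<alpha> \<le> v (f m) \<alpha>"
      using bspec[OF f(2) j] by (rule exE)
    define \<epsilon> where "\<epsilon> = Min (insert 1 ((\<lambda>k. \<delta> k / (v j (A k) + 1)) ` {..<k0}))"
    have vj: "0 \<le> v j \<alpha>" for \<alpha> using V.nonneg[OF j] .
    have \<epsilon>_pos: "0 < \<epsilon>"
      unfolding \<epsilon>_def using \<delta>_pos vj by (subst Min_gr_iff) (auto intro!: divide_pos_pos add_nonneg_pos)
    have "\<epsilon> * v j (A k) \<le> \<delta> k" for k
    proof (cases "k < k0")
      case True
      then have "\<epsilon> \<le> \<delta> k / (v j (A k) + 1)" unfolding \<epsilon>_def by (intro Min_le) auto
      then have "\<epsilon> * (v j (A k) + 1) \<le> \<delta> k"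
        using vj[of "A k"] by (simp add: le_divide_eq)
      then show ?thesis using \<epsilon>_pos by (simp add: distrib_left)
    next
      case False
      have "\<epsilon> \<le> 1" unfolding \<epsilon>_def by (intro Min_le) auto
      then have "\<epsilon> * v j (A k) \<le> 1 * v j (A k)" using vj by (intro mult_right_mono)
      also have "\<dots> \<le> v (f k) (A k)" using k0 False by simp
      finally show ?thesis using \<delta>[of k] by simp
    qed
    then have "c \<in> ?V" if "bnd (u i) (v j) \<epsilon> c" for c
      using order_trans[OF bndD[OF that]] by blast
    then show ?thesis using \<epsilon>_pos by blast
  qed
  have "abs_convex ?V"
    by (intro abs_convex_pointwise U.nonneg[OF i] less_imp_le[OF \<delta>_pos])
  then have "nhd_zero (E \<infinity> i) ?V"
    by (rule nhd_zero_EI[OF i]) (use absorb nhd_zero_stepI[OF i] in blast)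
  then have "nhd_zero (PI \<infinity>) ?V" by (rule nhd_zero_PI_step[OF i])
  then obtain n0 where n0: "\<And>n. n \<ge> n0 \<Longrightarrow> (\<lambda>\<alpha>. ys n \<alpha> - y \<alpha>) \<in> ?V"
    using lim[unfolded limitin_lc_top[OF lc_top_PI]] unfolding eventually_sequentially by blast
  have y: "y \<in> topspace (PI \<infinity>)" using lim by (simp add: limitin_def)
  \<comment> \<open>Each single element lies in some step and is thus absorbed. This covers the
    limit and the finitely many terms before \<open>n0\<close>.\<close>
  have L: "\<exists>\<Lambda>\<ge>0. \<forall>k. norm (c (A k)) * u i (A k) \<le> \<Lambda> * \<delta> k" if c: "c \<in> topspace (PI \<infinity>)" for c
  proof -
    have "c \<in> Es i" using c i unfolding topspace_PI by blast
    then obtain j C where j: "j \<in> J" "0 \<le> C" "bnd (u i) (v j) C c" by (rule EsD)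
    obtain \<epsilon> where \<epsilon>: "\<epsilon> > 0" "\<forall>c. bnd (u i) (v j) \<epsilon> c \<longrightarrow> c \<in> ?V" using absorb[OF j(1)] by blast
    define t where "t = (C + 1) / \<epsilon>"
    have t: "0 < t" "C \<le> \<epsilon> * t" using \<epsilon>(1) j(2) by (simp_all add: t_def)
    have "bnd (u i) (v j) \<epsilon> (\<lambda>\<alpha>. of_real (1 / t) * c \<alpha>)"
    proof (rule bndI)
      fix \<alpha>
      have "norm (c \<alpha>) * u i \<alpha> \<le> (\<epsilon> * t) * v j \<alpha>"
        using bndD[OF j(3), of \<alpha>] mult_right_mono[OF t(2) V.nonneg[OF j(1)], of \<alpha>] by linarith
      then show "norm (of_real (1 / t) * c \<alpha>) * u i \<alpha> \<le> \<epsilon> * v j \<alpha>"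
        using t(1) by (simp add: norm_mult norm_divide field_simps)
    qed
    then have in_V: "(\<lambda>\<alpha>. of_real (1 / t) * c \<alpha>) \<in> ?V" using \<epsilon>(2) by blast
    have "norm (c (A k)) * u i (A k) \<le> t * \<delta> k" for k
    proof -
      have "norm (of_real (1 / t) * c (A k)) * u i (A k) \<le> \<delta> k" using in_V by blast
      then show ?thesis using t(1) by (simp add: norm_mult norm_divide field_simps)
    qed
    then show ?thesis using t(1) less_imp_le by blast
  qed
  have "\<exists>\<Lambda>. \<forall>n k. norm (ys n (A k)) * u i (A k) \<le> \<Lambda> * \<delta> k"
  proof -
    obtain \<Lambda>y where \<Lambda>y: "\<Lambda>y \<ge> 0" "\<forall>k. norm (y (A k)) * u i (A k) \<le> \<Lambda>y * \<delta> k" using L[OF y] by blast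
    have "\<forall>n. \<exists>\<Lambda>\<ge>0. \<forall>k. norm (ys n (A k)) * u i (A k) \<le> \<Lambda> * \<delta> k" using L[OF ys] by blast
    then obtain M where M: "\<And>n. 0 \<le> M n" "\<And>n k. norm (ys n (A k)) * u i (A k) \<le> M n * \<delta> k" by metis
    \<comment> \<open>The 1 accounts for the difference from the limit, the second summand for the
      limit, the sum for the terms before \<open>n0\<close>.\<close>
    define \<Lambda> where "\<Lambda> = 1 + \<Lambda>y + sum M {..<n0}"
    have "norm (ys n (A k)) * u i (A k) \<le> \<Lambda> * \<delta> k" for n k
    proof (cases "n < n0")
      case True
      then have "M n \<le> sum M {..<n0}" using M(1) by (intro member_le_sum) auto
      then have "M n \<le> \<Lambda>" using \<Lambda>y(1) by (simp add: \<Lambda>_def)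
      then show ?thesis using M(2)[of n k] mult_right_mono[of "M n" \<Lambda> "\<delta> k"] \<delta>_pos[of k] by linarith
    next
      case False
      then have 1: "norm (ys n (A k) - y (A k)) * u i (A k) \<le> \<delta> k" using n0[of n] by simp
      have "norm (ys n (A k)) \<le> norm (ys n (A k) - y (A k)) + norm (y (A k))"
        using norm_triangle_ineq[of "ys n (A k) - y (A k)" "y (A k)"] by simp
      then have "norm (ys n (A k)) * u i (A k) \<le> (norm (ys n (A k) - y (A k)) + norm (y (A k))) * u i (A k)"
        using U.nonneg[OF i] by (intro mult_right_mono)
      also have "\<dots> \<le> \<delta> k + \<Lambda>y * \<delta> k" using 1 \<Lambda>y(2) by (simp add: distrib_right add_mono)
      also have "\<dots> \<le> \<Lambda> * \<delta> k"
      proof -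
        have "0 \<le> sum M {..<n0} * \<delta> k"
          using M(1) \<delta>_pos[of k] by (intro mult_nonneg_nonneg sum_nonneg) auto
        then show ?thesis by (simp add: \<Lambda>_def distrib_right)
      qed
      finally show ?thesis .
    qed
    then show ?thesis by blast
  qed
  then obtain \<Lambda> where \<Lambda>: "\<And>n k. norm (ys n (A k)) * u i (A k) \<le> \<Lambda> * \<delta> k" by blast
  obtain k where k: "\<Lambda> < real k" using reals_Archimedean2 by blast
  \<comment> \<open>At the entry chosen for \<open>k\<close> the weighted value equals
    \<open>(k + 1) * \<delta> k\<close> by the definition of \<delta>.\<close>
  have "real (k + 1) * \<delta> k \<le> \<Lambda> * \<delta> k"
    using \<Lambda>[of "N k" k] by (simp add: \<delta>_def)
  then have "real (k + 1) \<le> \<Lambda>" by (rule mult_right_le_imp_le) (rule \<delta>_pos)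
  then show False using k by simp
qed

section \<open>Continuity of the coefficient functionals\<close>

lemma eval_PI:
  "\<exists>V. nhd_zero (PI \<infinity>) V \<and> (\<forall>c\<in>V. norm (c \<alpha>) \<le> e)" if e: "0 < e"
proof -
  obtain i where i: "i \<in> I" "0 < u i \<alpha>" using U.pos by blast
  let ?V = "{c :: 'a \<Rightarrow> complex. norm (c \<alpha>) \<le> e}"
  have "abs_convex ?V"
    using abs_convex_pointwise[of "\<lambda>_ :: unit. 1" "\<lambda>_. e" "\<lambda>_. \<alpha>"] e by simp
  moreover have "nhd_zero (wstep (u i) (v j)) ?V" if j: "j \<in> J" for j
  proof (rule nhd_zero_stepI[OF i(1) j])
    let ?\<epsilon> = "e * u i \<alpha> / (v j \<alpha> + 1)"
    have pos: "0 < v j \<alpha> + 1" using V.nonneg[OF j, of \<alpha>] by simp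
    then show "0 < ?\<epsilon>" using e i(2) by simp
    fix d assume "bnd (u i) (v j) ?\<epsilon> d"
    then have "norm (d \<alpha>) * u i \<alpha> \<le> ?\<epsilon> * v j \<alpha>" by (rule bndD)
    also have "\<dots> \<le> e * u i \<alpha>"
    proof -
      have "e * u i \<alpha> * v j \<alpha> \<le> e * u i \<alpha> * (v j \<alpha> + 1)" using e i(2) by (intro mult_left_mono) auto
      then show ?thesis using pos by (simp add: divide_le_eq)
    qed
    finally show "d \<in> ?V" using i(2) by simp
  qed
  ultimately have "nhd_zero (E \<infinity> i) ?V" by (rule nhd_zero_EI[OF i(1)])
  then have "nhd_zero (PI \<infinity>) ?V" by (rule nhd_zero_PI_step[OF i(1)])
  then show ?thesis by blast
qed

lemma eval_IP:
  "\<exists>V. nhd_zero (IP \<infinity>) V \<and> (\<forall>c\<in>V. norm (c \<alpha>) \<le> e)" if e: "0 < e"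
proof -
  obtain j where j: "j \<in> J" "0 < v j \<alpha>" using V.pos by blast
  let ?V = "{c :: 'a \<Rightarrow> complex. norm (c \<alpha>) \<le> e}"
  have "abs_convex ?V"
    using abs_convex_pointwise[of "\<lambda>_ :: unit. 1" "\<lambda>_. e" "\<lambda>_. \<alpha>"] e by simp
  moreover have "nhd_zero (G \<infinity> i) ?V" if i: "i \<in> I" for i
  proof (rule nhd_zero_GI[OF i j(1)])
    let ?\<epsilon> = "e * v j \<alpha> / (u i \<alpha> + 1)"
    have pos: "0 < u i \<alpha> + 1" using U.nonneg[OF i, of \<alpha>] by simp
    then show "0 < ?\<epsilon>" using e j(2) by simp
    fix d assume "bnd (v j) (u i) ?\<epsilon> d"
    then have "norm (d \<alpha>) * v j \<alpha> \<le> ?\<epsilon> * u i \<alpha>" by (rule bndD)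
    also have "\<dots> \<le> e * v j \<alpha>"
    proof -
      have "e * v j \<alpha> * u i \<alpha> \<le> e * v j \<alpha> * (u i \<alpha> + 1)" using e j(2) by (intro mult_left_mono) auto
      then show ?thesis using pos by (simp add: divide_le_eq)
    qed
    finally show "d \<in> ?V" using j(2) by simp
  qed
  ultimately have "nhd_zero (IP \<infinity>) ?V" by (rule nhd_zero_IPI)
  then show ?thesis by blast
qed

lemma limitin_eval:
  assumes X: "lc_top X" and eval: "\<And>e. 0 < e \<Longrightarrow> \<exists>V. nhd_zero X V \<and> (\<forall>c\<in>V. norm (c \<alpha>) \<le> e)"
    and lim: "limitin X xs x sequentially"
  shows "(\<lambda>n. xs n \<alpha>) \<longlonglongrightarrow> x \<alpha>"
proof (rule tendstoI)
  fix e :: real assume e: "0 < e"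
  then obtain V where V: "nhd_zero X V" "\<forall>c\<in>V. norm (c \<alpha>) \<le> e / 2" using eval[of "e / 2"] by auto
  have "eventually (\<lambda>n. xs n \<in> topspace X \<and> (\<lambda>\<alpha>. xs n \<alpha> - x \<alpha>) \<in> V) sequentially"
    using lim V(1) unfolding limitin_lc_top[OF X] by blast
  then show "eventually (\<lambda>n. dist (xs n \<alpha>) (x \<alpha>) < e) sequentially"
  proof eventually_elim
    fix n assume "xs n \<in> topspace X \<and> (\<lambda>\<alpha>. xs n \<alpha> - x \<alpha>) \<in> V"
    from bspec[OF V(2) conjunct2[OF this]] have "norm (xs n \<alpha> - x \<alpha>) \<le> e / 2" .
    then show "dist (xs n \<alpha>) (x \<alpha>) < e" using e by (simp add: dist_norm)
  qed
qed

subsection \<open>Finitely supported sequences\<close>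

definition Fin :: "('a \<Rightarrow> complex) set" where "Fin = {c. finite {\<alpha>. c \<alpha> \<noteq> 0}}"

definition trunc :: "nat \<Rightarrow> ('a \<Rightarrow> complex) \<Rightarrow> 'a \<Rightarrow> complex" where
  "trunc n c \<alpha> = (if h \<alpha> \<le> n then c \<alpha> else 0)"

text \<open>Otherwise the sums of (1/2)^h over finite subsets would be unbounded, each term being at
  least (1/2)^n. So summability alone shows that truncations by degree have finite support.\<close>

lemma finite_h_le: "finite {\<alpha>. h \<alpha> \<le> n}"
proof (rule ccontr)
  let ?A = "{\<alpha>. h \<alpha> \<le> n}" and ?f = "\<lambda>\<alpha>. (1/2::real) ^ h \<alpha>"
  assume inf: "infinite ?A"
  obtain m :: nat where m: "\<Sigma>h * 2 ^ n < real m" using reals_Archimedean2 by blast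
  obtain B where B: "B \<subseteq> ?A" "finite B" "card B = m"
    using infinite_arbitrarily_large[OF inf] by blast
  have "real m * (1/2) ^ n = (\<Sum>\<alpha>\<in>B. (1/2) ^ n)" using B by simp
  also have "\<dots> \<le> sum ?f B" using B(1) by (intro sum_mono power_decreasing) auto
  also have "\<dots> \<le> \<Sigma>h"
    unfolding \<Sigma>h_def using B half_summable by (intro finite_sum_le_infsum) auto
  finally show False using m by (simp add: power_one_over field_simps)
qed

lemma trunc_Fin: "trunc n c \<in> Fin"
  unfolding Fin_def trunc_def by (auto intro: finite_subset[OF _ finite_h_le[of n]])

lemma Fin_bnd:
  assumes c: "c \<in> Fin" and nn: "\<And>\<alpha>. 0 \<le> a \<alpha>" "\<And>\<alpha>. 0 \<le> b \<alpha>" and pos: "\<And>\<alpha>. c \<alpha> \<noteq> 0 \<Longrightarrow> 0 < b \<alpha>"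
  shows "\<exists>C\<ge>0. bnd a b C c"
proof -
  let ?A = "{\<alpha>. c \<alpha> \<noteq> 0}"
  define C where "C = (\<Sum>\<alpha>\<in>?A. norm (c \<alpha>) * a \<alpha> / b \<alpha>)"
  have fin: "finite ?A" using c by (simp add: Fin_def)
  have C: "0 \<le> C" unfolding C_def using nn by (intro sum_nonneg) auto
  have "norm (c \<alpha>) * a \<alpha> \<le> C * b \<alpha>" for \<alpha>
  proof (cases "c \<alpha> = 0")
    case False
    then have "norm (c \<alpha>) * a \<alpha> / b \<alpha> \<le> C"
      unfolding C_def using fin nn by (intro member_le_sum) auto
    then show ?thesis using pos[OF False] by (simp add: divide_le_eq)
  qed (use C nn in simp)
  then show ?thesis using C by (intro exI[of _ C]) (simp add: bnd_def)
qed

lemma (in weight_family) finite_pos: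
  assumes "finite A" shows "\<exists>i\<in>I. \<forall>\<alpha>\<in>A. 0 < u i \<alpha>"
  using assms
proof (induction A rule: finite_induct)
  case empty
  then show ?case using index_ne by blast
next
  case (insert \<alpha> A)
  then obtain i where i: "i \<in> I" "\<forall>\<alpha>\<in>A. 0 < u i \<alpha>" by blast
  obtain j where j: "j \<in> I" "0 < u j \<alpha>" using pos by blast
  obtain k where "k \<in> I" "\<forall>\<alpha>. u i \<alpha> \<le> u k \<alpha>" "\<forall>\<alpha>. u j \<alpha> \<le> u k \<alpha>" using directed[OF i(1) j(1)] by blast
  then show ?case using i j by (intro bexI[of _ k]) (auto intro: less_le_trans)
qed

text \<open>One \<open>j\<close> whose weight is positive on the finite support serves every
  \<open>i\<close>.\<close>

lemma Fin_PI: "Fin \<subseteq> topspace (PI \<infinity>)"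
proof
  fix c assume c: "c \<in> Fin"
  have "finite {\<alpha>. c \<alpha> \<noteq> 0}" using c by (simp add: Fin_def)
  then obtain j where j: "j \<in> J" "\<forall>\<alpha>\<in>{\<alpha>. c \<alpha> \<noteq> 0}. 0 < v j \<alpha>"
    using V.finite_pos by blast
  have "c \<in> Es i" if i: "i \<in> I" for i
  proof -
    have "\<exists>C\<ge>0. bnd (u i) (v j) C c"
      using j(2) by (intro Fin_bnd[OF c U.nonneg[OF i] V.nonneg[OF j(1)]]) blast
    then show ?thesis using j(1) unfolding Es_def by blast
  qed
  then show "c \<in> topspace (PI \<infinity>)" unfolding topspace_PI by blast
qed

lemma Fin_IP: "Fin \<subseteq> topspace (IP \<infinity>)"
proof
  fix c assume c: "c \<in> Fin"
  have "finite {\<alpha>. c \<alpha> \<noteq> 0}" using c by (simp add: Fin_def)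
  then obtain i where i: "i \<in> I" "\<forall>\<alpha>\<in>{\<alpha>. c \<alpha> \<noteq> 0}. 0 < u i \<alpha>"
    using U.finite_pos by blast
  have "\<exists>C\<ge>0. bnd (v j) (u i) C c" if j: "j \<in> J" for j
    using i(2) by (intro Fin_bnd[OF c V.nonneg[OF j] U.nonneg[OF i(1)]]) blast
  then have "c \<in> Gs i" unfolding Gs_def by blast
  then show "c \<in> topspace (IP \<infinity>)" using i(1) unfolding topspace_IP by blast
qed

text \<open>The error lives on degrees above \<open>n\<close>, where the two gaps gain (1/2)^h \<le>
  (1/2)^n.\<close>

lemma trunc_bnd:
  assumes c: "bnd a b C c" "0 \<le> C" and a: "\<And>\<alpha>. 2 ^ h1 \<alpha> * a' \<alpha> \<le> K * a \<alpha>" and b: "\<And>\<alpha>. 2 ^ h2 \<alpha> * b \<alpha> \<le> L * b' \<alpha>"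
    and hh: "\<And>\<alpha>. h1 \<alpha> + h2 \<alpha> = h \<alpha>" and K: "0 < K" and b': "0 < L" "\<And>\<alpha>. 0 \<le> b' \<alpha>"
  shows "bnd a' b' ((1/2) ^ n * (K * L * C)) (\<lambda>\<alpha>. trunc n c \<alpha> - c \<alpha>)"
proof (rule bndI)
  fix \<alpha>
  show "norm (trunc n c \<alpha> - c \<alpha>) * a' \<alpha> \<le> (1/2) ^ n * (K * L * C) * b' \<alpha>"
  proof (cases "h \<alpha> \<le> n")
    case True
    then show ?thesis using K b' c(2) by (simp add: trunc_def)
  next
    case False
    have "2 ^ h \<alpha> * (norm (c \<alpha>) * a' \<alpha>) = 2 ^ h2 \<alpha> * (norm (c \<alpha>) * (2 ^ h1 \<alpha> * a' \<alpha>))"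
      by (simp add: hh[symmetric] power_add)
    also have "\<dots> \<le> 2 ^ h2 \<alpha> * (norm (c \<alpha>) * (K * a \<alpha>))" using a by (intro mult_left_mono) auto
    also have "\<dots> = K * 2 ^ h2 \<alpha> * (norm (c \<alpha>) * a \<alpha>)" by simp
    also have "\<dots> \<le> K * 2 ^ h2 \<alpha> * (C * b \<alpha>)" using bndD[OF c(1)] K by (intro mult_left_mono) auto
    also have "\<dots> = K * C * (2 ^ h2 \<alpha> * b \<alpha>)" by simp
    also have "\<dots> \<le> K * C * (L * b' \<alpha>)" using K c(2) b by (intro mult_left_mono) auto
    finally have "norm (c \<alpha>) * a' \<alpha> \<le> (1/2) ^ h \<alpha> * (K * L * C * b' \<alpha>)"
      by (simp add: power_one_over field_simps)
    also have "\<dots> \<le> (1/2) ^ n * (K * L * C * b' \<alpha>)"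
      using False K b' c(2) by (intro mult_right_mono power_decreasing) auto
    finally show ?thesis using False by (simp add: trunc_def)
  qed
qed

lemma half_power_small:
  assumes "0 < \<epsilon>" "0 \<le> C" shows "eventually (\<lambda>n. (1/2) ^ n * C \<le> (\<epsilon>::real)) sequentially"
proof -
  have "(\<lambda>n. (1/2) ^ n * C) \<longlonglongrightarrow> 0 * C" by (intro tendsto_intros LIMSEQ_power_zero) auto
  then have "eventually (\<lambda>n. (1/2) ^ n * C < \<epsilon>) sequentially" using assms(1) by (intro order_tendstoD) auto
  then show ?thesis by eventually_elim simp
qed

text \<open>The gap in \<open>u\<close> leads from the target index \<open>i\<close> to the index
  \<open>k\<close> at which the bound of \<open>c\<close> is read off; the gap in \<open>v\<close>
  leads from its step \<open>j\<close> to the step \<open>l\<close> where the error is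
  measured.\<close>

lemma trunc_PI:
  assumes c: "c \<in> topspace (PI \<infinity>)" shows "limitin (PI \<infinity>) (\<lambda>n. trunc n c) c sequentially"
  unfolding limitin_lc_top[OF lc_top_PI]
proof (intro conjI allI impI c)
  fix V assume "nhd_zero (PI \<infinity>) V"
  then obtain F W where F: "finite F" "F \<subseteq> I" "\<forall>i\<in>F. nhd_zero (E \<infinity> i) (W i)"
    "(\<Inter>i\<in>I. topspace (E \<infinity> i)) \<inter> (\<Inter>i\<in>F. W i) \<subseteq> V"
    using nhd_zero_proj_limD[of I "E \<infinity>" V, OF lc_top_zero[OF lc_top_E]] unfolding PI_def by metis
  have ev: "eventually (\<lambda>n. (\<lambda>\<alpha>. trunc n c \<alpha> - c \<alpha>) \<in> W i) sequentially" if "i \<in> F" for i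
  proof -
    have i: "i \<in> I" "nhd_zero (E \<infinity> i) (W i)" using F that by auto
    obtain k K where k: "k \<in> I" "K > 0" "\<And>\<alpha>. 2 ^ hu \<alpha> * u i \<alpha> \<le> K * u k \<alpha>" using U.gap[OF i(1)] by blast
    have "c \<in> Es k" using c k(1) unfolding topspace_PI by blast
    then obtain j C where j: "j \<in> J" "0 \<le> C" "bnd (u k) (v j) C c" by (rule EsD)
    obtain l L where l: "l \<in> J" "L > 0" "\<And>\<alpha>. 2 ^ hv \<alpha> * v j \<alpha> \<le> L * v l \<alpha>" using V.gap[OF j(1)] by blast
    obtain \<epsilon> where \<epsilon>: "0 < \<epsilon>" "\<forall>d. bnd (u i) (v l) \<epsilon> d \<longrightarrow> d \<in> W i"
      by (rule nhd_zero_stepD[OF i(1) l(1) nhd_zero_E_step[OF i(1) l(1) i(2)]])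
    have b: "bnd (u i) (v l) ((1/2) ^ n * (K * L * C)) (\<lambda>\<alpha>. trunc n c \<alpha> - c \<alpha>)" for n
      using trunc_bnd[OF j(3,2) k(3) l(3) refl k(2) l(2) V.nonneg[OF l(1)]] .
    have "eventually (\<lambda>n. (1/2) ^ n * (K * L * C) \<le> \<epsilon>) sequentially"
      using \<epsilon>(1) k(2) l(2) j(2) by (intro half_power_small) auto
    then show ?thesis
      by eventually_elim (use \<epsilon>(2) bnd_mono[OF b] V.nonneg[OF l(1)] in blast)
  qed
  have "eventually (\<lambda>n. \<forall>i\<in>F. (\<lambda>\<alpha>. trunc n c \<alpha> - c \<alpha>) \<in> W i) sequentially"
    using ev F(1) by (simp add: eventually_ball_finite)
  then show "eventually (\<lambda>n. trunc n c \<in> topspace (PI \<infinity>) \<and> (\<lambda>\<alpha>. trunc n c \<alpha> - c \<alpha>) \<in> V) sequentially"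
  proof eventually_elim
    fix n assume n: "\<forall>i\<in>F. (\<lambda>\<alpha>. trunc n c \<alpha> - c \<alpha>) \<in> W i"
    have t: "trunc n c \<in> topspace (PI \<infinity>)" using trunc_Fin Fin_PI by blast
    then have "(\<lambda>\<alpha>. trunc n c \<alpha> - c \<alpha>) \<in> topspace (PI \<infinity>)"
      using lin_space_diff[OF lc_topD(1)[OF lc_top_PI] _ c] by blast
    then have E: "(\<lambda>\<alpha>. trunc n c \<alpha> - c \<alpha>) \<in> (\<Inter>i\<in>I. topspace (E \<infinity> i))"
      unfolding PI_def topspace_proj_lim[OF U.index_ne] .
    have W: "(\<lambda>\<alpha>. trunc n c \<alpha> - c \<alpha>) \<in> (\<Inter>i\<in>F. W i)" using n by blast
    show "trunc n c \<in> topspace (PI \<infinity>) \<and> (\<lambda>\<alpha>. trunc n c \<alpha> - c \<alpha>) \<in> V"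
      by (rule conjI[OF t subsetD[OF F(4) IntI[OF E W]]])
  qed
qed

lemma trunc_IP:
  assumes c: "c \<in> topspace (IP \<infinity>)" shows "limitin (IP \<infinity>) (\<lambda>n. trunc n c) c sequentially"
  unfolding limitin_lc_top[OF lc_top_IP]
proof (intro conjI allI impI c)
  fix V assume V: "nhd_zero (IP \<infinity>) V"
  obtain i0 where i0: "i0 \<in> I" "c \<in> Gs i0" using c unfolding topspace_IP by blast
  obtain k K where k: "k \<in> I" "K > 0" "\<And>\<alpha>. 2 ^ hu \<alpha> * u i0 \<alpha> \<le> K * u k \<alpha>" using U.gap[OF i0(1)] by blast
  have "nhd_zero (G \<infinity> k) V" by (rule nhd_zero_IP_step[OF k(1) V])
  then obtain F \<epsilon> where F: "finite F" "F \<subseteq> J" "\<forall>j\<in>F. 0 < \<epsilon> j"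
    "\<forall>x\<in>Gs k. (\<forall>j\<in>F. bnd (v j) (u k) (\<epsilon> j) x) \<longrightarrow> x \<in> V"
    by (rule nhd_zero_GD[OF k(1)])
  have b: "\<exists>C\<ge>0. \<forall>n. bnd (v j) (u k) ((1/2) ^ n * C) (\<lambda>\<alpha>. trunc n c \<alpha> - c \<alpha>)" if j: "j \<in> J" for j
  proof -
    obtain l L where l: "l \<in> J" "L > 0" "\<And>\<alpha>. 2 ^ hv \<alpha> * v j \<alpha> \<le> L * v l \<alpha>" using V.gap[OF j] by blast
    obtain C where C: "0 \<le> C" "bnd (v l) (u i0) C c" by (rule GsD[OF i0(2) l(1)])
    have "bnd (v j) (u k) ((1/2) ^ n * (L * K * C)) (\<lambda>\<alpha>. trunc n c \<alpha> - c \<alpha>)" for n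
      using trunc_bnd[OF C(2,1) l(3) k(3) add.commute l(2) k(2) U.nonneg[OF k(1)]] .
    moreover have "0 \<le> L * K * C" using l(2) k(2) C(1) by simp
    ultimately show ?thesis by blast
  qed
  have "eventually (\<lambda>n. bnd (v j) (u k) (\<epsilon> j) (\<lambda>\<alpha>. trunc n c \<alpha> - c \<alpha>)) sequentially" if j: "j \<in> F" for j
  proof -
    have "j \<in> J" using F(2) j by blast
    then obtain C where C: "0 \<le> C" "\<forall>n. bnd (v j) (u k) ((1/2) ^ n * C) (\<lambda>\<alpha>. trunc n c \<alpha> - c \<alpha>)"
      using b by blast
    have "eventually (\<lambda>n. (1/2) ^ n * C \<le> \<epsilon> j) sequentially"
      using F(3) j C(1) by (intro half_power_small) auto
    then show ?thesis
      by eventually_elim (use bnd_mono[OF spec[OF C(2)]] U.nonneg[OF k(1)] in blast)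
  qed
  then have "eventually (\<lambda>n. \<forall>j\<in>F. bnd (v j) (u k) (\<epsilon> j) (\<lambda>\<alpha>. trunc n c \<alpha> - c \<alpha>)) sequentially"
    using F(1) by (simp add: eventually_ball_finite)
  then show "eventually (\<lambda>n. trunc n c \<in> topspace (IP \<infinity>) \<and> (\<lambda>\<alpha>. trunc n c \<alpha> - c \<alpha>) \<in> V) sequentially"
  proof eventually_elim
    fix n assume n: "\<forall>j\<in>F. bnd (v j) (u k) (\<epsilon> j) (\<lambda>\<alpha>. trunc n c \<alpha> - c \<alpha>)"
    have "(\<lambda>\<alpha>. trunc n c \<alpha> - c \<alpha>) \<in> Gs k"
      unfolding Gs_def
    proof (intro CollectI ballI)
      fix j assume "j \<in> J"
      then obtain C where C: "0 \<le> C" "\<forall>n. bnd (v j) (u k) ((1/2) ^ n * C) (\<lambda>\<alpha>. trunc n c \<alpha> - c \<alpha>)"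
        using b by blast
      then show "\<exists>C\<ge>0. bnd (v j) (u k) C (\<lambda>\<alpha>. trunc n c \<alpha> - c \<alpha>)"
        by (intro exI[of _ "(1/2) ^ n * C"]) simp
    qed
    then have "(\<lambda>\<alpha>. trunc n c \<alpha> - c \<alpha>) \<in> V" using bspec[OF F(4)] n by blast
    moreover have "trunc n c \<in> topspace (IP \<infinity>)" using trunc_Fin Fin_IP by blast
    ultimately show "trunc n c \<in> topspace (IP \<infinity>) \<and> (\<lambda>\<alpha>. trunc n c \<alpha> - c \<alpha>) \<in> V"
      by (intro conjI)
  qed
qed

subsection \<open>Unique extension\<close>

text \<open>Two stages: for finitely supported first argument the truncations of the second
  determine the value, then the truncations of the first do. Limits in \<open>Z\<close> are unique
  because coefficients converge.\<close>

lemma separately_continuous_unique: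
  assumes X: "\<And>x. x \<in> topspace X \<Longrightarrow> limitin X (\<lambda>n. trunc n x) x sequentially"
    and Y: "\<And>y. y \<in> topspace Y \<Longrightarrow> limitin Y (\<lambda>n. trunc n y) y sequentially"
    and FX: "Fin \<subseteq> topspace X" and Z: "lc_top Z"
    and eval: "\<And>e \<alpha>. 0 < e \<Longrightarrow> \<exists>V. nhd_zero Z V \<and> (\<forall>c\<in>V. norm (c \<alpha>) \<le> e)"
    and T: "extends_on Fin T0 T" "separately_continuous X Y Z T"
    and T': "extends_on Fin T0 T'" "separately_continuous X Y Z T'"
    and x: "x \<in> topspace X" and y: "y \<in> topspace Y"
  shows "T x y = T' x y"
proof -
  have uniq: "a = b" if "limitin Z s a sequentially" "limitin Z s b sequentially" for a b s
  proof
    fix \<alpha> show "a \<alpha> = b \<alpha>"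
      using LIMSEQ_unique[OF limitin_eval[OF Z eval that(1)] limitin_eval[OF Z eval that(2)]] .
  qed
  have FinY: "T c y = T' c y" if c: "c \<in> Fin" for c
  proof -
    have "c \<in> topspace X" using FX c by blast
    then have "continuous_map Y Z (T c)" "continuous_map Y Z (T' c)"
      using T(2) T'(2) unfolding separately_continuous_def by auto
    from this[THEN continuous_map_limit, OF Y[OF y]]
    have lim: "limitin Z (T c \<circ> (\<lambda>n. trunc n y)) (T c y) sequentially"
      "limitin Z (T' c \<circ> (\<lambda>n. trunc n y)) (T' c y) sequentially" .
    have "T c \<circ> (\<lambda>n. trunc n y) = T' c \<circ> (\<lambda>n. trunc n y)"
      using T(1) T'(1) c trunc_Fin unfolding extends_on_def by auto
    then show ?thesis using uniq lim by simp
  qed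
  have "continuous_map X Z (\<lambda>x. T x y)" "continuous_map X Z (\<lambda>x. T' x y)"
    using T(2) T'(2) y unfolding separately_continuous_def by auto
  from this[THEN continuous_map_limit, OF X[OF x]]
  have lim: "limitin Z ((\<lambda>x. T x y) \<circ> (\<lambda>n. trunc n x)) (T x y) sequentially"
    "limitin Z ((\<lambda>x. T' x y) \<circ> (\<lambda>n. trunc n x)) (T' x y) sequentially" .
  have "(\<lambda>x. T x y) \<circ> (\<lambda>n. trunc n x) = (\<lambda>x. T' x y) \<circ> (\<lambda>n. trunc n x)"
    using FinY trunc_Fin by auto
  then show ?thesis using uniq lim by simp
qed

section \<open>From zero neighbourhoods to the extension statements\<close>

lemma limitin_add_lc_top:
  assumes Z: "lc_top Z" and a: "limitin Z a A F"
    and b: "\<And>V. nhd_zero Z V \<Longrightarrow> eventually (\<lambda>n. b n \<in> topspace Z \<and> b n \<in> V) F"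
  shows "limitin Z (\<lambda>n \<alpha>. a n \<alpha> + b n \<alpha>) A F"
  unfolding limitin_lc_top[OF Z]
proof (intro conjI allI impI)
  show A: "A \<in> topspace Z" using a by (simp add: limitin_def)
  fix V assume "nhd_zero Z V"
  then obtain W where W: "W \<subseteq> V" "abs_convex W" "nhd_zero Z W" using lc_topD(3)[OF Z] by blast
  let ?W = "{c. (\<lambda>\<alpha>. of_real 2 * c \<alpha>) \<in> W}"
  have W2: "nhd_zero Z ?W" using nhd_zero_dilate[OF Z W(3), of 2] by simp
  have "eventually (\<lambda>n. a n \<in> topspace Z \<and> (\<lambda>\<alpha>. a n \<alpha> - A \<alpha>) \<in> ?W) F"
    using a W2 unfolding limitin_lc_top[OF Z] by blast
  with b[OF W2] show "eventually (\<lambda>n. (\<lambda>\<alpha>. a n \<alpha> + b n \<alpha>) \<in> topspace Z \<and> (\<lambda>\<alpha>. a n \<alpha> + b n \<alpha> - A \<alpha>) \<in> V) F"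
  proof eventually_elim
    fix n assume 1: "b n \<in> topspace Z \<and> b n \<in> ?W" and 2: "a n \<in> topspace Z \<and> (\<lambda>\<alpha>. a n \<alpha> - A \<alpha>) \<in> ?W"
    have "(\<lambda>\<alpha>. (a n \<alpha> - A \<alpha>) + b n \<alpha>) \<in> W"
      using abs_convex_add_half[OF W(2), of "\<lambda>\<alpha>. a n \<alpha> - A \<alpha>" "b n"] 1 2 by simp
    moreover have "(\<lambda>\<alpha>. (a n \<alpha> - A \<alpha>) + b n \<alpha>) = (\<lambda>\<alpha>. a n \<alpha> + b n \<alpha> - A \<alpha>)"
      by (rule ext) simp
    ultimately have "(\<lambda>\<alpha>. a n \<alpha> + b n \<alpha> - A \<alpha>) \<in> V" using W(1) by (simp only: subset_iff)
    moreover have "(\<lambda>\<alpha>. a n \<alpha> + b n \<alpha>) \<in> topspace Z"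
      using lin_space_add[OF lc_topD(1)[OF Z]] 1 2 by blast
    ultimately show "(\<lambda>\<alpha>. a n \<alpha> + b n \<alpha>) \<in> topspace Z \<and> (\<lambda>\<alpha>. a n \<alpha> + b n \<alpha> - A \<alpha>) \<in> V"
      by (intro conjI)
  qed
qed

lemma S_diff_right:
  assumes "x \<in> topspace (IP \<infinity>)" "c \<in> topspace (PI \<infinity>)" "d \<in> topspace (PI \<infinity>)"
  shows "S x (\<lambda>\<alpha>. d \<alpha> - c \<alpha>) = (\<lambda>\<alpha>. S x d \<alpha> - S x c \<alpha>)"
proof
  fix \<gamma>
  obtain i0 where i0: "i0 \<in> I" "x \<in> Gs i0" using assms(1) unfolding topspace_IP by blast
  show "S x (\<lambda>\<alpha>. d \<alpha> - c \<alpha>) \<gamma> = S x d \<gamma> - S x c \<gamma>"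
    using S_comb_right[OF summable_IP_PI[OF i0 assms(3)] summable_IP_PI[OF i0 assms(2)], of 1 "-1"] by simp
qed

lemma S_diff_left:
  assumes "c \<in> topspace (IP \<infinity>)" "d \<in> topspace (IP \<infinity>)" "y \<in> topspace (PI \<infinity>)"
  shows "S (\<lambda>\<alpha>. d \<alpha> - c \<alpha>) y = (\<lambda>\<alpha>. S d y \<alpha> - S c y \<alpha>)"
proof
  fix \<gamma>
  obtain i0 i1 where i0: "i0 \<in> I" "c \<in> Gs i0" and i1: "i1 \<in> I" "d \<in> Gs i1"
    using assms(1,2) unfolding topspace_IP by blast
  show "S (\<lambda>\<alpha>. d \<alpha> - c \<alpha>) y \<gamma> = S d y \<gamma> - S c y \<gamma>"
    using S_comb_left[OF summable_IP_PI[OF i1 assms(3)] summable_IP_PI[OF i0 assms(3)], of 1 "-1"] by simp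
qed

lemma S_diff_right':
  assumes "y \<in> topspace (PI \<infinity>)" "c \<in> topspace (IP \<infinity>)" "d \<in> topspace (IP \<infinity>)"
  shows "S y (\<lambda>\<alpha>. d \<alpha> - c \<alpha>) = (\<lambda>\<alpha>. S y d \<alpha> - S y c \<alpha>)"
proof
  fix \<gamma>
  show "S y (\<lambda>\<alpha>. d \<alpha> - c \<alpha>) \<gamma> = S y d \<gamma> - S y c \<gamma>"
    using S_comb_right[OF S_in_IP(2)[OF assms(3,1)] S_in_IP(2)[OF assms(2,1)], of 1 "-1"] by simp
qed

lemma S_diff_left':
  assumes "c \<in> topspace (PI \<infinity>)" "d \<in> topspace (PI \<infinity>)" "x \<in> topspace (IP \<infinity>)"
  shows "S (\<lambda>\<alpha>. d \<alpha> - c \<alpha>) x = (\<lambda>\<alpha>. S d x \<alpha> - S c x \<alpha>)"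
proof
  fix \<gamma>
  show "S (\<lambda>\<alpha>. d \<alpha> - c \<alpha>) x \<gamma> = S d x \<gamma> - S c x \<gamma>"
    using S_comb_left[OF S_in_IP(2)[OF assms(3,2)] S_in_IP(2)[OF assms(3,1)], of 1 "-1"] by simp
qed

lemma continuous_S_IP_PI:
  shows "x \<in> topspace (IP \<infinity>) \<Longrightarrow> continuous_map (PI \<infinity>) (PI \<infinity>) (\<lambda>y. S x y)"
    and "y \<in> topspace (PI \<infinity>) \<Longrightarrow> continuous_map (IP \<infinity>) (PI \<infinity>) (\<lambda>x. S x y)"
proof -
  assume x: "x \<in> topspace (IP \<infinity>)"
  show "continuous_map (PI \<infinity>) (PI \<infinity>) (\<lambda>y. S x y)"
  proof (rule continuous_map_lc_top[OF lc_top_PI lc_top_PI])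
    fix c d assume c: "c \<in> topspace (PI \<infinity>)" and d: "d \<in> topspace (PI \<infinity>)"
    show "S x (\<lambda>\<alpha>. d \<alpha> - c \<alpha>) = (\<lambda>\<alpha>. S x d \<alpha> - S x c \<alpha>)"
      by (rule S_diff_right[OF x c d])
  next
    fix c assume c: "c \<in> topspace (PI \<infinity>)"
    show "S x c \<in> topspace (PI \<infinity>)" by (rule S_in_PI[OF x c])
  next
    fix V assume V: "nhd_zero (PI \<infinity>) V"
    show "nhd_zero (PI \<infinity>) {c \<in> topspace (PI \<infinity>). S x c \<in> V}"
      using S_right_nhd_PI[OF x V] by simp
  qed
next
  assume y: "y \<in> topspace (PI \<infinity>)"
  then have y': "{y} \<subseteq> topspace (PI \<infinity>)" by blast
  show "continuous_map (IP \<infinity>) (PI \<infinity>) (\<lambda>x. S x y)"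
  proof (rule continuous_map_lc_top[OF lc_top_IP lc_top_PI])
    fix c d assume c: "c \<in> topspace (IP \<infinity>)" and d: "d \<in> topspace (IP \<infinity>)"
    show "S (\<lambda>\<alpha>. d \<alpha> - c \<alpha>) y = (\<lambda>\<alpha>. S d y \<alpha> - S c y \<alpha>)"
      by (rule S_diff_left[OF c d y])
  next
    fix c assume c: "c \<in> topspace (IP \<infinity>)"
    show "S c y \<in> topspace (PI \<infinity>)" by (rule S_in_PI[OF c y])
  next
    fix V assume V: "nhd_zero (PI \<infinity>) V"
    show "nhd_zero (IP \<infinity>) {c \<in> topspace (IP \<infinity>). S c y \<in> V}"
      using S_equicontinuous_IP_PI[OF bdd_singleton[OF y] y' V] by simp
  qed
qed

lemma continuous_S_PI_IP:
  shows "y \<in> topspace (PI \<infinity>) \<Longrightarrow> continuous_map (IP \<infinity>) (IP \<infinity>) (\<lambda>x. S y x)"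
    and "x \<in> topspace (IP \<infinity>) \<Longrightarrow> continuous_map (PI \<infinity>) (IP \<infinity>) (\<lambda>y. S y x)"
proof -
  assume y: "y \<in> topspace (PI \<infinity>)"
  then have y': "{y} \<subseteq> topspace (PI \<infinity>)" by blast
  show "continuous_map (IP \<infinity>) (IP \<infinity>) (\<lambda>x. S y x)"
  proof (rule continuous_map_lc_top[OF lc_top_IP lc_top_IP])
    fix c d assume c: "c \<in> topspace (IP \<infinity>)" and d: "d \<in> topspace (IP \<infinity>)"
    show "S y (\<lambda>\<alpha>. d \<alpha> - c \<alpha>) = (\<lambda>\<alpha>. S y d \<alpha> - S y c \<alpha>)"
      by (rule S_diff_right'[OF y c d])
  next
    fix c assume c: "c \<in> topspace (IP \<infinity>)"
    show "S y c \<in> topspace (IP \<infinity>)" by (rule S_in_IP(1)[OF c y])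
  next
    fix V assume V: "nhd_zero (IP \<infinity>) V"
    show "nhd_zero (IP \<infinity>) {c \<in> topspace (IP \<infinity>). S y c \<in> V}"
      using S_equicontinuous_PI_IP[OF bdd_singleton[OF y] y' V] by simp
  qed
next
  assume x: "x \<in> topspace (IP \<infinity>)"
  show "continuous_map (PI \<infinity>) (IP \<infinity>) (\<lambda>y. S y x)"
  proof (rule continuous_map_lc_top[OF lc_top_PI lc_top_IP])
    fix c d assume c: "c \<in> topspace (PI \<infinity>)" and d: "d \<in> topspace (PI \<infinity>)"
    show "S (\<lambda>\<alpha>. d \<alpha> - c \<alpha>) x = (\<lambda>\<alpha>. S d x \<alpha> - S c x \<alpha>)"
      by (rule S_diff_left'[OF c d x])
  next
    fix c assume c: "c \<in> topspace (PI \<infinity>)"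
    show "S c x \<in> topspace (IP \<infinity>)" by (rule S_in_IP(1)[OF x c])
  next
    fix V assume V: "nhd_zero (IP \<infinity>) V"
    show "nhd_zero (PI \<infinity>) {c \<in> topspace (PI \<infinity>). S c x \<in> V}"
      using S_left_nhd_IP[OF x V] by simp
  qed
qed

text \<open>\<open>T xs ys\<close> is split into \<open>T x ys\<close> and
  \<open>T (xs - x) ys\<close>. The former converges by continuity in the second variable; in the
  latter \<open>ys\<close> is bounded and \<open>xs - x\<close> tends to zero, so equicontinuity
  applies. The first argument of \<open>T\<close> is always the one in \<open>IP\<close>; for the
  other order of the factors \<open>T\<close> is \<open>S\<close> with exchanged arguments.\<close>

lemma jointly_seq_continuousI:
  assumes Z: "lc_top Z"
    and equi: "\<And>B V. bdd B \<Longrightarrow> B \<subseteq> topspace (PI \<infinity>) \<Longrightarrow> nhd_zero Z V \<Longrightarrow>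
      nhd_zero (IP \<infinity>) {x \<in> topspace (IP \<infinity>). \<forall>y\<in>B. T x y \<in> V}"
    and cont: "\<And>x. x \<in> topspace (IP \<infinity>) \<Longrightarrow> continuous_map (PI \<infinity>) Z (T x)"
    and map: "\<And>x y. x \<in> topspace (IP \<infinity>) \<Longrightarrow> y \<in> topspace (PI \<infinity>) \<Longrightarrow> T x y \<in> topspace Z"
    and diff: "\<And>c d y. c \<in> topspace (IP \<infinity>) \<Longrightarrow> d \<in> topspace (IP \<infinity>) \<Longrightarrow> y \<in> topspace (PI \<infinity>) \<Longrightarrow>
      T (\<lambda>\<alpha>. d \<alpha> - c \<alpha>) y = (\<lambda>\<alpha>. T d y \<alpha> - T c y \<alpha>)"
    and xs: "limitin (IP \<infinity>) xs x sequentially" and ys: "limitin (PI \<infinity>) ys y sequentially"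
  shows "limitin Z (\<lambda>n. T (xs n) (ys n)) (T x y) sequentially"
proof -
  have x: "x \<in> topspace (IP \<infinity>)" using xs by (simp add: limitin_def)
  have "eventually (\<lambda>n. xs n \<in> topspace (IP \<infinity>)) sequentially" "eventually (\<lambda>n. ys n \<in> topspace (PI \<infinity>)) sequentially"
    using xs ys by (auto simp: limitin_def)
  then have "eventually (\<lambda>n. xs n \<in> topspace (IP \<infinity>) \<and> ys n \<in> topspace (PI \<infinity>)) sequentially"
    by (rule eventually_conj)
  then obtain N where N: "\<And>n. n \<ge> N \<Longrightarrow> xs n \<in> topspace (IP \<infinity>) \<and> ys n \<in> topspace (PI \<infinity>)"
    unfolding eventually_sequentially by blast
  \<comment> \<open>Convergence places the terms in the spaces only eventually, while boundedness
    concerns a whole sequence, so the first \<open>N\<close> terms are dropped.\<close>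
  define xs' ys' where "xs' n = xs (n + N)" and "ys' n = ys (n + N)" for n
  have lim': "limitin (IP \<infinity>) xs' x sequentially" "limitin (PI \<infinity>) ys' y sequentially"
    unfolding xs'_def ys'_def using limitin_sequentially_offset[OF xs] limitin_sequentially_offset[OF ys] by blast+
  have top: "xs' n \<in> topspace (IP \<infinity>)" "ys' n \<in> topspace (PI \<infinity>)" for n
    using N unfolding xs'_def ys'_def by auto
  have top_diff: "(\<lambda>\<alpha>. xs' n \<alpha> - x \<alpha>) \<in> topspace (IP \<infinity>)" for n
    using lin_space_diff[OF lc_topD(1)[OF lc_top_IP] top(1) x] .
  have bdd: "bdd (range ys')" "range ys' \<subseteq> topspace (PI \<infinity>)"
    using convergent_bdd[OF lim'(2) top(2)] top(2) by auto
  have a: "limitin Z (\<lambda>n. T x (ys' n)) (T x y) sequentially"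
    using continuous_map_limit[OF cont[OF x] lim'(2)] by (simp add: o_def)
  have b: "eventually (\<lambda>n. T (\<lambda>\<alpha>. xs' n \<alpha> - x \<alpha>) (ys' n) \<in> topspace Z \<and> T (\<lambda>\<alpha>. xs' n \<alpha> - x \<alpha>) (ys' n) \<in> V) sequentially"
    if V: "nhd_zero Z V" for V
  proof -
    have "eventually (\<lambda>n. xs' n \<in> topspace (IP \<infinity>) \<and>
        (\<lambda>\<alpha>. xs' n \<alpha> - x \<alpha>) \<in> {x \<in> topspace (IP \<infinity>). \<forall>y\<in>range ys'. T x y \<in> V}) sequentially"
      using lim'(1) equi[OF bdd V] unfolding limitin_lc_top[OF lc_top_IP] by blast
    then show ?thesis
      by eventually_elim (use map top_diff top(2) in blast)
  qed
  have "T (xs' n) (ys' n) = (\<lambda>\<alpha>. T x (ys' n) \<alpha> + T (\<lambda>\<alpha>. xs' n \<alpha> - x \<alpha>) (ys' n) \<alpha>)" for n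
    unfolding diff[OF x top(1) top(2)] by simp
  then have "limitin Z (\<lambda>n. T (xs' n) (ys' n)) (T x y) sequentially"
    using limitin_add_lc_top[OF Z a b] by simp
  then show ?thesis
    unfolding xs'_def ys'_def by (rule limitin_sequentially_offset_rev)
qed

lemma extension_IP_PI: "uniquely_extendable Fin S (IP \<infinity>) (PI \<infinity>) (PI \<infinity>)"
  unfolding uniquely_extendable_def
proof (intro conjI exI[of _ S] allI impI ballI Fin_IP Fin_PI)
  show "extends_on Fin S S" by (simp add: extends_on_def)
  show "separately_continuous (IP \<infinity>) (PI \<infinity>) (PI \<infinity>) S"
    unfolding separately_continuous_def using continuous_S_IP_PI by blast
  show "jointly_seq_continuous (IP \<infinity>) (PI \<infinity>) (PI \<infinity>) S"
    unfolding jointly_seq_continuous_def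
  proof (intro allI impI, elim conjE)
    fix xs ys x y
    assume xs: "limitin (IP \<infinity>) xs x sequentially" and ys: "limitin (PI \<infinity>) ys y sequentially"
    show "limitin (PI \<infinity>) (\<lambda>n. S (xs n) (ys n)) (S x y) sequentially"
    proof (rule jointly_seq_continuousI[where T = "\<lambda>x y. S x y", OF lc_top_PI _ _ _ _ xs ys])
      fix B V assume "bdd B" "B \<subseteq> topspace (PI \<infinity>)" "nhd_zero (PI \<infinity>) V"
      then show "nhd_zero (IP \<infinity>) {x \<in> topspace (IP \<infinity>). \<forall>y\<in>B. S x y \<in> V}"
        by (rule S_equicontinuous_IP_PI)
    next
      fix x assume "x \<in> topspace (IP \<infinity>)"
      then show "continuous_map (PI \<infinity>) (PI \<infinity>) (\<lambda>y. S x y)" by (rule continuous_S_IP_PI(1))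
    next
      fix x y assume x: "x \<in> topspace (IP \<infinity>)" and y: "y \<in> topspace (PI \<infinity>)"
      show "S x y \<in> topspace (PI \<infinity>)" by (rule S_in_PI[OF x y])
      fix d assume d: "d \<in> topspace (IP \<infinity>)"
      show "S (\<lambda>\<alpha>. d \<alpha> - x \<alpha>) y = (\<lambda>\<alpha>. S d y \<alpha> - S x y \<alpha>)" by (rule S_diff_left[OF x d y])
    qed
  qed
  fix T T' x y
  assume "extends_on Fin S T \<and> separately_continuous (IP \<infinity>) (PI \<infinity>) (PI \<infinity>) T \<and>
      extends_on Fin S T' \<and> separately_continuous (IP \<infinity>) (PI \<infinity>) (PI \<infinity>) T'"
    and "x \<in> topspace (IP \<infinity>)" "y \<in> topspace (PI \<infinity>)"
  then show "T x y = T' x y"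
    using separately_continuous_unique[OF trunc_IP trunc_PI Fin_IP lc_top_PI eval_PI] by blast
qed

lemma extension_PI_IP: "uniquely_extendable Fin S (PI \<infinity>) (IP \<infinity>) (IP \<infinity>)"
  unfolding uniquely_extendable_def
proof (intro conjI exI[of _ S] allI impI ballI Fin_IP Fin_PI)
  show "extends_on Fin S S" by (simp add: extends_on_def)
  show "separately_continuous (PI \<infinity>) (IP \<infinity>) (IP \<infinity>) S"
    unfolding separately_continuous_def using continuous_S_PI_IP by blast
  show "jointly_seq_continuous (PI \<infinity>) (IP \<infinity>) (IP \<infinity>) S"
    unfolding jointly_seq_continuous_def
  proof (intro allI impI, elim conjE)
    fix xs ys x y
    assume xs: "limitin (PI \<infinity>) xs x sequentially" and ys: "limitin (IP \<infinity>) ys y sequentially"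
    show "limitin (IP \<infinity>) (\<lambda>n. S (xs n) (ys n)) (S x y) sequentially"
    proof (rule jointly_seq_continuousI[where T = "\<lambda>x y. S y x", OF lc_top_IP _ _ _ _ ys xs])
      fix B V assume "bdd B" "B \<subseteq> topspace (PI \<infinity>)" "nhd_zero (IP \<infinity>) V"
      then show "nhd_zero (IP \<infinity>) {x \<in> topspace (IP \<infinity>). \<forall>y\<in>B. S y x \<in> V}"
        by (rule S_equicontinuous_PI_IP)
    next
      fix x assume "x \<in> topspace (IP \<infinity>)"
      then show "continuous_map (PI \<infinity>) (IP \<infinity>) (\<lambda>y. S y x)" by (rule continuous_S_PI_IP(2))
    next
      fix x y assume x: "x \<in> topspace (IP \<infinity>)" and y: "y \<in> topspace (PI \<infinity>)"
      show "S y x \<in> topspace (IP \<infinity>)" by (rule S_in_IP(1)[OF x y])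
      fix d assume d: "d \<in> topspace (IP \<infinity>)"
      show "S y (\<lambda>\<alpha>. d \<alpha> - x \<alpha>) = (\<lambda>\<alpha>. S y d \<alpha> - S y x \<alpha>)" by (rule S_diff_right'[OF y x d])
    qed
  qed
  fix T T' x y
  assume "extends_on Fin S T \<and> separately_continuous (PI \<infinity>) (IP \<infinity>) (IP \<infinity>) T \<and>
      extends_on Fin S T' \<and> separately_continuous (PI \<infinity>) (IP \<infinity>) (IP \<infinity>) T'"
    and "x \<in> topspace (PI \<infinity>)" "y \<in> topspace (IP \<infinity>)"
  then show "T x y = T' x y"
    using separately_continuous_unique[OF trunc_PI trunc_IP Fin_PI lc_top_IP eval_IP] by blast
qed

end

section \<open>Transport to formal series\<close>

lemma topspace_pullback_UNIV: "topspace (pullback_topology UNIV f X) = f -` topspace X"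
  by (simp add: topspace_pullback_topology)

lemma continuous_map_from_pullback: "continuous_map (pullback_topology UNIV f X) X f"
  using continuous_map_pullback[OF continuous_map_id, of UNIV f X] by simp

lemma continuous_map_inv_pullback: "bij f \<Longrightarrow> continuous_map X (pullback_topology UNIV f X) (inv f)"
  by (rule continuous_map_pullback') (simp_all add: iffD1[OF surj_iff bij_is_surj])

text \<open>Conjugation with \<open>f\<close> carries an extension to the pulled back spaces;
  conversely two extensions there are conjugated back and compared where uniqueness is
  known.\<close>

lemma uniquely_extendable_pullback:
  assumes f: "bij f" and ext: "uniquely_extendable D' S X Y Z"
    and D: "\<And>x. x \<in> D \<longleftrightarrow> f x \<in> D'"
    and T0: "\<And>x y. x \<in> D \<Longrightarrow> y \<in> D \<Longrightarrow> f (T0 x y) = S (f x) (f y)"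
  shows "uniquely_extendable D T0 (pullback_topology UNIV f X) (pullback_topology UNIV f Y) (pullback_topology UNIV f Z)"
proof -
  let ?P = "pullback_topology UNIV f"
  let ?g = "inv f"
  have fg [simp]: "f (?g a) = a" and gf [simp]: "?g (f b) = b" for a b
    using f by (simp_all add: bij_is_surj bij_is_inj surj_f_inv_f)
  have sep: "separately_continuous (?P X) (?P Y) (?P Z) (\<lambda>x y. ?g (T (f x) (f y)))"
    if T: "separately_continuous X Y Z T" for T
    unfolding separately_continuous_def
  proof (intro conjI ballI)
    fix x assume "x \<in> topspace (?P X)"
    then have "continuous_map Y Z (T (f x))"
      using T unfolding separately_continuous_def by (simp add: topspace_pullback_UNIV)
    from continuous_map_compose[OF continuous_map_compose[OF continuous_map_from_pullback this] continuous_map_inv_pullback[OF f]]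
    show "continuous_map (?P Y) (?P Z) (\<lambda>y. ?g (T (f x) (f y)))" by (simp add: o_def)
  next
    fix y assume "y \<in> topspace (?P Y)"
    then have "continuous_map X Z (\<lambda>x. T x (f y))"
      using T unfolding separately_continuous_def by (simp add: topspace_pullback_UNIV)
    from continuous_map_compose[OF continuous_map_compose[OF continuous_map_from_pullback this] continuous_map_inv_pullback[OF f]]
    show "continuous_map (?P X) (?P Z) (\<lambda>x. ?g (T (f x) (f y)))" by (simp add: o_def)
  qed
  have sep': "separately_continuous X Y Z (\<lambda>a b. f (T (?g a) (?g b)))"
    if T: "separately_continuous (?P X) (?P Y) (?P Z) T" for T
    unfolding separately_continuous_def
  proof (intro conjI ballI)
    fix a assume "a \<in> topspace X"
    then have "continuous_map (?P Y) (?P Z) (T (?g a))"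
      using T unfolding separately_continuous_def by (simp add: topspace_pullback_UNIV)
    from continuous_map_compose[OF continuous_map_compose[OF continuous_map_inv_pullback[OF f] this] continuous_map_from_pullback]
    show "continuous_map Y Z (\<lambda>b. f (T (?g a) (?g b)))" by (simp add: o_def)
  next
    fix b assume "b \<in> topspace Y"
    then have "continuous_map (?P X) (?P Z) (\<lambda>x. T x (?g b))"
      using T unfolding separately_continuous_def by (simp add: topspace_pullback_UNIV)
    from continuous_map_compose[OF continuous_map_compose[OF continuous_map_inv_pullback[OF f] this] continuous_map_from_pullback]
    show "continuous_map X Z (\<lambda>a. f (T (?g a) (?g b)))" by (simp add: o_def)
  qed
  have ext': "extends_on D' S (\<lambda>a b. f (T (?g a) (?g b)))" if "extends_on D T0 T" for T
    using that T0[of "?g _" "?g _"] D[of "?g _"] unfolding extends_on_def by simp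
  have sub: "D \<subseteq> topspace (?P X)" "D \<subseteq> topspace (?P Y)"
    using ext D unfolding uniquely_extendable_def topspace_pullback_UNIV by auto
  obtain T where T: "extends_on D' S T" "separately_continuous X Y Z T" "jointly_seq_continuous X Y Z T"
    using ext unfolding uniquely_extendable_def by blast
  let ?T = "\<lambda>x y. ?g (T (f x) (f y))"
  have "extends_on D T0 ?T"
    unfolding extends_on_def
  proof (intro ballI)
    fix x y assume "x \<in> D" "y \<in> D"
    then have "T (f x) (f y) = f (T0 x y)" using T(1) D T0 unfolding extends_on_def by simp
    then show "?T x y = T0 x y" by simp
  qed
  moreover have "jointly_seq_continuous (?P X) (?P Y) (?P Z) ?T"
    unfolding jointly_seq_continuous_def
  proof (intro allI impI, elim conjE)
    fix xs ys x y
    assume "limitin (?P X) xs x sequentially" "limitin (?P Y) ys y sequentially"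
    from this[THEN continuous_map_limit[OF continuous_map_from_pullback]]
    have "limitin Z (\<lambda>n. T (f (xs n)) (f (ys n))) (T (f x) (f y)) sequentially"
      using T(3) unfolding jointly_seq_continuous_def o_def by blast
    from continuous_map_limit[OF continuous_map_inv_pullback[OF f] this]
    show "limitin (?P Z) (\<lambda>n. ?T (xs n) (ys n)) (?T x y) sequentially" by (simp add: o_def)
  qed
  moreover have "T x y = T' x y"
    if "extends_on D T0 T" "separately_continuous (?P X) (?P Y) (?P Z) T"
      "extends_on D T0 T'" "separately_continuous (?P X) (?P Y) (?P Z) T'"
      "x \<in> topspace (?P X)" "y \<in> topspace (?P Y)" for T T' x y
  proof -
    let ?F = "\<lambda>T a b. f (T (?g a) (?g b))"
    have "?F T (f x) (f y) = ?F T' (f x) (f y)"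
      using ext ext'[OF that(1)] sep'[OF that(2)] ext'[OF that(3)] sep'[OF that(4)] that(5,6)
      unfolding uniquely_extendable_def topspace_pullback_UNIV vimage_eq by meson
    then have "f (T x y) = f (T' x y)" by simp
    then show ?thesis by (metis gf)
  qed
  ultimately show ?thesis
    unfolding uniquely_extendable_def using sub sep[OF T(2)] by blast
qed

section \<open>Multi-indices\<close>

lemma mi_abs_add: "mi_abs (\<alpha> + \<gamma>) = mi_abs \<alpha> + mi_abs \<gamma>"
  by (simp add: mi_abs_def sum.distrib)

lemma mi_fact_mult_le: "mi_fact \<alpha> * mi_fact \<gamma> \<le> mi_fact (\<alpha> + \<gamma>)"
proof -
  have "fact a * fact b \<le> (fact (a + b) :: real)" for a b :: nat
  proof -
    have "fact a * fact b \<le> (fact (a + b) :: nat)"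
      using fact_fact_dvd_fact[of a b, where 'a = nat] by (intro dvd_imp_le) auto
    then show ?thesis by (metis of_nat_fact of_nat_le_iff of_nat_mult)
  qed
  then show ?thesis
    by (auto simp: mi_fact_def prod.distrib[symmetric] intro!: prod_mono)
qed

text \<open>In each coordinate a binomial coefficient of \<open>a + b\<close> is at most
  \<open>2 ^ (a + b)\<close>.\<close>

lemma mi_fact_add_le: "mi_fact (\<alpha> + \<gamma>) \<le> 2 ^ mi_abs (\<alpha> + \<gamma>) * (mi_fact \<alpha> * mi_fact \<gamma>)"
proof -
  have "(fact (a + b) :: real) \<le> 2 ^ (a + b) * (fact a * fact b)" for a b :: nat
  proof -
    have "fact a * fact b * ((a + b) choose a) = (fact (a + b) :: nat)"
      using binomial_fact_lemma[of a "a + b"] by simp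
    then have "(fact (a + b) :: nat) \<le> fact a * fact b * 2 ^ (a + b)"
      using binomial_le_pow2[of "a + b" a] by (metis mult_le_mono2)
    then have "real (fact (a + b)) \<le> real (fact a * fact b * 2 ^ (a + b))" by (simp only: of_nat_le_iff)
    then show ?thesis by (simp add: mult.commute)
  qed
  then have "mi_fact (\<alpha> + \<gamma>) \<le> (\<Prod>i\<in>UNIV. 2 ^ (\<alpha> $ i + \<gamma> $ i) * (fact (\<alpha> $ i) * fact (\<gamma> $ i)))"
    unfolding mi_fact_def by (intro prod_mono) auto
  also have "\<dots> = 2 ^ mi_abs (\<alpha> + \<gamma>) * (mi_fact \<alpha> * mi_fact \<gamma>)"
    by (simp add: prod.distrib mi_fact_def mi_abs_def power_sum)
  finally show ?thesis .
qed

text \<open>The finite set is enlarged to a box, over which the sum is a product of partial sums of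
  the geometric series.\<close>

lemma sum_power_mi_abs_le:
  assumes x: "0 < x" "x < (1::real)" and F: "finite (F :: (nat ^ 'd::finite) set)"
  shows "(\<Sum>\<alpha>\<in>F. x ^ mi_abs \<alpha>) \<le> (1 / (1 - x)) ^ CARD('d)"
proof -
  let ?N = "Max (insert 0 ((\<lambda>(\<alpha>, i). \<alpha> $ i) ` (F \<times> UNIV)))"
  have N: "\<alpha> $ i \<le> ?N" if "\<alpha> \<in> F" for \<alpha> i
    using F that by (intro Max_ge) force+
  let ?P = "PiE (UNIV :: 'd set) (\<lambda>_. {..?N})"
  have inj: "inj_on (($) :: nat ^ 'd \<Rightarrow> _) F" by (auto simp: inj_on_def vec_eq_iff)
  have "(\<Sum>\<alpha>\<in>F. x ^ mi_abs \<alpha>) = (\<Sum>\<alpha>\<in>F. \<Prod>i\<in>UNIV. x ^ (\<alpha> $ i))"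
    by (simp add: mi_abs_def power_sum)
  also have "\<dots> = (\<Sum>g\<in>($) ` F. \<Prod>i\<in>UNIV. x ^ g i)"
    by (subst sum.reindex[OF inj]) simp
  also have "\<dots> \<le> (\<Sum>g\<in>?P. \<Prod>i\<in>UNIV. x ^ g i)"
    using x N by (intro sum_mono2 finite_PiE prod_nonneg) auto
  also have "\<dots> = (\<Prod>i\<in>(UNIV :: 'd set). \<Sum>n\<le>?N. x ^ n)"
    by (subst prod_sum_PiE) auto
  also have "\<dots> \<le> (\<Prod>i\<in>(UNIV :: 'd set). 1 / (1 - x))"
  proof (intro prod_mono conjI)
    have "(\<Sum>n\<le>?N. x ^ n) \<le> (\<Sum>n. x ^ n)"
      using x by (intro sum_le_suminf) auto
    also have "\<dots> = 1 / (1 - x)" using x by (intro suminf_geometric) auto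
    finally show "(\<Sum>n\<le>?N. x ^ n) \<le> 1 / (1 - x)" .
  qed (use x in \<open>auto intro!: sum_nonneg\<close>)
  finally show ?thesis by simp
qed

section \<open>Summation over pairs of multi-indices and the kernel of the product\<close>

definition mi2_abs :: "('d2::finite, 'd1::finite) mi2 \<Rightarrow> nat" where
  "mi2_abs \<alpha> = mi_abs (fst \<alpha>) + mi_abs (snd \<alpha>)"

lemma summable_power_mi2_abs:
  assumes x: "0 < x" "x < (1::real)"
  shows "(\<lambda>\<alpha> :: ('d2::finite, 'd1::finite) mi2. x ^ mi2_abs \<alpha>) summable_on UNIV"
proof (rule nonneg_bdd_above_summable_on)
  let ?f = "\<lambda>\<alpha> :: ('d2, 'd1) mi2. x ^ mi2_abs \<alpha>"
  let ?B = "(1 / (1 - x)) ^ CARD('d2) * (1 / (1 - x)) ^ CARD('d1)"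
  have "sum ?f F \<le> ?B" if F: "finite F" for F
  proof -
    have "sum ?f F \<le> sum ?f (fst ` F \<times> snd ` F)"
      using F x by (intro sum_mono2) (auto simp: image_iff, force+)
    also have "\<dots> = (\<Sum>a\<in>fst ` F. x ^ mi_abs a) * (\<Sum>b\<in>snd ` F. x ^ mi_abs b)"
      by (simp add: sum_product sum.cartesian_product mi2_abs_def power_add split_def)
    also have "\<dots> \<le> ?B"
      using F x by (intro mult_mono sum_power_mi_abs_le sum_nonneg) auto
    finally show ?thesis .
  qed
  then show "bdd_above (sum ?f ` {F. F \<subseteq> UNIV \<and> finite F})" by (intro bdd_aboveI[of _ ?B]) auto
qed (use x in auto)

text \<open>The derivative of order \<alpha>, divided by the square root of \<alpha>!, maps the
  basis element of index \<alpha> + \<gamma> to this multiple of the one of index \<gamma>.\<close>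

definition mi_kernel :: "('d2::finite, 'd1::finite) mi2 \<Rightarrow> ('d2, 'd1) mi2 \<Rightarrow> real" where
  "mi_kernel \<alpha> \<gamma> = sqrt (mi2_fact (\<alpha> + \<gamma>) / (mi2_fact \<alpha> * mi2_fact \<gamma>))"

text \<open>With \<open>n\<close> the degree of \<alpha> + \<gamma>, the binomial product is at most
  2^n \<le> (2^n)^2, so its root is at most 2^n; the generous square keeps the exponents integral.
  The second 2^n dominates the factor at \<alpha>.\<close>

lemma mi_kernel_le: "2 ^ mi2_abs \<alpha> * mi_kernel \<alpha> \<gamma> \<le> 4 ^ mi2_abs (\<alpha> + \<gamma>)"
proof -
  let ?n = "mi2_abs (\<alpha> + \<gamma>)"
  have "mi2_fact (\<alpha> + \<gamma>) \<le> (2 ^ mi_abs (fst \<alpha> + fst \<gamma>) * (mi_fact (fst \<alpha>) * mi_fact (fst \<gamma>))) *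
      (2 ^ mi_abs (snd \<alpha> + snd \<gamma>) * (mi_fact (snd \<alpha>) * mi_fact (snd \<gamma>)))"
    unfolding mi2_fact_def fst_add snd_add
    by (intro mult_mono mi_fact_add_le mult_nonneg_nonneg zero_le_power) (auto intro: less_imp_le mi_fact_pos)
  also have "\<dots> = 2 ^ ?n * (mi2_fact \<alpha> * mi2_fact \<gamma>)"
    by (simp add: mi2_fact_def mi2_abs_def power_add)
  finally have "mi2_fact (\<alpha> + \<gamma>) / (mi2_fact \<alpha> * mi2_fact \<gamma>) \<le> 2 ^ ?n"
    using mi2_fact_pos[of \<alpha>] mi2_fact_pos[of \<gamma>] by (simp add: divide_le_eq)
  also have "\<dots> \<le> (2 ^ ?n)\<^sup>2"
    by (simp add: power2_eq_square)
  finally have "mi_kernel \<alpha> \<gamma> \<le> 2 ^ ?n"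
    unfolding mi_kernel_def by (intro real_le_lsqrt) (auto intro!: divide_nonneg_pos less_imp_le mi2_fact_pos mult_pos_pos)
  then have "2 ^ mi2_abs \<alpha> * mi_kernel \<alpha> \<gamma> \<le> 2 ^ mi2_abs \<alpha> * 2 ^ ?n" by (rule mult_left_mono) simp
  also have "\<dots> \<le> 2 ^ ?n * 2 ^ ?n"
    by (intro mult_right_mono power_increasing) (auto simp: mi2_abs_def mi_abs_add)
  also have "\<dots> = 4 ^ ?n" by (simp flip: power_mult_distrib)
  finally show ?thesis .
qed

lemma mi_weight_pair:
  assumes "weight_family I u hu" "weight_family J v hv" "\<And>\<alpha>. hu \<alpha> + hv \<alpha> = mi2_abs \<alpha>"
  shows "weight_pair I u hu J v hv mi_kernel"
proof -
  interpret U: weight_family I u hu by fact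
  interpret V: weight_family J v hv by fact
  show ?thesis
  proof
    show "0 \<le> mi_kernel \<alpha> \<gamma>" for \<alpha> \<gamma> :: "('b, 'c) mi2"
      using mi2_fact_pos[of "\<alpha> + \<gamma>"] mi2_fact_pos[of \<alpha>] mi2_fact_pos[of \<gamma>] by (simp add: mi_kernel_def)
  qed (simp_all only: assms(3) mi_kernel_le summable_power_mi2_abs)
qed

lemma bij_coeff_c: "bij coeff_c"
proof (rule o_bij)
  let ?g = "\<lambda>c \<alpha>. c \<alpha> / of_real (sqrt (mi2_fact \<alpha>))"
  have "mi2_fact \<alpha> \<noteq> 0" for \<alpha> using mi2_fact_pos[of \<alpha>] by simp
  then show "?g \<circ> coeff_c = id" "coeff_c \<circ> ?g = id" by (auto simp: coeff_c_def fun_eq_iff)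
qed

text \<open>The quotient of factorials from the derivative, the normalization by the square root of
  \<alpha>! and the two from \<open>coeff_c\<close> combine to the kernel. The support of the first
  factor is finite, so the sum over it equals the infinite sum in \<open>S\<close>.\<close>

lemma coeff_c_diamond:
  assumes "K1 \<in> hatA_fin"
  shows "coeff_c (diamond K1 K2) \<gamma> =
    (\<Sum>\<^sub>\<infinity>\<alpha>. coeff_c K1 \<alpha> * coeff_c K2 (\<alpha> + \<gamma>) * of_real (mi_kernel \<alpha> \<gamma>))"
proof -
  let ?A = "{\<alpha>. coeff_c K1 \<alpha> \<noteq> 0}"
  have fin: "finite ?A" using assms by (simp only: hatA_fin_def mem_Collect_eq)
  have term_eq: "coeff_c K1 \<alpha> * fderiv \<alpha> K2 \<gamma> / of_real (sqrt (mi2_fact \<alpha>)) * of_real (sqrt (mi2_fact \<gamma>)) =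
      coeff_c K1 \<alpha> * coeff_c K2 (\<alpha> + \<gamma>) * of_real (mi_kernel \<alpha> \<gamma>)" for \<alpha>
  proof -
    let ?a = "mi2_fact \<alpha>" and ?g = "mi2_fact \<gamma>" and ?ag = "mi2_fact (\<alpha> + \<gamma>)"
    have pos: "0 < ?a" "0 < ?g" "0 < ?ag" by (rule mi2_fact_pos)+
    have "?ag / ?g / sqrt ?a * sqrt ?g = ?ag / (sqrt ?a * sqrt ?g)"
    proof -
      have "x / (b * b) / a * b = x / (a * b)" if "b \<noteq> 0" for x a b :: real
        using that by (simp add: field_simps)
      from this[of "sqrt ?g" ?ag "sqrt ?a"] show ?thesis using pos by simp
    qed
    also have "\<dots> = sqrt ?ag * mi_kernel \<alpha> \<gamma>"
      using pos by (simp add: mi_kernel_def real_sqrt_divide real_sqrt_mult)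
    finally have "of_real (?ag / ?g / sqrt ?a * sqrt ?g) = (of_real (sqrt ?ag * mi_kernel \<alpha> \<gamma>) :: complex)"
      by simp
    moreover have "coeff_c K1 \<alpha> * fderiv \<alpha> K2 \<gamma> / of_real (sqrt ?a) * of_real (sqrt ?g) =
        coeff_c K1 \<alpha> * K2 (\<alpha> + \<gamma>) * of_real (?ag / ?g / sqrt ?a * sqrt ?g)"
      by (simp add: fderiv_def add.commute[of \<gamma> \<alpha>])
    moreover have "coeff_c K1 \<alpha> * coeff_c K2 (\<alpha> + \<gamma>) * of_real (mi_kernel \<alpha> \<gamma>) =
        coeff_c K1 \<alpha> * K2 (\<alpha> + \<gamma>) * of_real (sqrt ?ag * mi_kernel \<alpha> \<gamma>)"
      by (simp add: coeff_c_def)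
    ultimately show ?thesis by (simp only:)
  qed
  have "coeff_c (diamond K1 K2) \<gamma> = diamond K1 K2 \<gamma> * of_real (sqrt (mi2_fact \<gamma>))"
    by (simp only: coeff_c_def)
  also have "\<dots> = (\<Sum>\<alpha>\<in>?A. coeff_c K1 \<alpha> * coeff_c K2 (\<alpha> + \<gamma>) * of_real (mi_kernel \<alpha> \<gamma>))"
    by (simp only: diamond_def sum_distrib_right term_eq)
  also have "\<dots> = (\<Sum>\<^sub>\<infinity>\<alpha>\<in>?A. coeff_c K1 \<alpha> * coeff_c K2 (\<alpha> + \<gamma>) * of_real (mi_kernel \<alpha> \<gamma>))"
    using fin by (simp only: infsum_finite)
  also have "\<dots> = (\<Sum>\<^sub>\<infinity>\<alpha>. coeff_c K1 \<alpha> * coeff_c K2 (\<alpha> + \<gamma>) * of_real (mi_kernel \<alpha> \<gamma>))"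
    by (rule infsum_cong_neutral) auto
  finally show ?thesis .
qed

lemma diamond_extension:
  assumes wp: "weight_pair I u hu J v hv mi_kernel" and p: "0 < p"
  defines "P \<equiv> series_space (proj_lim I (\<lambda>i. ind_lim J (\<lambda>j. ell p (quot (u i) (v j)))))"
    and "Q \<equiv> series_space (ind_lim I (\<lambda>i. proj_lim J (\<lambda>j. ell p (quot (v j) (u i)))))"
  shows "uniquely_extendable hatA_fin diamond P Q Q" and "uniquely_extendable hatA_fin diamond Q P P"
proof -
  interpret weight_pair I u hu J v hv mi_kernel by fact
  have P: "P = pullback_topology UNIV coeff_c (PI \<infinity>)" and Q: "Q = pullback_topology UNIV coeff_c (IP \<infinity>)"
    unfolding P_def Q_def series_space_def PI_exponent[OF p, symmetric] IP_exponent[OF p, symmetric]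
    by (simp_all only: PI_def IP_def E_def[abs_def] G_def[abs_def])
  have D: "K \<in> hatA_fin \<longleftrightarrow> coeff_c K \<in> Fin" for K by (simp only: hatA_fin_def Fin_def mem_Collect_eq)
  have T: "coeff_c (diamond K1 K2) = S (coeff_c K1) (coeff_c K2)" if "K1 \<in> hatA_fin" "K2 \<in> hatA_fin" for K1 K2
    by (rule ext) (simp only: coeff_c_diamond[OF that(1)] S_def summand_def)
  show "uniquely_extendable hatA_fin diamond P Q Q"
    unfolding P Q 
    by (rule uniquely_extendable_pullback[where f = coeff_c and S = S and ?T0.0 = diamond and D = hatA_fin,
          OF bij_coeff_c extension_PI_IP])
      (simp_all only: D T)
  show "uniquely_extendable hatA_fin diamond Q P P"
    unfolding P Q 
    by (rule uniquely_extendable_pullback[where f = coeff_c and S = S and ?T0.0 = diamond and D = hatA_fin,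
          OF bij_coeff_c extension_IP_PI])
      (simp_all only: D T)
qed

section \<open>The weights\<close>

fun phi :: "real \<Rightarrow> flat_real \<Rightarrow> nat ^ 'd \<Rightarrow> real" where
  "phi r (Reg x) \<alpha> = exp (r * real (mi_abs \<alpha>) powr (1 / (2 * x)))"
| "phi r (Flat \<sigma>) \<alpha> = r ^ mi_abs \<alpha> * mi_fact \<alpha> powr (1 / (2 * \<sigma>))"

text \<open>The inverse of \<open>theta\<close> is recorded because it stays real at the zero index:
  it is an indicator function where \<open>theta\<close> takes the values 1 and \<infinity>.\<close>

definition rho :: "real \<Rightarrow> flat_real \<Rightarrow> nat ^ 'd \<Rightarrow> real" where
  "rho r s \<alpha> = (if s = Reg 0 then of_bool (real (mi_abs \<alpha>) \<le> r) else 1 / phi r s \<alpha>)"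

lemma theta_eq_phi: "s \<noteq> Reg 0 \<Longrightarrow> theta r s \<alpha> = ennreal (phi r s \<alpha>)"
  by (cases s) auto

lemma phi_pos: "0 < r \<Longrightarrow> 0 < phi r s \<alpha>"
  using mi_fact_pos[of \<alpha>] by (cases s) auto

lemma theta_eq_rho: "0 < r \<Longrightarrow> theta r s \<alpha> = inverse (ennreal (rho r s \<alpha>))"
  using phi_pos[of r s \<alpha>] by (auto simp: rho_def theta_eq_phi inverse_ennreal)

lemma rho_nonneg: "0 < r \<Longrightarrow> 0 \<le> rho r s \<alpha>"
  using phi_pos[of r s \<alpha>] by (auto simp: rho_def)

lemma phi_mono:
  assumes "s \<in> bar_R_flat" "0 < r" "r \<le> r'" shows "phi r s \<alpha> \<le> phi r' s \<alpha>"
  using assms mi_fact_pos[of \<alpha>] by (cases s) (auto intro!: mult_right_mono power_mono)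

lemma powr_add_le:
  fixes a b m :: real
  assumes "0 \<le> a" "0 \<le> b" "0 < m"
  shows "a powr m + b powr m \<le> 2 * (a + b) powr m" and "(a + b) powr m \<le> 2 powr m * (a powr m + b powr m)"
proof -
  have "a powr m \<le> (a + b) powr m" "b powr m \<le> (a + b) powr m"
    using assms by (auto intro!: powr_mono2)
  then show "a powr m + b powr m \<le> 2 * (a + b) powr m" by simp
  have "(a + b) powr m \<le> (2 * max a b) powr m" using assms by (intro powr_mono2) auto
  also have "\<dots> = 2 powr m * max a b powr m" using assms by (simp add: powr_mult)
  also have "\<dots> \<le> 2 powr m * (a powr m + b powr m)"
    by (intro mult_left_mono) (auto simp: max_def)
  finally show "(a + b) powr m \<le> 2 powr m * (a powr m + b powr m)" .
qed

text \<open>For a real index a^m + b^m is compared with (a + b)^m, and the constants 2 and 2^m go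
  into \<open>k\<close>. For a flat index \<alpha>! \<gamma>! is compared with (\<alpha> +
  \<gamma>)!; the factor 2^|\<alpha> + \<gamma>|, raised to the power \<tau>, becomes a dilation of
  \<open>r\<close> by 2^\<tau>.\<close>

lemma phi_add:
  assumes s: "s \<in> bar_R_flat" "s \<noteq> Reg 0"
  shows "\<exists>k\<ge>1. \<forall>r>0. \<forall>\<alpha> \<gamma>. phi (r / k) s \<alpha> * phi (r / k) s \<gamma> \<le> phi r s (\<alpha> + \<gamma>) \<and>
    phi r s (\<alpha> + \<gamma>) \<le> phi (k * r) s \<alpha> * phi (k * r) s \<gamma>"
proof (cases s)
  case (Reg x)
  define m where "m = 1 / (2 * x)"
  have x: "0 < x" using s Reg by (auto simp: bar_R_flat_def)
  then have m: "0 < m" by (simp add: m_def)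
  define k where "k = 2 * 2 powr m"
  have k: "1 \<le> 2 powr m" "1 \<le> k" "2 \<le> k" "2 powr m \<le> k"
    using m ge_one_powr_ge_zero[of 2 m] by (auto simp: k_def)
  have "phi (r / k) s \<alpha> * phi (r / k) s \<gamma> \<le> phi r s (\<alpha> + \<gamma>) \<and>
    phi r s (\<alpha> + \<gamma>) \<le> phi (k * r) s \<alpha> * phi (k * r) s \<gamma>" if r: "0 < r" for r and \<alpha> \<gamma> :: "nat ^ 'a"
  proof -
    let ?a = "real (mi_abs \<alpha>)" and ?b = "real (mi_abs \<gamma>)"
    have "r / k * (?a powr m + ?b powr m) \<le> r / k * (2 * (?a + ?b) powr m)"
      using r k m by (intro mult_left_mono powr_add_le) auto
    also have "\<dots> \<le> r / k * (k * (?a + ?b) powr m)"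
      using r k by (intro mult_left_mono mult_right_mono) auto
    also have "\<dots> = r * (?a + ?b) powr m" using k by simp
    finally have 1: "r / k * ?a powr m + r / k * ?b powr m \<le> r * (?a + ?b) powr m"
      by (simp add: distrib_left)
    have "r * (?a + ?b) powr m \<le> r * (2 powr m * (?a powr m + ?b powr m))"
      using r m by (intro mult_left_mono powr_add_le) auto
    also have "\<dots> \<le> r * (k * (?a powr m + ?b powr m))"
      using r k by (intro mult_left_mono mult_right_mono) auto
    finally have 2: "r * (?a + ?b) powr m \<le> k * r * ?a powr m + k * r * ?b powr m"
      by (simp add: algebra_simps)
    show ?thesis
      using 1 2 by (simp add: Reg m_def[symmetric] mi_abs_add exp_add[symmetric])
  qed
  then show ?thesis using k by blast
next
  case (Flat \<sigma>)
  define \<tau> where "\<tau> = 1 / (2 * \<sigma>)"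
  have \<tau>: "0 < \<tau>" using s Flat by (auto simp: bar_R_flat_def \<tau>_def)
  define k where "k = 2 powr \<tau>"
  have k: "1 \<le> k" using \<tau> ge_one_powr_ge_zero[of 2 \<tau>] by (auto simp: k_def)
  have "phi (r / k) s \<alpha> * phi (r / k) s \<gamma> \<le> phi r s (\<alpha> + \<gamma>) \<and>
    phi r s (\<alpha> + \<gamma>) \<le> phi (k * r) s \<alpha> * phi (k * r) s \<gamma>" if r: "0 < r" for r and \<alpha> \<gamma> :: "nat ^ 'a"
  proof
    let ?n = "mi_abs (\<alpha> + \<gamma>)" and ?a = "mi_fact \<alpha>" and ?b = "mi_fact \<gamma>" and ?ab = "mi_fact (\<alpha> + \<gamma>)"
    have pos: "0 < ?a" "0 < ?b" "0 < ?ab" by (rule mi_fact_pos)+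
    have eq: "phi t s \<alpha> * phi t s \<gamma> = t ^ ?n * (?a * ?b) powr \<tau>" for t
      using pos by (simp add: Flat \<tau>_def[symmetric] mi_abs_add power_add powr_mult)
    have lhs: "phi r s (\<alpha> + \<gamma>) = r ^ ?n * ?ab powr \<tau>" by (simp add: Flat \<tau>_def)
    have "(r / k) ^ ?n * (?a * ?b) powr \<tau> \<le> r ^ ?n * ?ab powr \<tau>"
      using r k pos \<tau> mi_fact_mult_le[of \<alpha> \<gamma>]
      by (intro mult_mono power_mono powr_mono2) (auto simp: divide_le_eq)
    then show "phi (r / k) s \<alpha> * phi (r / k) s \<gamma> \<le> phi r s (\<alpha> + \<gamma>)"
      unfolding eq by (simp add: Flat \<tau>_def[symmetric])
    have "?ab powr \<tau> \<le> (2 ^ ?n * (?a * ?b)) powr \<tau>"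
      using pos \<tau> mi_fact_add_le[of \<alpha> \<gamma>] by (intro powr_mono2) auto
    also have "\<dots> = k ^ ?n * (?a * ?b) powr \<tau>"
      using pos by (simp add: powr_mult k_def powr_realpow[symmetric] powr_powr mult.commute)
    finally have "r ^ ?n * ?ab powr \<tau> \<le> r ^ ?n * (k ^ ?n * (?a * ?b) powr \<tau>)"
      using r by (intro mult_left_mono) auto
    then show "phi r s (\<alpha> + \<gamma>) \<le> phi (k * r) s \<alpha> * phi (k * r) s \<gamma>"
      unfolding eq using lhs by (simp add: power_mult_distrib ac_simps)
  qed
  then show ?thesis using k by blast
qed

text \<open>A real index at most 1/2 means \<open>m \<ge> 1\<close>, hence |\<alpha>| \<le>
  |\<alpha>|^m, and one more unit in \<open>r\<close> beats 2^|\<alpha>| since 2 \<le> e. At the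
  endpoint the weight is exp(r |\<alpha>|), which still permits this. For a flat index
  \<open>r\<close> is doubled.\<close>

lemma phi_gap_up:
  assumes s: "s \<in> bar_R_flat" "s \<noteq> Reg 0" "s \<le> Reg (1/2)" and r: "0 < r"
  shows "\<exists>r'>0. \<forall>\<alpha>. 2 ^ mi_abs \<alpha> * phi r s \<alpha> \<le> phi r' s \<alpha>"
proof (cases s)
  case (Reg x)
  then have x: "0 < x" "x \<le> 1/2" using s by (auto simp: bar_R_flat_def less_eq_flat_real_def)
  define m where "m = 1 / (2 * x)"
  have m: "1 \<le> m" using x by (simp add: m_def)
  have "2 ^ mi_abs \<alpha> * phi r s \<alpha> \<le> phi (r + 1) s \<alpha>" for \<alpha> :: "nat ^ 'a"
  proof -
    let ?a = "real (mi_abs \<alpha>)"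
    have "?a \<le> ?a powr m"
    proof (cases "mi_abs \<alpha> = 0")
      case False
      then show ?thesis using powr_mono[OF m, of ?a] by simp
    qed simp
    have "(2::real) ^ mi_abs \<alpha> \<le> exp 1 ^ mi_abs \<alpha>"
      using exp_ge_add_one_self[of 1] by (intro power_mono) auto
    also have "\<dots> = exp ?a" by (simp add: exp_of_nat_mult[symmetric])
    also have "\<dots> \<le> exp (?a powr m)" using \<open>?a \<le> ?a powr m\<close> by simp
    finally have "2 ^ mi_abs \<alpha> * exp (r * ?a powr m) \<le> exp (?a powr m) * exp (r * ?a powr m)"
      by (rule mult_right_mono) simp
    also have "\<dots> = exp ((r + 1) * ?a powr m)" by (simp add: exp_add[symmetric] algebra_simps)
    finally show ?thesis by (simp add: Reg m_def[symmetric])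
  qed
  then show ?thesis using r by (intro exI[of _ "r + 1"]) auto
next
  case (Flat \<sigma>)
  then show ?thesis using r by (intro exI[of _ "2 * r"]) (simp add: power_mult_distrib)
qed

text \<open>The factor has to be absorbed by shrinking \<open>r\<close>, for which \<open>m\<close>
  must exceed 1 strictly: then |\<alpha>| is at most (r/2) |\<alpha>|^m plus a constant. At the
  index 1/2 a small \<open>r\<close> would leave no room for 2^|\<alpha>|.\<close>

lemma phi_gap_down:
  assumes s: "s \<in> bar_R_flat" "s \<noteq> Reg 0" "s < Reg (1/2)" and r: "0 < r"
  shows "\<exists>r'>0. \<exists>C>0. \<forall>\<alpha>. 2 ^ mi_abs \<alpha> * phi r' s \<alpha> \<le> C * phi r s \<alpha>"
proof (cases s)
  case (Reg x)
  then have x: "0 < x" "x < 1/2" using s by (auto simp: bar_R_flat_def)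
  define m where "m = 1 / (2 * x)"
  have m: "1 < m" using x by (simp add: m_def)
  \<comment> \<open>The point at which \<open>r / 2 * a powr m\<close> overtakes \<open>a\<close>,
    that is, \<open>K powr (m - 1) = 2 / r\<close>.\<close>
  define K where "K = (2 / r) powr (1 / (m - 1))"
  have K: "0 \<le> K" by (simp add: K_def)
  have bound: "a \<le> r / 2 * a powr m + K" if a: "0 \<le> a" for a
  proof (cases "a \<le> K")
    case True
    have "0 \<le> r / 2 * a powr m" using r by simp
    then show ?thesis using True by linarith
  next
    case False
    then have a0: "0 < a" using K by linarith
    have "2 / r = K powr (m - 1)" using r m by (simp add: K_def powr_powr)
    also have "\<dots> \<le> a powr (m - 1)" using False K m by (intro powr_mono2) auto
    finally have "2 / r * a \<le> a powr (m - 1) * a" using a by (rule mult_right_mono)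
    also have "\<dots> = a powr m" using a0 powr_add[of a "m - 1" 1] by simp
    finally have "a \<le> r / 2 * a powr m" using r by (simp add: field_simps)
    then show ?thesis using K by linarith
  qed
  have "2 ^ mi_abs \<alpha> * phi (r / 2) s \<alpha> \<le> exp K * phi r s \<alpha>" for \<alpha> :: "nat ^ 'a"
  proof -
    let ?a = "real (mi_abs \<alpha>)"
    have "(2::real) ^ mi_abs \<alpha> \<le> exp 1 ^ mi_abs \<alpha>"
      using exp_ge_add_one_self[of 1] by (intro power_mono) auto
    also have "\<dots> = exp ?a" by (simp add: exp_of_nat_mult[symmetric])
    also have "\<dots> \<le> exp (r / 2 * ?a powr m + K)" using bound[of ?a] by simp
    finally have "2 ^ mi_abs \<alpha> * exp (r / 2 * ?a powr m) \<le> exp (r / 2 * ?a powr m + K) * exp (r / 2 * ?a powr m)"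
      by (rule mult_right_mono) simp
    also have "\<dots> = exp K * exp (r * ?a powr m)" by (simp add: exp_add[symmetric] algebra_simps)
    finally show ?thesis by (simp add: Reg m_def[symmetric])
  qed
  then show ?thesis using r by (intro exI[of _ "r / 2"] conjI exI[of _ "exp K"]) auto
next
  case (Flat \<sigma>)
  have "2 ^ mi_abs \<alpha> * phi (r / 2) s \<alpha> \<le> 1 * phi r s \<alpha>" for \<alpha> :: "nat ^ 'a"
    by (simp add: Flat power_divide)
  then show ?thesis using r by (intro exI[of _ "r / 2"] conjI exI[of _ 1]) auto
qed

lemma weight_family_phi:
  assumes s: "s \<in> bar_R_flat" "s \<noteq> Reg 0" "s \<le> Reg (1/2)"
  shows "weight_family pos (\<lambda>r. phi r s) mi_abs"
proof
  have "\<exists>k. \<forall>m\<ge>k. \<forall>\<alpha> :: nat ^ 'a. phi r s \<alpha> \<le> phi (real (m + 1)) s \<alpha>" if r: "r \<in> pos" for r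
  proof -
    obtain k where "r \<le> real k" using real_arch_simple by blast
    then have "phi r s \<alpha> \<le> phi (real (m + 1)) s \<alpha>" if "m \<ge> k" for m and \<alpha> :: "nat ^ 'a"
      using r that by (intro phi_mono s) auto
    then show ?thesis by blast
  qed
  then have cof: "\<forall>r\<in>pos. \<exists>k. \<forall>m\<ge>k. \<forall>\<alpha> :: nat ^ 'a. phi r s \<alpha> \<le> phi (real (m + 1)) s \<alpha>"
    by (rule ballI)
  have "range (\<lambda>m. real (m + 1)) \<subseteq> pos" by auto
  from conjI[OF this cof]
  show "\<exists>f::nat \<Rightarrow> real. range f \<subseteq> pos \<and> (\<forall>r\<in>pos. \<exists>k. \<forall>m\<ge>k. \<forall>\<alpha> :: nat ^ 'a. phi r s \<alpha> \<le> phi (f m) s \<alpha>)"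
    by (rule exI[of _ "\<lambda>m. real (m + 1)"])
next
  obtain k where k1: "k \<ge> 1" and k2: "\<forall>r>0. \<forall>\<alpha> \<gamma> :: nat ^ 'a. phi (r / k) s \<alpha> * phi (r / k) s \<gamma> \<le> phi r s (\<alpha> + \<gamma>) \<and>
    phi r s (\<alpha> + \<gamma>) \<le> phi (k * r) s \<alpha> * phi (k * r) s \<gamma>"
    using phi_add[OF s(1,2)] by (elim exE conjE)
  have k: "k \<ge> 1" "phi (r / k) s \<alpha> * phi (r / k) s \<gamma> \<le> phi r s (\<alpha> + \<gamma>)"
    "phi r s (\<alpha> + \<gamma>) \<le> phi (k * r) s \<alpha> * phi (k * r) s \<gamma>" if "0 < r" for r and \<alpha> \<gamma> :: "nat ^ 'a"
    using k1 k2[rule_format, OF that, of \<alpha> \<gamma>] by blast+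
  fix r assume r: "r \<in> pos"
  show "0 \<le> phi r s \<alpha>" for \<alpha> :: "nat ^ 'a" using phi_pos[of r s \<alpha>] r by simp
  show "\<exists>k\<in>pos. \<exists>C>0. \<forall>\<alpha> :: nat ^ 'a. 2 ^ mi_abs \<alpha> * phi r s \<alpha> \<le> C * phi k s \<alpha>"
  proof -
    obtain r' where "0 < r'" "\<forall>\<alpha> :: nat ^ 'a. 2 ^ mi_abs \<alpha> * phi r s \<alpha> \<le> phi r' s \<alpha>"
      using phi_gap_up[OF s, of r] r by auto
    then show ?thesis by (intro bexI[of _ r'] exI[of _ 1]) auto
  qed
  show "\<exists>k\<in>pos. \<exists>C>0. \<forall>\<alpha> \<gamma> :: nat ^ 'a. phi r s \<alpha> * phi r s \<gamma> \<le> C * phi k s (\<alpha> + \<gamma>)"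
  proof -
    have kr: "k * r \<in> pos" using k1 r by simp
    have "phi r s \<alpha> * phi r s \<gamma> \<le> 1 * phi (k * r) s (\<alpha> + \<gamma>)" for \<alpha> \<gamma> :: "nat ^ 'a"
      using k(2)[of "k * r" \<alpha> \<gamma>] k1 kr by simp
    then show ?thesis using kr zero_less_one by blast
  qed
  show "\<exists>k\<in>pos. \<exists>C>0. \<forall>\<alpha> \<gamma> :: nat ^ 'a. phi r s (\<alpha> + \<gamma>) \<le> C * (phi k s \<alpha> * phi k s \<gamma>)"
  proof -
    have kr: "k * r \<in> pos" using k1 r by simp
    have "phi r s (\<alpha> + \<gamma>) \<le> 1 * (phi (k * r) s \<alpha> * phi (k * r) s \<gamma>)" for \<alpha> \<gamma> :: "nat ^ 'a"
      using k(3)[of r \<alpha> \<gamma>] r by simp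
    then show ?thesis using kr zero_less_one by blast
  qed
next
  show "\<exists>r\<in>pos. 0 < phi r s \<alpha>" for \<alpha> :: "nat ^ 'a"
    by (intro bexI[of _ 1] phi_pos) auto
qed

text \<open>Inverse weights grow as \<open>r\<close> tends to 0, hence the cofinal sequence
  \<open>1 / (m + 1)\<close>. At the zero index they are indicators of |\<alpha>| \<le> r and grow
  with \<open>r\<close>; there the gap costs only the constant 2^r, and \<open>super\<close> doubles
  the radius.\<close>

lemma weight_family_rho:
  assumes s: "s \<in> bar_R_flat" "s < Reg (1/2)"
  shows "weight_family pos (\<lambda>r. rho r s) mi_abs"
proof (cases "s = Reg 0")
  case True
  then have rho: "rho r s \<alpha> = of_bool (real (mi_abs \<alpha>) \<le> r)" for r and \<alpha> :: "nat ^ 'a"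
    by (simp add: rho_def)
  show ?thesis
  proof (unfold rho, unfold_locales)
    have "\<exists>k::nat. \<forall>m\<ge>k. \<forall>\<alpha> :: nat ^ 'a. of_bool (real (mi_abs \<alpha>) \<le> r) \<le> (of_bool (real (mi_abs \<alpha>) \<le> real (m + 1)) :: real)" if "r \<in> pos" for r
    proof -
      obtain k where "r \<le> real k" using real_arch_simple by blast
      then show ?thesis by (intro exI[of _ k]) auto
    qed
    then have cof: "\<forall>r\<in>pos. \<exists>k::nat. \<forall>m\<ge>k. \<forall>\<alpha> :: nat ^ 'a.
        of_bool (real (mi_abs \<alpha>) \<le> r) \<le> (of_bool (real (mi_abs \<alpha>) \<le> real (m + 1)) :: real)"
      by (rule ballI)
    have "range (\<lambda>m. real (m + 1)) \<subseteq> pos" by auto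
    from conjI[OF this cof]
    show "\<exists>f::nat \<Rightarrow> real. range f \<subseteq> pos \<and> (\<forall>r\<in>pos. \<exists>k. \<forall>m\<ge>k. \<forall>\<alpha> :: nat ^ 'a.
        of_bool (real (mi_abs \<alpha>) \<le> r) \<le> (of_bool (real (mi_abs \<alpha>) \<le> f m) :: real))"
      by (rule exI[of _ "\<lambda>m. real (m + 1)"])
    fix r :: real assume r: "r \<in> pos"
    have "2 ^ mi_abs \<alpha> * of_bool (real (mi_abs \<alpha>) \<le> r) \<le> 2 powr r * (of_bool (real (mi_abs \<alpha>) \<le> r) :: real)" for \<alpha> :: "nat ^ 'a"
      by (auto simp: powr_realpow[symmetric])
    then show "\<exists>k\<in>pos. \<exists>C>0. \<forall>\<alpha> :: nat ^ 'a. 2 ^ mi_abs \<alpha> * of_bool (real (mi_abs \<alpha>) \<le> r) \<le>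
        C * (of_bool (real (mi_abs \<alpha>) \<le> k) :: real)"
      using r by (intro bexI[of _ r] exI[of _ "2 powr r"]) auto
    show "\<exists>k\<in>pos. \<exists>C>0. \<forall>\<alpha> \<gamma> :: nat ^ 'a. of_bool (real (mi_abs \<alpha>) \<le> r) * of_bool (real (mi_abs \<gamma>) \<le> r) \<le>
        C * (of_bool (real (mi_abs (\<alpha> + \<gamma>)) \<le> k) :: real)"
      using r by (intro bexI[of _ "2 * r"] exI[of _ 1]) (auto simp: mi_abs_add)
    show "\<exists>k\<in>pos. \<exists>C>0. \<forall>\<alpha> \<gamma> :: nat ^ 'a. of_bool (real (mi_abs (\<alpha> + \<gamma>)) \<le> r) \<le>
        C * (of_bool (real (mi_abs \<alpha>) \<le> k) * of_bool (real (mi_abs \<gamma>) \<le> k) :: real)"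
      using r by (intro bexI[of _ r] exI[of _ 1]) (auto simp: mi_abs_add)
  next
    show "\<exists>r\<in>pos. 0 < (of_bool (real (mi_abs \<alpha>) \<le> r) :: real)" for \<alpha> :: "nat ^ 'a"
      by (intro bexI[of _ "real (mi_abs \<alpha>) + 1"]) auto
  qed auto
next
  case False
  then have rho: "rho r s \<alpha> = 1 / phi r s \<alpha>" for r and \<alpha> :: "nat ^ 'a"
    by (simp add: rho_def)
  obtain k where k1: "k \<ge> 1" and k2: "\<forall>r>0. \<forall>\<alpha> \<gamma> :: nat ^ 'a. phi (r / k) s \<alpha> * phi (r / k) s \<gamma> \<le> phi r s (\<alpha> + \<gamma>) \<and>
    phi r s (\<alpha> + \<gamma>) \<le> phi (k * r) s \<alpha> * phi (k * r) s \<gamma>"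
    using phi_add[OF s(1) False] by (elim exE conjE)
  have k: "k \<ge> 1" "phi (r / k) s \<alpha> * phi (r / k) s \<gamma> \<le> phi r s (\<alpha> + \<gamma>)"
    "phi r s (\<alpha> + \<gamma>) \<le> phi (k * r) s \<alpha> * phi (k * r) s \<gamma>" if "0 < r" for r and \<alpha> \<gamma> :: "nat ^ 'a"
    using k1 k2[rule_format, OF that, of \<alpha> \<gamma>] by blast+
  show ?thesis
  proof
    have "\<exists>k. \<forall>m\<ge>k. \<forall>\<alpha> :: nat ^ 'a. rho r s \<alpha> \<le> rho (1 / real (m + 1)) s \<alpha>" if r: "r \<in> pos" for r
    proof -
      obtain k where k: "1 / r \<le> real k" using real_arch_simple by blast
      have "rho r s \<alpha> \<le> rho (1 / real (m + 1)) s \<alpha>" if "m \<ge> k" for m and \<alpha> :: "nat ^ 'a"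
      proof -
        have "1 / r \<le> real (m + 1)" using k that by simp
        then have "1 / real (m + 1) \<le> r" using r by (simp add: field_simps)
        then have "phi (1 / real (m + 1)) s \<alpha> \<le> phi r s \<alpha>" by (intro phi_mono s) auto
        then show ?thesis
          unfolding rho by (intro divide_left_mono mult_pos_pos phi_pos) (use r in auto)
      qed
      then show ?thesis by blast
    qed
    then have cof: "\<forall>r\<in>pos. \<exists>k. \<forall>m\<ge>k. \<forall>\<alpha> :: nat ^ 'a. rho r s \<alpha> \<le> rho (1 / real (m + 1)) s \<alpha>"
      by (rule ballI)
    have "range (\<lambda>m. 1 / real (m + 1)) \<subseteq> pos" by auto
    from conjI[OF this cof]
    show "\<exists>f::nat \<Rightarrow> real. range f \<subseteq> pos \<and> (\<forall>r\<in>pos. \<exists>k. \<forall>m\<ge>k. \<forall>\<alpha> :: nat ^ 'a. rho r s \<alpha> \<le> rho (f m) s \<alpha>)"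
      by (rule exI[of _ "\<lambda>m. 1 / real (m + 1)"])
  next
    fix r assume r: "r \<in> pos"
    show "0 \<le> rho r s \<alpha>" for \<alpha> :: "nat ^ 'a" using rho_nonneg r by simp
    show "\<exists>k\<in>pos. \<exists>C>0. \<forall>\<alpha> :: nat ^ 'a. 2 ^ mi_abs \<alpha> * rho r s \<alpha> \<le> C * rho k s \<alpha>"
    proof -
      obtain r' C where r': "0 < r'" "0 < C" "\<forall>\<alpha> :: nat ^ 'a. 2 ^ mi_abs \<alpha> * phi r' s \<alpha> \<le> C * phi r s \<alpha>"
        using phi_gap_down[OF s(1) False s(2), of r] r by auto
      have "2 ^ mi_abs \<alpha> * rho r s \<alpha> \<le> C * rho r' s \<alpha>" for \<alpha> :: "nat ^ 'a"
        using r'(3) phi_pos[of r s \<alpha>] phi_pos[OF r'(1), of s \<alpha>] r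
        by (simp add: rho pos_divide_le_eq pos_le_divide_eq)
      then show ?thesis using r'(1,2) by auto
    qed
    \<comment> \<open>Inversion exchanges the inequalities of \<open>phi_add\<close>: its upper
      bound for the weight at \<alpha> + \<gamma> gives \<open>super\<close>, its lower bound gives
      \<open>sub\<close>.\<close>
    show "\<exists>k\<in>pos. \<exists>C>0. \<forall>\<alpha> \<gamma> :: nat ^ 'a. rho r s \<alpha> * rho r s \<gamma> \<le> C * rho k s (\<alpha> + \<gamma>)"
    proof -
      have "rho r s \<alpha> * rho r s \<gamma> \<le> 1 * rho (r / k) s (\<alpha> + \<gamma>)" for \<alpha> \<gamma> :: "nat ^ 'a"
        using k(3)[of "r / k" \<alpha> \<gamma>] k1 r phi_pos[of r s \<alpha>] phi_pos[of r s \<gamma>] phi_pos[of "r / k" s "\<alpha> + \<gamma>"]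
        by (simp add: rho frac_le)
      moreover have "r / k \<in> pos" using k1 r by simp
      ultimately show ?thesis using zero_less_one by blast
    qed
    show "\<exists>k\<in>pos. \<exists>C>0. \<forall>\<alpha> \<gamma> :: nat ^ 'a. rho r s (\<alpha> + \<gamma>) \<le> C * (rho k s \<alpha> * rho k s \<gamma>)"
    proof -
      have "rho r s (\<alpha> + \<gamma>) \<le> 1 * (rho (r / k) s \<alpha> * rho (r / k) s \<gamma>)" for \<alpha> \<gamma> :: "nat ^ 'a"
        using k(2)[of r \<alpha> \<gamma>] k1 r phi_pos[of "r / k" s \<alpha>] phi_pos[of "r / k" s \<gamma>] phi_pos[of r s "\<alpha> + \<gamma>"]
        by (simp add: rho frac_le)
      moreover have "r / k \<in> pos" using k1 r by simp
      ultimately show ?thesis using zero_less_one by blast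
    qed
  next
    show "\<exists>r\<in>pos. 0 < rho r s \<alpha>" for \<alpha> :: "nat ^ 'a"
      using phi_pos[of 1 s \<alpha>] by (intro bexI[of _ 1]) (auto simp: rho)
  qed
qed

section \<open>Identification of the spaces\<close>

lemma proj_lim_cong:
  assumes "\<And>i. i \<in> I \<Longrightarrow> X i = Y i" shows "proj_lim I X = proj_lim I Y"
proof (cases "I = {}")
  case False
  have "\<exists>j\<in>I. finer_step (X j) (Y i)" "\<exists>j\<in>I. finer_step (Y j) (X i)" if "i \<in> I" for i
    using assms[OF that] that by (auto intro!: bexI[of _ i] finer_step_refl)
  then show ?thesis by (intro proj_lim_cofinal[OF False False])
qed (simp add: proj_lim_def)

lemma ind_lim_cong: "(\<And>i. i \<in> I \<Longrightarrow> X i = Y i) \<Longrightarrow> ind_lim I X = ind_lim I Y"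
  unfolding ind_lim_def by simp

lemma proj_lim_singleton: "proj_lim {i} X = X i"
proof (rule finer_step_antisym)
  show "finer_step (proj_lim {i} X) (X i)" by (rule finer_step_proj_lim) simp
  have "continuous_map (X i) (proj_lim {i} X) id"
    by (rule continuous_map_into_proj_lim) auto
  then show "finer_step (X i) (proj_lim {i} X)"
    by (simp add: finer_step_def topspace_proj_lim)
qed

text \<open>Local convexity of the step matters, because \<open>ind_lim\<close> keeps only
  absolutely convex zero neighbourhoods. With it, both topologies have the same zero
  neighbourhoods.\<close>

lemma ind_lim_singleton:
  fixes X :: "'i \<Rightarrow> ('b \<Rightarrow> complex) topology"
  assumes X: "lc_top (X i)" shows "ind_lim {i} X = X i"
proof (rule finer_step_antisym)
  have top: "topspace (ind_lim {i} X) = topspace (X i)"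
    using topspace_ind_lim[of "{i}" X] lc_top_zero[OF X] by simp
  have lc: "lc_top (ind_lim {i} X)"
    by (rule lc_top_ind_lim) (use X in auto)
  have nhd: "nhd_zero (ind_lim {i} X) V \<longleftrightarrow> nhd_zero (X i) V" for V
  proof
    show "nhd_zero (X i) V" if "nhd_zero (ind_lim {i} X) V"
      using nhd_zero_ind_limD[OF lc_top_zero[OF X] _ that] by simp
    show "nhd_zero (ind_lim {i} X) V" if V: "nhd_zero (X i) V"
    proof -
      obtain W where W: "W \<subseteq> V" "abs_convex W" "nhd_zero (X i) W" using lc_topD(3)[OF X V] by blast
      have "nhd_zero (ind_lim {i} X) W"
        by (rule nhd_zero_ind_limI) (use X W in auto)
      then show ?thesis using W(1) by (rule nhd_zero_mono)
    qed
  qed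
  have fs: "finer_step Y Z" if "lc_top Y" "lc_top Z" "topspace Y = topspace Z" "\<And>V. nhd_zero Z V \<Longrightarrow> nhd_zero Y V"
    for Y Z :: "('b \<Rightarrow> complex) topology"
  proof -
    have "continuous_map Y Z (\<lambda>x. x)"
    proof (rule continuous_map_lc_top[OF that(1,2)])
      fix V assume "nhd_zero Z V"
      from nhd_zero_Int[OF nhd_zero_topspace[OF lc_top_zero[OF that(1)]] that(4)[OF this]]
      show "nhd_zero Y {c \<in> topspace Y. c \<in> V}" by (simp add: Int_def)
    qed (use that(3) in auto)
    then show ?thesis using that(3) unfolding finer_step_def id_def by blast
  qed
  show "finer_step (ind_lim {i} X) (X i)" by (rule fs[OF lc X top]) (simp only: nhd)
  show "finer_step (X i) (ind_lim {i} X)" by (rule fs[OF X lc top[symmetric]]) (simp only: nhd)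
qed

section \<open>The extension for two weight families in separate variables\<close>

lemma quot_inverse: "quot u (\<lambda>_. 1) = (\<lambda>\<alpha>. ennreal (u \<alpha>))" "quot (\<lambda>_. 1) u = (\<lambda>\<alpha>. inverse (ennreal (u \<alpha>)))"
  by (simp_all add: quot_def fun_eq_iff divide_ennreal_def)

text \<open>The second family is trivial, so the inner limits range over one point. In
  \<open>Q\<close> this projective limit is dropped for every exponent. In \<open>P\<close> it is an
  inductive one, and for p < 1 its step need not be locally convex; therefore the exponent is
  changed to \<infinity> before it is identified with the step.\<close>

lemma diamond_extension_A:
  fixes w1 :: "real \<Rightarrow> nat ^ 'd1::finite \<Rightarrow> real" and w2 :: "real \<Rightarrow> nat ^ 'd2::finite \<Rightarrow> real"
  assumes w2: "weight_family pos w2 mi_abs" and w1: "weight_family pos w1 mi_abs" and p: "0 < p"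
  defines "u \<equiv> \<lambda>r \<alpha>. w2 (fst r) (fst \<alpha>) * w1 (snd r) (snd \<alpha>)"
  defines "P \<equiv> series_space (proj_lim (pos \<times> pos) (\<lambda>r. ell p (\<lambda>\<alpha>. ennreal (u r \<alpha>))))"
    and "Q \<equiv> series_space (ind_lim (pos \<times> pos) (\<lambda>r. ell p (\<lambda>\<alpha>. inverse (ennreal (u r \<alpha>)))))"
  shows "uniquely_extendable hatA_fin diamond P Q Q" and "uniquely_extendable hatA_fin diamond Q P P"
proof -
  have wp: "weight_pair (pos \<times> pos) u mi2_abs {()} (\<lambda>_ _. 1) (\<lambda>_. 0) mi_kernel"
  proof (rule mi_weight_pair)
    show "weight_family (pos \<times> pos) u mi2_abs"
      using weight_family_mult[OF weight_family_pullback[where g = fst, OF w2 fst_add] weight_family_pullback[where g = snd, OF w1 snd_add]]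
      unfolding u_def mi2_abs_def[abs_def] .
  qed (simp_all add: weight_family_trivial)
  interpret weight_pair "pos \<times> pos" u mi2_abs "{()}" "\<lambda>_ _. 1" "\<lambda>_. 0" mi_kernel by (rule wp)
  have "proj_lim (pos \<times> pos) (\<lambda>r. ell q (\<lambda>\<alpha>. ennreal (u r \<alpha>))) = PI \<infinity>" if q: "0 < q" for q
  proof -
    have "proj_lim (pos \<times> pos) (\<lambda>r. ell q (quot (u r) (\<lambda>_. 1))) = proj_lim (pos \<times> pos) (\<lambda>r. wstep (u r) (\<lambda>_. 1))"
    proof (rule finer_step_antisym)
      show "finer_step (proj_lim (pos \<times> pos) (\<lambda>r. ell q (quot (u r) (\<lambda>_. 1)))) (proj_lim (pos \<times> pos) (\<lambda>r. wstep (u r) (\<lambda>_. 1)))"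
        using finer_step_ell_infinity[OF q] by (intro finer_step_proj_limI U.index_ne) blast
      show "finer_step (proj_lim (pos \<times> pos) (\<lambda>r. wstep (u r) (\<lambda>_. 1))) (proj_lim (pos \<times> pos) (\<lambda>r. ell q (quot (u r) (\<lambda>_. 1))))"
        using finer_step_gap(1)[OF q] by (intro finer_step_proj_limI U.index_ne) auto
    qed
    also have "\<dots> = PI \<infinity>"
      unfolding PI_def E_def[abs_def]
      by (intro proj_lim_cong ind_lim_singleton[symmetric] lc_top_step) auto
    finally show ?thesis by (simp only: quot_inverse)
  qed
  then have P: "P = series_space (PI p)"
    unfolding P_def using p PI_exponent[OF p] by simp
  have Q: "Q = series_space (IP p)"
    unfolding Q_def IP_def G_def[abs_def] proj_lim_singleton quot_inverse ..
  show "uniquely_extendable hatA_fin diamond P Q Q" "uniquely_extendable hatA_fin diamond Q P P"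
    unfolding P Q PI_def IP_def E_def[abs_def] G_def[abs_def] by (rule diamond_extension[OF wp p])+
qed

text \<open>The same two families form two weight pairs, since either variable may supply the outer
  weights \<open>u\<close>.\<close>

lemma diamond_extension_BC:
  fixes w1 :: "real \<Rightarrow> nat ^ 'd1::finite \<Rightarrow> real" and w2 :: "real \<Rightarrow> nat ^ 'd2::finite \<Rightarrow> real"
  assumes w2: "weight_family pos w2 mi_abs" and w1: "weight_family pos w1 mi_abs" and p: "0 < p"
  defines "q12 \<equiv> \<lambda>r2 r1 \<alpha>. ennreal (w1 r1 (snd \<alpha>)) / ennreal (w2 r2 (fst \<alpha>))"
    and "q21 \<equiv> \<lambda>r2 r1 \<alpha>. ennreal (w2 r2 (fst \<alpha>)) / ennreal (w1 r1 (snd \<alpha>))"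
  defines "P12 \<equiv> series_space (proj_lim pos (\<lambda>r1. ind_lim pos (\<lambda>r2. ell p (q12 r2 r1))))"
    and "Q12 \<equiv> series_space (ind_lim pos (\<lambda>r1. proj_lim pos (\<lambda>r2. ell p (q21 r2 r1))))"
    and "P21 \<equiv> series_space (proj_lim pos (\<lambda>r2. ind_lim pos (\<lambda>r1. ell p (q21 r2 r1))))"
    and "Q21 \<equiv> series_space (ind_lim pos (\<lambda>r2. proj_lim pos (\<lambda>r1. ell p (q12 r2 r1))))"
  shows "uniquely_extendable hatA_fin diamond P12 Q12 Q12" "uniquely_extendable hatA_fin diamond Q12 P12 P12"
    "uniquely_extendable hatA_fin diamond P21 Q21 Q21" "uniquely_extendable hatA_fin diamond Q21 P21 P21"
proof -
  let ?u1 = "\<lambda>r \<alpha> :: ('d2, 'd1) mi2. w1 r (snd \<alpha>)" and ?u2 = "\<lambda>r \<alpha> :: ('d2, 'd1) mi2. w2 r (fst \<alpha>)"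
  have f1: "weight_family pos ?u1 (\<lambda>\<alpha>. mi_abs (snd \<alpha>))" and f2: "weight_family pos ?u2 (\<lambda>\<alpha>. mi_abs (fst \<alpha>))"
    by (rule weight_family_pullback[where g = snd, OF w1 snd_add]) (rule weight_family_pullback[where g = fst, OF w2 fst_add])
  have q: "quot (?u1 r1) (?u2 r2) = q12 r2 r1" "quot (?u2 r2) (?u1 r1) = q21 r2 r1" for r1 r2
    by (simp_all add: quot_def q12_def q21_def fun_eq_iff)
  have wp1: "weight_pair pos ?u1 (\<lambda>\<alpha>. mi_abs (snd \<alpha>)) pos ?u2 (\<lambda>\<alpha>. mi_abs (fst \<alpha>)) mi_kernel"
    by (rule mi_weight_pair[OF f1 f2]) (simp add: mi2_abs_def)
  have wp2: "weight_pair pos ?u2 (\<lambda>\<alpha>. mi_abs (fst \<alpha>)) pos ?u1 (\<lambda>\<alpha>. mi_abs (snd \<alpha>)) mi_kernel"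
    by (rule mi_weight_pair[OF f2 f1]) (simp add: mi2_abs_def)
  show "uniquely_extendable hatA_fin diamond P12 Q12 Q12" "uniquely_extendable hatA_fin diamond Q12 P12 P12"
    using diamond_extension[OF wp1 p] unfolding q P12_def Q12_def by blast+
  show "uniquely_extendable hatA_fin diamond P21 Q21 Q21" "uniquely_extendable hatA_fin diamond Q21 P21 P21"
    using diamond_extension[OF wp2 p] unfolding q P21_def Q21_def by blast+
qed

text \<open>For general extended factors 0 could meet \<infinity>; here both factors are images of
  reals and hence finite.\<close>

lemma inverse_ennreal_mult: "inverse (ennreal a * ennreal b) = inverse (ennreal a) * inverse (ennreal b)"
  by (cases "ennreal a = 0"; cases "ennreal b = 0") (auto simp: ennreal_inverse_mult ennreal_top_mult ennreal_mult_top)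

lemma inverse_inverse_ennreal: "inverse (inverse (ennreal a)) = ennreal a"
  by (cases "0 < a") (simp_all add: inverse_ennreal ennreal_neg not_less)

text \<open>The \<open>B\<close>-spaces are always of the form \<open>PI\<close> and the
  \<open>C\<close>-spaces of the form \<open>IP\<close>, a \<open>B\<close>-space sharing its outer
  family with the \<open>C\<close>-space of opposite star. For the \<open>A\<close>-spaces the form
  depends on the case: \<open>hatA\<close> is an \<open>IP\<close> and \<open>hatA_star\<close> a
  \<open>PI\<close> space for the inverse weights, while \<open>hatA0\<close> is a \<open>PI\<close>
  and \<open>hatA0_star\<close> an \<open>IP\<close> space for the direct ones.\<close>

theorem theorem4p14:
  fixes s1 s2 :: flat_real and s :: "flat_real \<times> flat_real" and p :: ennreal
    and T :: "('d2::finite, 'd1::finite) fseries \<Rightarrow> ('d2, 'd1) fseries \<Rightarrow> ('d2, 'd1) fseries"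
  assumes p: "0 < p"
    and s1: "s1 \<in> bar_R_flat" and s2: "s2 \<in> bar_R_flat" and s: "s = (s2, s1)"
    and T: "T = diamond"
  shows "(s1 < Reg (1/2) \<and> s2 < Reg (1/2) \<longrightarrow>
            uniquely_extendable hatA_fin T (hatA p s) (hatA_star p s) (hatA_star p s) \<and>
            uniquely_extendable hatA_fin T (hatA_star p s) (hatA p s) (hatA p s) \<and>
            uniquely_extendable hatA_fin T (hatB p s) (hatC_star p s) (hatC_star p s) \<and>
            uniquely_extendable hatA_fin T (hatB_star p s) (hatC p s) (hatC p s) \<and>
            uniquely_extendable hatA_fin T (hatC p s) (hatB_star p s) (hatB_star p s) \<and>
            uniquely_extendable hatA_fin T (hatC_star p s) (hatB p s) (hatB p s)) \<and>
         (Reg 0 < s1 \<and> s1 \<le> Reg (1/2) \<and> Reg 0 < s2 \<and> s2 \<le> Reg (1/2) \<longrightarrow>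
            uniquely_extendable hatA_fin T (hatA0 p s) (hatA0_star p s) (hatA0_star p s) \<and>
            uniquely_extendable hatA_fin T (hatA0_star p s) (hatA0 p s) (hatA0 p s) \<and>
            uniquely_extendable hatA_fin T (hatB0 p s) (hatC0_star p s) (hatC0_star p s) \<and>
            uniquely_extendable hatA_fin T (hatB0_star p s) (hatC0 p s) (hatC0 p s) \<and>
            uniquely_extendable hatA_fin T (hatC0 p s) (hatB0_star p s) (hatB0_star p s) \<and>
            uniquely_extendable hatA_fin T (hatC0_star p s) (hatB0 p s) (hatB0 p s))"
proof (intro conjI[of "_ \<longrightarrow> _" "_ \<longrightarrow> _"] impI)
  assume "s1 < Reg (1/2) \<and> s2 < Reg (1/2)"
  then have w1: "weight_family pos (\<lambda>r. rho r s1 :: nat ^ 'd1 \<Rightarrow> real) mi_abs"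
    and w2: "weight_family pos (\<lambda>r. rho r s2 :: nat ^ 'd2 \<Rightarrow> real) mi_abs"
    using weight_family_rho s1 s2 by blast+
  have theta: "theta2 s r \<alpha> = inverse (ennreal (rho (fst r) s2 (fst \<alpha>) * rho (snd r) s1 (snd \<alpha>)))"
    "1 / theta2 s r \<alpha> = ennreal (rho (fst r) s2 (fst \<alpha>) * rho (snd r) s1 (snd \<alpha>))"
    if "r \<in> pos \<times> pos" for r and \<alpha> :: "('d2, 'd1) mi2"
  proof -
    have r: "0 < fst r" "0 < snd r" using that by auto
    have "theta2 s r \<alpha> = inverse (ennreal (rho (fst r) s2 (fst \<alpha>))) * inverse (ennreal (rho (snd r) s1 (snd \<alpha>)))"
      using r by (simp add: theta2_def s theta_eq_rho)
    also have "\<dots> = inverse (ennreal (rho (fst r) s2 (fst \<alpha>) * rho (snd r) s1 (snd \<alpha>)))"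
      by (simp only: inverse_ennreal_mult ennreal_mult[OF rho_nonneg[OF r(1)] rho_nonneg[OF r(2)]])
    finally show "theta2 s r \<alpha> = inverse (ennreal (rho (fst r) s2 (fst \<alpha>) * rho (snd r) s1 (snd \<alpha>)))" .
    then show "1 / theta2 s r \<alpha> = ennreal (rho (fst r) s2 (fst \<alpha>) * rho (snd r) s1 (snd \<alpha>))"
      by (simp add: divide_ennreal_def inverse_inverse_ennreal)
  qed
  \<comment> \<open>Where both values of \<open>theta\<close> are infinite the quotient is 0, in
    agreement with 0 / 0 = 0 for the inverse weights.\<close>
  have omega: "omega s r2 r1 \<alpha> = ennreal (rho r1 s1 (snd \<alpha>)) / ennreal (rho r2 s2 (fst \<alpha>))"
    "omega_star s r2 r1 \<alpha> = ennreal (rho r2 s2 (fst \<alpha>)) / ennreal (rho r1 s1 (snd \<alpha>))"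
    if "0 < r1" "0 < r2" for r1 r2 and \<alpha> :: "('d2, 'd1) mi2"
    using that by (simp_all add: omega_def omega_star_def s theta_eq_rho divide_ennreal_def inverse_inverse_ennreal mult.commute)
  have A: "hatA p s = series_space (ind_lim (pos \<times> pos) (\<lambda>r. ell p (\<lambda>\<alpha> :: ('d2, 'd1) mi2.
        inverse (ennreal (rho (fst r) s2 (fst \<alpha>) * rho (snd r) s1 (snd \<alpha>))))))"
    "hatA_star p s = series_space (proj_lim (pos \<times> pos) (\<lambda>r. ell p (\<lambda>\<alpha> :: ('d2, 'd1) mi2.
        ennreal (rho (fst r) s2 (fst \<alpha>) * rho (snd r) s1 (snd \<alpha>)))))"
    unfolding hatA_def ell_A_def hatA_star_def ell_A_star_def
    by (intro arg_cong[of _ _ series_space] ind_lim_cong proj_lim_cong arg_cong[of _ _ "ell p"] ext theta; assumption)+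
  have B: "hatB p s = series_space (proj_lim pos (\<lambda>r1. ind_lim pos (\<lambda>r2. ell p (\<lambda>\<alpha> :: ('d2, 'd1) mi2.
        ennreal (rho r1 s1 (snd \<alpha>)) / ennreal (rho r2 s2 (fst \<alpha>))))))"
    "hatC_star p s = series_space (ind_lim pos (\<lambda>r1. proj_lim pos (\<lambda>r2. ell p (\<lambda>\<alpha> :: ('d2, 'd1) mi2.
        ennreal (rho r2 s2 (fst \<alpha>)) / ennreal (rho r1 s1 (snd \<alpha>))))))"
    "hatB_star p s = series_space (proj_lim pos (\<lambda>r2. ind_lim pos (\<lambda>r1. ell p (\<lambda>\<alpha> :: ('d2, 'd1) mi2.
        ennreal (rho r2 s2 (fst \<alpha>)) / ennreal (rho r1 s1 (snd \<alpha>))))))"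
    "hatC p s = series_space (ind_lim pos (\<lambda>r2. proj_lim pos (\<lambda>r1. ell p (\<lambda>\<alpha> :: ('d2, 'd1) mi2.
        ennreal (rho r1 s1 (snd \<alpha>)) / ennreal (rho r2 s2 (fst \<alpha>))))))"
    unfolding hatB_def ell_B_def hatC_star_def ell_C_star_def hatB_star_def ell_B_star_def hatC_def ell_C_def
    by (intro arg_cong[of _ _ series_space] ind_lim_cong proj_lim_cong arg_cong[of _ _ "ell p"] ext omega; simp)+
  show "uniquely_extendable hatA_fin T (hatA p s) (hatA_star p s) (hatA_star p s) \<and>
            uniquely_extendable hatA_fin T (hatA_star p s) (hatA p s) (hatA p s) \<and>
            uniquely_extendable hatA_fin T (hatB p s) (hatC_star p s) (hatC_star p s) \<and>
            uniquely_extendable hatA_fin T (hatB_star p s) (hatC p s) (hatC p s) \<and>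
            uniquely_extendable hatA_fin T (hatC p s) (hatB_star p s) (hatB_star p s) \<and>
            uniquely_extendable hatA_fin T (hatC_star p s) (hatB p s) (hatB p s)"
    unfolding T A B
    by (intro conjI diamond_extension_A[OF w2 w1 p] diamond_extension_BC[OF w2 w1 p])
next
  \<comment> \<open>Indices above zero exclude infinite values of \<open>theta\<close>, so the
    weights themselves are real and serve as the families.\<close>
  assume "Reg 0 < s1 \<and> s1 \<le> Reg (1/2) \<and> Reg 0 < s2 \<and> s2 \<le> Reg (1/2)"
  then have ne: "s1 \<noteq> Reg 0" "s2 \<noteq> Reg 0"
    and w1: "weight_family pos (\<lambda>r. phi r s1 :: nat ^ 'd1 \<Rightarrow> real) mi_abs"
    and w2: "weight_family pos (\<lambda>r. phi r s2 :: nat ^ 'd2 \<Rightarrow> real) mi_abs"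
    using weight_family_phi s1 s2 by blast+
  have theta: "theta2 s r \<alpha> = ennreal (phi (fst r) s2 (fst \<alpha>) * phi (snd r) s1 (snd \<alpha>))"
    "1 / theta2 s r \<alpha> = inverse (ennreal (phi (fst r) s2 (fst \<alpha>) * phi (snd r) s1 (snd \<alpha>)))"
    if "r \<in> pos \<times> pos" for r and \<alpha> :: "('d2, 'd1) mi2"
  proof -
    have r: "0 < fst r" "0 < snd r" using that by auto
    show "theta2 s r \<alpha> = ennreal (phi (fst r) s2 (fst \<alpha>) * phi (snd r) s1 (snd \<alpha>))"
      by (simp only: theta2_def s theta_eq_phi[OF ne(1)] theta_eq_phi[OF ne(2)] fst_conv snd_conv
          ennreal_mult[OF less_imp_le[OF phi_pos[OF r(1)]] less_imp_le[OF phi_pos[OF r(2)]]])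
    then show "1 / theta2 s r \<alpha> = inverse (ennreal (phi (fst r) s2 (fst \<alpha>) * phi (snd r) s1 (snd \<alpha>)))"
      by (simp add: divide_ennreal_def)
  qed
  have omega: "omega s r2 r1 \<alpha> = ennreal (phi r2 s2 (fst \<alpha>)) / ennreal (phi r1 s1 (snd \<alpha>))"
    "omega_star s r2 r1 \<alpha> = ennreal (phi r1 s1 (snd \<alpha>)) / ennreal (phi r2 s2 (fst \<alpha>))"
    for r1 r2 and \<alpha> :: "('d2, 'd1) mi2"
    by (simp_all add: omega_def omega_star_def s theta_eq_phi ne)
  have A: "hatA0 p s = series_space (proj_lim (pos \<times> pos) (\<lambda>r. ell p (\<lambda>\<alpha> :: ('d2, 'd1) mi2.
        ennreal (phi (fst r) s2 (fst \<alpha>) * phi (snd r) s1 (snd \<alpha>)))))"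
    "hatA0_star p s = series_space (ind_lim (pos \<times> pos) (\<lambda>r. ell p (\<lambda>\<alpha> :: ('d2, 'd1) mi2.
        inverse (ennreal (phi (fst r) s2 (fst \<alpha>) * phi (snd r) s1 (snd \<alpha>))))))"
    unfolding hatA0_def ell_A0_def hatA0_star_def ell_A0_star_def
    by (intro arg_cong[of _ _ series_space] ind_lim_cong proj_lim_cong arg_cong[of _ _ "ell p"] ext theta; assumption)+
  show "uniquely_extendable hatA_fin T (hatA0 p s) (hatA0_star p s) (hatA0_star p s) \<and>
            uniquely_extendable hatA_fin T (hatA0_star p s) (hatA0 p s) (hatA0 p s) \<and>
            uniquely_extendable hatA_fin T (hatB0 p s) (hatC0_star p s) (hatC0_star p s) \<and>
            uniquely_extendable hatA_fin T (hatB0_star p s) (hatC0 p s) (hatC0 p s) \<and>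
            uniquely_extendable hatA_fin T (hatC0 p s) (hatB0_star p s) (hatB0_star p s) \<and>
            uniquely_extendable hatA_fin T (hatC0_star p s) (hatB0 p s) (hatB0 p s)"
    unfolding T A hatB0_def ell_B0_def hatB0_star_def ell_B0_star_def hatC0_def ell_C0_def
      hatC0_star_def ell_C0_star_def omega[abs_def]
    by (intro conjI diamond_extension_A[OF w2 w1 p] diamond_extension_BC[OF w2 w1 p])
qed

end
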